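(* Let $\Gamma$ be a compact quantum graph with a loose edge of length $s$, i.e. an edge one of whose ends is a vertex of degree $1$ (this end-vertex is also denoted $s$), with the Dirichlet condition imposed at the end-vertex $s$. Let $\lambda=\lambda(s)$ be a simple eigenvalue of $\Gamma$, considered as a function of the length $s$, and let $f=f_s(x)$ be the corresponding eigenfunction normalized in $L_2(\Gamma)$. Then $$\frac{d\lambda}{ds}=-\left|f'(s)\right|^2,$$ where $f'(s)$ is the value of the derivative of the eigenfunction at the end-vertex.
   Context: A compact quantum graph is a metric graph with finitely many vertices and edges, each edge $e$ being a segment of finite positive length, equipped with the operator $\mathcal{H}$ acting as $-d^2/dx^2+V(x)$ on each edge, where $V\in L_2(\Gamma)$ is real-valued, on functions that belong to $H^2(e)$ on each edge $e$ and satisfy local self-adjoint vertex conditions. Self-adjoint conditions at a vertex $v$ of degree $d_v$ are conditions $A_vF(v)+B_vF'(v)=0$, where $F(v)$ and $F'(v)$ are the column vectors of values and of derivatives (taken into the edges) of $f$ at $v$ along the incident edges, $A_v,B_v$ are $d_v\times d_v$ complex matrices, $(A_v\ B_v)$ has rank $d_v$ and $A_vB_v^*$ is self-adjoint. The Dirichlet condition at a vertex is $f(v)=0$. Eigenvalues of $\Gamma$ are eigenvalues of $\mathcal{H}$. The loose edge is parametrized as $[0,s]$ with $x=s$ the degree-one end-vertex. As $s$ varies, everything else is kept fixed: the rest of the graph, the conditions at all other vertices (arbitrary self-adjoint ones), and the potential, which on the loose edge is the restriction to $[0,s]$ of a fixed function of $x$. *)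

theory Defs
  imports
    "HOL-Analysis.Analysis"
    "Graph_Theory.Digraph"
    "Jordan_Normal_Form.DL_Rank"
    "Jordan_Normal_Form.Schur_Decomposition"
begin

text \<open>
  The orientation of the arcs of \<open>graph\<close> only fixes the parametrization: the edge \<open>e\<close> is the segment
  from \<open>x = 0\<close> at its tail to \<open>x = elen e\<close> at its head.  Loops and multiple edges are allowed.
  The end of \<open>e\<close> at its tail is \<open>(e, False)\<close>, the one at its head is \<open>(e, True)\<close>.
  \<open>star v\<close> enumerates the edge ends at the vertex \<open>v\<close> (a loop occurs twice); it fixes the order in
  which the entries of the vectors \<open>F(v)\<close> and \<open>F'(v)\<close> are listed.
  Only the values of \<open>pot e\<close> on \<open>[0, elen e]\<close> matter, but \<open>pot e\<close> is a function on the real line, so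
  that changing \<open>elen\<close> alone restricts a fixed function of \<open>x\<close> to a different segment.
\<close>
record ('v, 'e) qgraph =
  graph :: "('v, 'e) pre_digraph"
  elen  :: "'e \<Rightarrow> real"
  pot   :: "'e \<Rightarrow> real \<Rightarrow> real"
  star  :: "'v \<Rightarrow> ('e \<times> bool) list"
  condA :: "'v \<Rightarrow> complex mat"
  condB :: "'v \<Rightarrow> complex mat"

definition ends_at :: "('v, 'e) qgraph \<Rightarrow> 'v \<Rightarrow> ('e \<times> bool) set" where
  "ends_at \<Gamma> v = out_arcs (graph \<Gamma>) v \<times> {False} \<union> in_arcs (graph \<Gamma>) v \<times> {True}"

definition degree_at :: "('v, 'e) qgraph \<Rightarrow> 'v \<Rightarrow> nat" where
  "degree_at \<Gamma> v = in_degree (graph \<Gamma>) v + out_degree (graph \<Gamma>) v"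

definition L2_seg :: "real \<Rightarrow> (real \<Rightarrow> 'a::euclidean_space) \<Rightarrow> bool" where
  "L2_seg l h \<longleftrightarrow> h \<in> borel_measurable (lebesgue_on {0..l}) \<and>
     integrable (lebesgue_on {0..l}) (\<lambda>x. (norm (h x))\<^sup>2)"

text \<open>
  \<open>mat_of_cols d (cols A @ cols B)\<close> is the \<open>d \<times> 2d\<close> block matrix \<open>(A B)\<close>.
\<close>
definition self_adjoint_condition :: "nat \<Rightarrow> complex mat \<Rightarrow> complex mat \<Rightarrow> bool" where
  "self_adjoint_condition d A B \<longleftrightarrow>
     A \<in> carrier_mat d d \<and> B \<in> carrier_mat d d \<and>
     vec_space.rank d (mat_of_cols d (cols A @ cols B)) = d \<and>
     mat_adjoint (A * mat_adjoint B) = A * mat_adjoint B"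

locale compact_quantum_graph =
  fixes \<Gamma> :: "('v, 'e) qgraph"
  assumes fin_digraph: "fin_digraph (graph \<Gamma>)"
    and elen_pos: "\<And>e. e \<in> arcs (graph \<Gamma>) \<Longrightarrow> 0 < elen \<Gamma> e"
    and pot_L2: "\<And>e. e \<in> arcs (graph \<Gamma>) \<Longrightarrow> L2_seg (elen \<Gamma> e) (pot \<Gamma> e)"
    and star: "\<And>v. v \<in> verts (graph \<Gamma>) \<Longrightarrow> distinct (star \<Gamma> v) \<and> set (star \<Gamma> v) = ends_at \<Gamma> v"
    and conditions: "\<And>v. v \<in> verts (graph \<Gamma>) \<Longrightarrow>
          self_adjoint_condition (degree_at \<Gamma> v) (condA \<Gamma> v) (condB \<Gamma> v)"

text \<open>
  At an end of the segment this is the one-sided derivative.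
\<close>
definition seg_deriv :: "real \<Rightarrow> (real \<Rightarrow> complex) \<Rightarrow> real \<Rightarrow> complex" where
  "seg_deriv l f x = vector_derivative f (at x within {0..l})"

text \<open>
  \<open>f \<in> H\<^sup>2(0, l)\<close> with weak second derivative \<open>h\<close>.  The Sobolev class is represented by its continuously
  differentiable member, so that the values of \<open>f\<close> and \<open>f'\<close> at the ends make sense:
  \<open>f'\<close> is absolutely continuous with derivative \<open>h \<in> L\<^sub>2(0, l)\<close>.
\<close>
definition H2_seg :: "real \<Rightarrow> (real \<Rightarrow> complex) \<Rightarrow> (real \<Rightarrow> complex) \<Rightarrow> bool" where
  "H2_seg l f h \<longleftrightarrow> L2_seg l h \<and>
     (\<forall>x\<in>{0..l}. f differentiable (at x within {0..l}) \<and>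
        seg_deriv l f x = seg_deriv l f 0 + integral\<^sup>L (lebesgue_on {0..x}) h)"

fun end_value :: "('v, 'e) qgraph \<Rightarrow> ('e \<Rightarrow> real \<Rightarrow> complex) \<Rightarrow> 'e \<times> bool \<Rightarrow> complex" where
  "end_value \<Gamma> f (e, False) = f e 0"
| "end_value \<Gamma> f (e, True) = f e (elen \<Gamma> e)"

text \<open>
  Derivatives are taken into the edge, hence the sign at the head.
\<close>
fun end_deriv :: "('v, 'e) qgraph \<Rightarrow> ('e \<Rightarrow> real \<Rightarrow> complex) \<Rightarrow> 'e \<times> bool \<Rightarrow> complex" where
  "end_deriv \<Gamma> f (e, False) = seg_deriv (elen \<Gamma> e) (f e) 0"
| "end_deriv \<Gamma> f (e, True) = - seg_deriv (elen \<Gamma> e) (f e) (elen \<Gamma> e)"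

definition satisfies_at :: "('v, 'e) qgraph \<Rightarrow> 'v \<Rightarrow> complex Matrix.vec \<Rightarrow> complex Matrix.vec \<Rightarrow> bool" where
  "satisfies_at \<Gamma> v F F' \<longleftrightarrow>
     condA \<Gamma> v *\<^sub>v F + condB \<Gamma> v *\<^sub>v F' = 0\<^sub>v (degree_at \<Gamma> v)"

text \<open>
  The condition at \<open>v\<close> says precisely that all values at \<open>v\<close> vanish.
\<close>
definition dirichlet_at :: "('v, 'e) qgraph \<Rightarrow> 'v \<Rightarrow> bool" where
  "dirichlet_at \<Gamma> v \<longleftrightarrow>
     (\<forall>F \<in> carrier_vec (degree_at \<Gamma> v). \<forall>F' \<in> carrier_vec (degree_at \<Gamma> v).
        satisfies_at \<Gamma> v F F' \<longleftrightarrow> F = 0\<^sub>v (degree_at \<Gamma> v))"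

text \<open>
  A function on \<open>\<Gamma>\<close> is a family of functions on the edges, extended by \<open>0\<close> off \<open>\<Gamma>\<close> so that each
  function on \<open>\<Gamma>\<close> has only one representation.
\<close>
definition ham_dom :: "('v, 'e) qgraph \<Rightarrow> ('e \<Rightarrow> real \<Rightarrow> complex) set" where
  "ham_dom \<Gamma> = {f.
     (\<forall>e x. \<not> (e \<in> arcs (graph \<Gamma>) \<and> x \<in> {0..elen \<Gamma> e}) \<longrightarrow> f e x = 0) \<and>
     (\<forall>e \<in> arcs (graph \<Gamma>). \<exists>h. H2_seg (elen \<Gamma> e) (f e) h) \<and>
     (\<forall>v \<in> verts (graph \<Gamma>). satisfies_at \<Gamma> v
        (vec_of_list (map (end_value \<Gamma> f) (star \<Gamma> v)))
        (vec_of_list (map (end_deriv \<Gamma> f) (star \<Gamma> v))))}"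

text \<open>
  \<open>ham \<Gamma> f u\<close>: \<open>f\<close> is in the domain of \<open>\<H>\<close> and \<open>\<H> f = u\<close> in \<open>L\<^sub>2(\<Gamma>)\<close>, i.e. almost everywhere.
\<close>
definition ham :: "('v, 'e) qgraph \<Rightarrow> ('e \<Rightarrow> real \<Rightarrow> complex) \<Rightarrow> ('e \<Rightarrow> real \<Rightarrow> complex) \<Rightarrow> bool" where
  "ham \<Gamma> f u \<longleftrightarrow> f \<in> ham_dom \<Gamma> \<and>
     (\<forall>e \<in> arcs (graph \<Gamma>). \<exists>h. H2_seg (elen \<Gamma> e) (f e) h \<and>
        (AE x in lebesgue_on {0..elen \<Gamma> e}. u e x = - h x + of_real (pot \<Gamma> e x) * f e x))"

definition eigenspace :: "('v, 'e) qgraph \<Rightarrow> complex \<Rightarrow> ('e \<Rightarrow> real \<Rightarrow> complex) set" where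
  "eigenspace \<Gamma> z = {f. ham \<Gamma> f (\<lambda>e x. z * f e x)}"

definition is_eigenvalue :: "('v, 'e) qgraph \<Rightarrow> complex \<Rightarrow> bool" where
  "is_eigenvalue \<Gamma> z \<longleftrightarrow> (\<exists>f \<in> eigenspace \<Gamma> z. f \<noteq> (\<lambda>e x. 0))"

text \<open>
  The eigenspace is one-dimensional.
\<close>
definition simple_eigenvalue :: "('v, 'e) qgraph \<Rightarrow> complex \<Rightarrow> bool" where
  "simple_eigenvalue \<Gamma> z \<longleftrightarrow>
     (\<exists>f. f \<noteq> (\<lambda>e x. 0) \<and> eigenspace \<Gamma> z = range (\<lambda>c e x. c * f e x))"

definition normalized :: "('v, 'e) qgraph \<Rightarrow> ('e \<Rightarrow> real \<Rightarrow> complex) \<Rightarrow> bool" where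
  "normalized \<Gamma> f \<longleftrightarrow>
     (\<Sum>e \<in> arcs (graph \<Gamma>). integral\<^sup>L (lebesgue_on {0..elen \<Gamma> e}) (\<lambda>x. (norm (f e x))\<^sup>2)) = 1"

definition set_length :: "('v, 'e) qgraph \<Rightarrow> 'e \<Rightarrow> real \<Rightarrow> ('v, 'e) qgraph" where
  "set_length \<Gamma> e s = \<Gamma>\<lparr>elen := (elen \<Gamma>)(e := s)\<rparr>"

text \<open>
  An edge whose end \<open>x = elen e\<close> is a vertex of degree \<open>1\<close>.
\<close>
definition loose_edge :: "('v, 'e) qgraph \<Rightarrow> 'e \<Rightarrow> bool" where
  "loose_edge \<Gamma> e \<longleftrightarrow> e \<in> arcs (graph \<Gamma>) \<and> degree_at \<Gamma> (head (graph \<Gamma>) e) = 1"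

end

theory Submission
  imports Defs
begin

text \<open>
  Let \<open>g\<close> be the normalized eigenfunction at \<open>(\<lambda>\<^sub>0, s\<^sub>0)\<close>, extended by zero along the loose edge.  For
  \<open>(\<alpha>, s)\<close> near \<open>(\<lambda>\<^sub>0, s\<^sub>0)\<close> the bordered problem \<open>- u'' + V u = \<alpha> u - \<kappa> g\<close> on \<open>\<Gamma>\<^sub>s\<close> with all vertex
  conditions and \<open>\<langle>g, u\<rangle> = 1\<close> is a square linear system for the initial data of \<open>u\<close> and for \<open>\<kappa>\<close>; by
  simplicity of \<open>\<lambda>\<^sub>0\<close> it is uniquely solvable, with solution continuous in \<open>(\<alpha>, s)\<close>, and \<open>\<alpha>\<close> is an
  eigenvalue of \<open>\<Gamma>\<^sub>s\<close> if and only if \<open>\<kappa>(\<alpha>, s) = 0\<close>.  Green's identity shows that \<open>\<kappa>\<close> is real, that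
  \<open>\<kappa>(\<alpha>, s\<^sub>0) = \<alpha> - \<lambda>\<^sub>0\<close>, and that \<open>\<kappa>\<close> is strictly increasing in \<open>\<alpha>\<close>, so for each \<open>s\<close> it has exactly one
  zero \<open>\<lambda>(s)\<close> near \<open>\<lambda>\<^sub>0\<close>.  Extend the eigenfunction \<open>u\<close> at \<open>s\<close> beyond the end of the loose edge as a
  solution of the differential equation and let \<open>w\<close> be the eigenfunction at \<open>t\<close>.  Green's identity on
  \<open>\<Gamma>\<^sub>t\<close> reads \<open>(\<lambda>(s) - \<lambda>(t)) \<langle>u, w\<rangle> = cnj (u t) * w' t\<close>; as \<open>u s = 0\<close>, dividing by \<open>t - s\<close> and
  letting \<open>t\<close> tend to \<open>s\<close> gives the derivative.
\<close>

text \<open>A characteristic determinant in (\<alpha>, s) would also describe the eigenvalues, but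
  extracting a curve from its zero set calls for differentiability and for the order of its zeros.
  Bordering by \<open>g\<close> avoids both: the enlarged matrix is invertible at the base point, so
  continuity of its entries suffices, and the scalar \<kappa> obeys exact difference formulas in
  place of derivatives. Its monotonicity in \<alpha> is such a formula, with a factor <U, U> close
  to 1. As V is only square integrable, second derivatives exist merely almost everywhere; hence the
  integral form of the equation and a Green identity for L1 coefficients. All solutions live on
  edges of one fixed length \<open>L\<close> with s0 < L < S, and s only decides where they are
  evaluated. This is possible because the Dirichlet condition makes \<open>g\<close>, continued by
  zero, continuous beyond s0. Continuity of the root in s has to be proved first: the same Green
  identity bounds |lam t - lam s| by a multiple of |u t|, which tends to |u s| = 0. Normalization in
  L2 is restored only at the end, through the factor <u, u>.\<close>

unbundle no vec_syntax

section \<open>The Sturm-Liouville equation with integrable potential\<close>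

lemma absolutely_integrable_mult_continuous:
  fixes q y :: "real \<Rightarrow> complex"
  assumes "q absolutely_integrable_on {a..b}" "continuous_on {a..b} y"
  shows "(\<lambda>x. q x * y x) absolutely_integrable_on {a..b}"
proof -
  have "(\<lambda>x. y x * q x) absolutely_integrable_on {a..b}"
    using assms
    by (intro absolutely_integrable_bounded_measurable_product[OF bilinear_times]
        continuous_imp_measurable_on_sets_lebesgue compact_imp_bounded compact_continuous_image) auto
  then show ?thesis
    by (simp add: mult.commute)
qed

section \<open>Estimates in an exponentially weighted sup norm\<close>

lemma integral_exp_le:
  fixes K x :: real
  assumes "K > 0" "x \<ge> 0"
  shows "integral {0..x} (\<lambda>t. exp (K * t)) \<le> exp (K * x) / K"
proof -
  have "((\<lambda>t. exp (K * t)) has_integral exp (K * x) / K - exp (K * 0) / K) {0..x}"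
    using assms
    by (intro fundamental_theorem_of_calculus)
       (auto intro!: derivative_eq_intros simp: has_real_derivative_iff_has_vector_derivative[symmetric])
  then show ?thesis
    using assms by (simp add: integral_unique)
qed

lemma integral_subinterval_le:
  fixes q :: "real \<Rightarrow> complex"
  assumes "q absolutely_integrable_on {0..l}" "t \<in> {0..l}"
  shows "integral {0..t} (\<lambda>x. norm (q x)) \<le> integral {0..l} (\<lambda>x. norm (q x))"
  using assms by (intro integral_subset_le)
    (auto simp: absolutely_integrable_on_def intro: integrable_on_subinterval)

lemma norm_integral_mult_le:
  fixes q y :: "real \<Rightarrow> complex"
  assumes q: "q absolutely_integrable_on {0..l}" and y: "continuous_on {0..l} y"
    and Q: "integral {0..l} (\<lambda>x. norm (q x)) \<le> Q" and t: "t \<in> {0..l}"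
    and m: "\<And>x. x \<in> {0..t} \<Longrightarrow> norm (y x) \<le> m"
  shows "norm (integral {0..t} (\<lambda>x. q x * y x)) \<le> Q * m"
proof -
  have m0: "0 \<le> m"
    using order_trans[OF norm_ge_zero m[of 0]] t by simp
  have qt: "q absolutely_integrable_on {0..t}"
    using q t by (auto intro: absolutely_integrable_on_subinterval)
  have "(\<lambda>x. q x * y x) integrable_on {0..t}"
    using absolutely_integrable_mult_continuous[OF qt continuous_on_subset[OF y]] t
    by (simp add: absolutely_integrable_on_def)
  moreover have nq: "(\<lambda>x. norm (q x)) integrable_on {0..t}"
    using qt by (simp add: absolutely_integrable_on_def)
  ultimately have "norm (integral {0..t} (\<lambda>x. q x * y x)) \<le> integral {0..t} (\<lambda>x. norm (q x) * m)"
    using m by (intro integral_norm_bound_integral integrable_on_mult_left)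
      (auto simp: norm_mult intro!: mult_left_mono)
  also have "\<dots> = integral {0..t} (\<lambda>x. norm (q x)) * m"
    by simp
  also have "\<dots> \<le> Q * m"
    using integral_subinterval_le[OF q t] Q m0 by (intro mult_right_mono) auto
  finally show ?thesis .
qed

lemma continuous_on_integral_mult:
  fixes q y :: "real \<Rightarrow> complex"
  assumes "q absolutely_integrable_on {0..l}" "continuous_on {0..l} y"
  shows "continuous_on {0..l} (\<lambda>t. integral {0..t} (\<lambda>x. q x * y x))"
  using absolutely_integrable_mult_continuous[OF assms]
  by (intro indefinite_integral_continuous_1) (simp add: absolutely_integrable_on_def)

text \<open>One Picard step measured against the weight exp (K x): the inner integral costs the mass
  Q of \<open>q\<close>, the outer integration of the exponential gains 1 / K, so the factor Q / K
  becomes small by the choice of K.\<close>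

lemma norm_iterated_integral_le:
  fixes q y :: "real \<Rightarrow> complex"
  assumes q: "q absolutely_integrable_on {0..l}" and y: "continuous_on {0..l} y"
    and Q: "integral {0..l} (\<lambda>x. norm (q x)) \<le> Q" and x: "x \<in> {0..l}" and K: "K > 0"
    and m: "\<And>x. x \<in> {0..l} \<Longrightarrow> norm (y x) \<le> m * exp (K * x)"
  shows "norm (integral {0..x} (\<lambda>t. integral {0..t} (\<lambda>s. q s * y s))) \<le> Q * m * exp (K * x) / K"
proof -
  have m0: "0 \<le> m"
    using order_trans[OF norm_ge_zero m[of 0]] x by simp
  have Q0: "0 \<le> Q"
    using Q order_trans[OF integral_nonneg Q] q by (auto simp: absolutely_integrable_on_def)
  have inner: "norm (integral {0..t} (\<lambda>s. q s * y s)) \<le> Q * m * exp (K * t)" if "t \<in> {0..x}" for t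
  proof -
    have "norm (integral {0..t} (\<lambda>s. q s * y s)) \<le> Q * (m * exp (K * t))"
    proof (rule norm_integral_mult_le[OF q y Q])
      show "t \<in> {0..l}" using that x by auto
      fix s assume s: "s \<in> {0..t}"
      then have "norm (y s) \<le> m * exp (K * s)"
        using m[of s] that x by auto
      also have "\<dots> \<le> m * exp (K * t)"
        using s K m0 by (intro mult_left_mono) auto
      finally show "norm (y s) \<le> m * exp (K * t)" .
    qed
    then show ?thesis by (simp add: mult.assoc)
  qed
  have "(\<lambda>t. integral {0..t} (\<lambda>s. q s * y s)) integrable_on {0..x}"
    using continuous_on_subset[OF continuous_on_integral_mult[OF q y]] x
    by (intro integrable_continuous_real) auto
  then have "norm (integral {0..x} (\<lambda>t. integral {0..t} (\<lambda>s. q s * y s)))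
      \<le> integral {0..x} (\<lambda>t. Q * m * exp (K * t))"
    using inner
    by (intro integral_norm_bound_integral) (auto intro!: integrable_continuous_real continuous_intros)
  also have "\<dots> = Q * m * integral {0..x} (\<lambda>t. exp (K * t))"
    by simp
  also have "\<dots> \<le> Q * m * (exp (K * x) / K)"
    using integral_exp_le[OF K] x m0 Q0 by (intro mult_left_mono) auto
  finally show ?thesis by simp
qed

text \<open>At a maximum point of the weighted modulus of \<open>d\<close>, the weighted iterated
  integral is at most half of that maximum and can be absorbed on the left. \<open>G\<close>
  measures how far \<open>d\<close> is from solving the homogeneous equation with zero initial
  data.\<close>

lemma iterated_integral_gronwall:
  fixes q d :: "real \<Rightarrow> complex"
  assumes q: "q absolutely_integrable_on {0..l}" and d: "continuous_on {0..l} d"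
    and Q: "integral {0..l} (\<lambda>x. norm (q x)) \<le> Q"
    and G: "\<And>x. x \<in> {0..l} \<Longrightarrow>
      norm (d x - integral {0..x} (\<lambda>t. integral {0..t} (\<lambda>s. q s * d s))) \<le> G"
    and x: "x \<in> {0..l}"
  shows "norm (d x) \<le> 2 * G * exp ((2 * Q + 1) * l)"
proof -
  \<comment> \<open>This makes Q / K at most 1/2, and the added 1 keeps K positive when Q =
    0.\<close>
  define K where "K = 2 * Q + 1"
  have Q0: "0 \<le> Q"
    using Q order_trans[OF integral_nonneg Q] q by (auto simp: absolutely_integrable_on_def)
  then have K: "K > 0" by (simp add: K_def)
  have "continuous_on {0..l} (\<lambda>x. norm (d x) * exp (- K * x))"
    using d by (intro continuous_intros)
  then obtain \<xi> where \<xi>: "\<xi> \<in> {0..l}"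
    and max: "\<And>x. x \<in> {0..l} \<Longrightarrow> norm (d x) * exp (- K * x) \<le> norm (d \<xi>) * exp (- K * \<xi>)"
    using continuous_attains_sup[of "{0..l}" "\<lambda>x. norm (d x) * exp (- K * x)"] x by auto
  define m where "m = norm (d \<xi>) * exp (- K * \<xi>)"
  have m: "norm (d x) \<le> m * exp (K * x)" if "x \<in> {0..l}" for x
  proof -
    have "norm (d x) = norm (d x) * exp (- K * x) * exp (K * x)"
      by (simp add: exp_minus)
    also have "\<dots> \<le> m * exp (K * x)"
      using max[OF that] by (intro mult_right_mono) (auto simp: m_def)
    finally show ?thesis .
  qed
  have m0: "m \<ge> 0" by (simp add: m_def)
  have G0: "G \<ge> 0"
    using G[OF x] norm_ge_zero order_trans by blast
  have "norm (d \<xi>) \<le> G + Q * m * exp (K * \<xi>) / K"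
    using G[OF \<xi>] norm_iterated_integral_le[OF q d Q \<xi> K m]
      norm_triangle_ineq2[of "d \<xi>" "integral {0..\<xi>} (\<lambda>t. integral {0..t} (\<lambda>s. q s * d s))"]
    by linarith
  then have "m \<le> (G + Q * m * exp (K * \<xi>) / K) * exp (- K * \<xi>)"
    unfolding m_def by (intro mult_right_mono) auto
  also have "\<dots> = G * exp (- K * \<xi>) + Q / K * m"
    using K by (simp add: exp_minus field_simps)
  also have "\<dots> \<le> G * 1 + 1 / 2 * m"
    using G0 K \<xi> Q0 m0
    by (intro add_mono mult_left_mono mult_right_mono) (auto simp: K_def intro: mult_nonpos_nonneg)
  finally have "m \<le> 2 * G" by simp
  have "norm (d x) \<le> m * exp (K * x)" by (rule m[OF x])
  also have "\<dots> \<le> 2 * G * exp (K * l)"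
    using \<open>m \<le> 2 * G\<close> m0 G0 x K by (intro mult_mono) auto
  finally show ?thesis by (simp add: K_def)
qed

section \<open>The initial value problem: existence, linearity, uniqueness\<close>

text \<open>The equation y'' = q y + r as an integrated first-order system with z = y'. Since
  \<open>q\<close> and \<open>r\<close> are merely integrable, the differential form would hold only
  off a null set; the integral form has no exceptional points. \<open>r\<close> will carry the
  forcing term of the bordered problem.\<close>

definition sturm_solution ::
  "real \<Rightarrow> (real \<Rightarrow> complex) \<Rightarrow> (real \<Rightarrow> complex) \<Rightarrow> (real \<Rightarrow> complex) \<Rightarrow> (real \<Rightarrow> complex) \<Rightarrow> bool"
where
  "sturm_solution l q r y z \<longleftrightarrow>
     continuous_on {0..l} y \<and> continuous_on {0..l} z \<and>
     (\<forall>x\<in>{0..l}. y x = y 0 + integral {0..x} z \<and>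
        z x = z 0 + integral {0..x} (\<lambda>t. q t * y t + r t))"

lemma sturm_solutionD:
  assumes "sturm_solution l q r y z"
  shows "continuous_on {0..l} y" "continuous_on {0..l} z"
    and "x \<in> {0..l} \<Longrightarrow> y x = y 0 + integral {0..x} z"
    and "x \<in> {0..l} \<Longrightarrow> z x = z 0 + integral {0..x} (\<lambda>t. q t * y t + r t)"
  using assms unfolding sturm_solution_def by blast+

lemma sturm_solution_restrict:
  "sturm_solution l q r y z \<Longrightarrow> l' \<le> l \<Longrightarrow> sturm_solution l' q r y z"
  unfolding sturm_solution_def
  by (meson atLeastAtMost_iff atLeastatMost_subset_iff continuous_on_subset order_refl order_trans)

lemma sturm_rhs_integrable:
  fixes q r y :: "real \<Rightarrow> complex"
  assumes "q absolutely_integrable_on {0..l}" "r absolutely_integrable_on {0..l}"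
    "continuous_on {0..l} y" "x \<le> l"
  shows "(\<lambda>t. q t * y t + r t) absolutely_integrable_on {0..x}"
  using absolutely_integrable_mult_continuous[OF assms(1,3)] assms(2,4)
  by (intro absolutely_integrable_on_subinterval[OF set_integral_add(1)]) auto

text \<open>
  Picard iteration contracts in the sup norm weighted by \<open>exp (- K x)\<close> once \<open>K\<close> exceeds twice the
  \<open>L\<^sub>1\<close> norm of \<open>q\<close>, so a single fixed point covers the whole segment.
\<close>

lemma sturm_solution_exists:
  assumes q: "q absolutely_integrable_on {0..l}" and r: "r absolutely_integrable_on {0..l}"
    and l: "0 \<le> l"
  obtains y z where "sturm_solution l q r y z" "y 0 = a" "z 0 = b"
proof -
  define Q where "Q = integral {0..l} (\<lambda>x. norm (q x))"
  define K where "K = 2 * Q + 1"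
  have Q0: "0 \<le> Q"
    unfolding Q_def using q by (intro integral_nonneg) (auto simp: absolutely_integrable_on_def)
  then have K: "K > 0" by (simp add: K_def)
  \<comment> \<open>\<open>Z y\<close> is the derivative that the equation prescribes for
    \<open>y\<close>, and \<open>P\<close> integrates it once more. Only \<open>y\<close> is
    iterated; the pair is recovered from the fixed point.\<close>
  define Z where "Z y t = b + integral {0..t} (\<lambda>s. q s * y s + r s)" for y t
  define P where "P y x = a + integral {0..x} (Z y)" for y x
  have int: "(\<lambda>s. q s * y s + r s) integrable_on {0..t}"
    if "continuous_on {0..l} y" "t \<le> l" for y t
    using sturm_rhs_integrable[OF q r that] by (simp add: absolutely_integrable_on_def)
  have contZ: "continuous_on {0..l} (Z y)" if "continuous_on {0..l} y" for y
    unfolding Z_def using int[OF that order_refl]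
    by (intro continuous_intros indefinite_integral_continuous_1)
  have intZ: "Z y integrable_on {0..t}" if "continuous_on {0..l} y" "t \<le> l" for y t
    using continuous_on_subset[OF contZ[OF that(1)]] that(2) by (intro integrable_continuous_real) auto
  have contP: "continuous_on {0..l} (P y)" if "continuous_on {0..l} y" for y
    unfolding P_def using intZ[OF that order_refl]
    by (intro continuous_intros indefinite_integral_continuous_1)
  have Pdiff: "P y x - P w x = integral {0..x} (\<lambda>t. integral {0..t} (\<lambda>s. q s * (y s - w s)))"
    if y: "continuous_on {0..l} y" and w: "continuous_on {0..l} w" and x: "x \<in> {0..l}" for y w x
  proof -
    have "P y x - P w x = integral {0..x} (\<lambda>t. Z y t - Z w t)"
      unfolding P_def using intZ[OF y] intZ[OF w] x by (simp add: integral_diff)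
    also have "\<dots> = integral {0..x} (\<lambda>t. integral {0..t} (\<lambda>s. q s * (y s - w s)))"
    proof (rule integral_cong)
      fix t assume "t \<in> {0..x}"
      then have "t \<le> l"
        using x by simp
      then have "Z y t - Z w t = integral {0..t} (\<lambda>s. (q s * y s + r s) - (q s * w s + r s))"
        unfolding Z_def integral_diff[OF int[OF y \<open>t \<le> l\<close>] int[OF w \<open>t \<le> l\<close>]] by simp
      then show "Z y t - Z w t = integral {0..t} (\<lambda>s. q s * (y s - w s))"
        by (simp add: algebra_simps)
    qed
    finally show ?thesis .
  qed
  \<comment> \<open>Conjugation by the weight: the unknown is y divided by exp (K t), so that the
    plain distance of bounded continuous functions is the weighted distance of the y.\<close>
  define \<Phi> where "\<Phi> v x = exp (- K * x) * P (\<lambda>t. exp (K * t) * apply_bcontfun v t) x"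
    for v :: "real \<Rightarrow>\<^sub>C complex" and x
  have contv: "continuous_on {0..l} (\<lambda>t. exp (K * t) * apply_bcontfun v t)"
    for v :: "real \<Rightarrow>\<^sub>C complex"
    by (intro continuous_intros continuous_on_apply_bcontfun)
  \<comment> \<open>Bounded continuous functions live on the whole line; \<open>clamp\<close>
    continues the values on the segment by constants, and the fixed point is later read on the
    segment only.\<close>
  have "\<exists>g. \<forall>x. apply_bcontfun g x = \<Phi> v (clamp 0 l x)" for v
  proof -
    have "continuous_on (cbox 0 l) (\<Phi> v)"
      unfolding \<Phi>_def box_real by (intro continuous_intros contP contv)
    then show ?thesis
      by (rule continuous_on_cbox_bcontfunE) blast
  qed
  then obtain F where F: "\<And>v x. apply_bcontfun (F v) x = \<Phi> v (clamp 0 l x)"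
    by metis
  have "dist (F v) (F w) \<le> 1 / 2 * dist v w" for v w
  proof (rule dist_bound)
    fix x :: real
    define c where "c = clamp 0 l x"
    have c: "c \<in> {0..l}"
      using clamp_in_interval[of 0 l x] l by (simp add: c_def)
    have "\<Phi> v c - \<Phi> w c = exp (- K * c) * (P (\<lambda>t. exp (K * t) * apply_bcontfun v t) c
        - P (\<lambda>t. exp (K * t) * apply_bcontfun w t) c)"
      by (simp only: \<Phi>_def right_diff_distrib)
    also have "\<dots> = exp (- K * c) * integral {0..c} (\<lambda>t. integral {0..t}
        (\<lambda>s. q s * (exp (K * s) * apply_bcontfun v s - exp (K * s) * apply_bcontfun w s)))"
      by (simp only: Pdiff[OF contv contv c])
    finally have eq: "norm (\<Phi> v c - \<Phi> w c) = exp (- K * c) * norm (integral {0..c}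
        (\<lambda>t. integral {0..t} (\<lambda>s. q s * (exp (K * s) * apply_bcontfun v s - exp (K * s) * apply_bcontfun w s))))"
      by (simp only: norm_mult norm_of_real abs_exp_cancel)
    have "norm (integral {0..c}
        (\<lambda>t. integral {0..t} (\<lambda>s. q s * (exp (K * s) * apply_bcontfun v s - exp (K * s) * apply_bcontfun w s))))
        \<le> Q * dist v w * exp (K * c) / K"
    proof (rule norm_iterated_integral_le[OF q _ _ c K])
      fix s
      have "norm (exp (K * s) * apply_bcontfun v s - exp (K * s) * apply_bcontfun w s)
          = exp (K * s) * dist (apply_bcontfun v s) (apply_bcontfun w s)"
        unfolding dist_norm right_diff_distrib[symmetric] norm_mult by simp
      then show "norm (exp (K * s) * apply_bcontfun v s - exp (K * s) * apply_bcontfun w s)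
          \<le> dist v w * exp (K * s)"
        by (simp add: dist_bounded mult.commute)
    qed (simp_all add: Q_def continuous_on_diff[OF contv contv])
    then have "norm (\<Phi> v c - \<Phi> w c) \<le> exp (- K * c) * (Q * dist v w * exp (K * c) / K)"
      unfolding eq by (intro mult_left_mono) auto
    also have "\<dots> = Q / K * dist v w"
      using K by (simp add: exp_minus field_simps)
    also have "\<dots> \<le> 1 / 2 * dist v w"
      using Q0 by (intro mult_right_mono) (auto simp: K_def field_simps)
    finally show "dist (apply_bcontfun (F v) x) (apply_bcontfun (F w) x) \<le> 1 / 2 * dist v w"
      by (simp add: F c_def dist_norm)
  qed
  then obtain v where v: "F v = v"
    using banach_fix_type[of "1/2" F] by auto
  define y where "y t = exp (K * t) * apply_bcontfun v t" for t
  have y: "continuous_on {0..l} y"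
    unfolding y_def by (rule contv)
  have yP: "y x = P y x" if "x \<in> {0..l}" for x
  proof -
    have "apply_bcontfun v x = \<Phi> v x"
      using F[of v x] that by (simp add: v clamp_cancel_cbox[of x 0 l])
    then have "apply_bcontfun v x = of_real (exp (- K * x)) * P y x"
      by (simp only: \<Phi>_def y_def[abs_def])
    then have "y x = of_real (exp (K * x) * exp (- K * x)) * P y x"
      by (simp only: y_def of_real_mult mult.assoc)
    then show ?thesis
      by (simp add: exp_minus)
  qed
  have y0: "y 0 = a" "Z y 0 = b"
    using yP[of 0] l by (auto simp: P_def Z_def)
  have "sturm_solution l q r y (Z y)"
    unfolding sturm_solution_def
  proof (intro conjI ballI y contZ)
    fix x assume "x \<in> {0..l}"
    then show "y x = y 0 + integral {0..x} (Z y)"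
      using yP[of x] unfolding y0 P_def by simp
    show "Z y x = Z y 0 + integral {0..x} (\<lambda>t. q t * y t + r t)"
      unfolding y0 by (rule Z_def)
  qed
  then show thesis
    using that y0 by blast
qed

lemma sturm_solution_add:
  assumes q: "q absolutely_integrable_on {0..l}"
    and r1: "r1 absolutely_integrable_on {0..l}" and r2: "r2 absolutely_integrable_on {0..l}"
    and s1: "sturm_solution l q r1 y1 z1" and s2: "sturm_solution l q r2 y2 z2"
  shows "sturm_solution l q (\<lambda>x. r1 x + r2 x) (\<lambda>x. y1 x + y2 x) (\<lambda>x. z1 x + z2 x)"
  unfolding sturm_solution_def
proof (intro conjI ballI)
  have cont: "continuous_on {0..l} y1" "continuous_on {0..l} z1"
      "continuous_on {0..l} y2" "continuous_on {0..l} z2"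
    using s1 s2 by (simp_all add: sturm_solution_def)
  then show "continuous_on {0..l} (\<lambda>x. y1 x + y2 x)" "continuous_on {0..l} (\<lambda>x. z1 x + z2 x)"
    by (auto intro!: continuous_on_add)
  fix x assume x: "x \<in> {0..l}"
  have "z1 integrable_on {0..x}" "z2 integrable_on {0..x}"
    using cont x by (auto intro!: integrable_continuous_real intro: continuous_on_subset)
  then have "integral {0..x} (\<lambda>x. z1 x + z2 x) = integral {0..x} z1 + integral {0..x} z2"
    by (rule integral_add)
  moreover have "y1 x = y1 0 + integral {0..x} z1" "y2 x = y2 0 + integral {0..x} z2"
    using s1 s2 x unfolding sturm_solution_def by blast+
  ultimately show "y1 x + y2 x = y1 0 + y2 0 + integral {0..x} (\<lambda>x. z1 x + z2 x)"
    by (simp only: add.assoc add.left_commute)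
  have "(\<lambda>t. q t * y1 t + r1 t) integrable_on {0..x}" "(\<lambda>t. q t * y2 t + r2 t) integrable_on {0..x}"
    using sturm_rhs_integrable[OF q r1 cont(1), of x] sturm_rhs_integrable[OF q r2 cont(3), of x] x
    by (simp_all add: absolutely_integrable_on_def)
  then have "integral {0..x} (\<lambda>t. (q t * y1 t + r1 t) + (q t * y2 t + r2 t))
      = integral {0..x} (\<lambda>t. q t * y1 t + r1 t) + integral {0..x} (\<lambda>t. q t * y2 t + r2 t)"
    by (rule integral_add)
  moreover have "(\<lambda>t. (q t * y1 t + r1 t) + (q t * y2 t + r2 t))
      = (\<lambda>t. q t * (y1 t + y2 t) + (r1 t + r2 t))"
    by (simp add: algebra_simps)
  moreover have "z1 x = z1 0 + integral {0..x} (\<lambda>t. q t * y1 t + r1 t)"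
    and "z2 x = z2 0 + integral {0..x} (\<lambda>t. q t * y2 t + r2 t)"
    using s1 s2 x unfolding sturm_solution_def by blast+
  ultimately show "z1 x + z2 x = z1 0 + z2 0
      + integral {0..x} (\<lambda>t. q t * (y1 t + y2 t) + (r1 t + r2 t))"
    by (simp only: add.assoc add.left_commute)
qed

lemma sturm_solution_cmult:
  assumes "sturm_solution l q r y z"
  shows "sturm_solution l q (\<lambda>x. c * r x) (\<lambda>x. c * y x) (\<lambda>x. c * z x)"
  unfolding sturm_solution_def
proof (intro conjI ballI)
  show "continuous_on {0..l} (\<lambda>x. c * y x)" "continuous_on {0..l} (\<lambda>x. c * z x)"
    using assms by (auto simp: sturm_solution_def intro!: continuous_on_mult_left)
  fix x assume x: "x \<in> {0..l}"
  have "y x = y 0 + integral {0..x} z" "z x = z 0 + integral {0..x} (\<lambda>t. q t * y t + r t)"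
    using assms x unfolding sturm_solution_def by blast+
  then have "c * y x = c * (y 0 + integral {0..x} z)"
    "c * z x = c * (z 0 + integral {0..x} (\<lambda>t. q t * y t + r t))"
    by simp_all
  then show "c * y x = c * y 0 + integral {0..x} (\<lambda>x. c * z x)"
    "c * z x = c * z 0 + integral {0..x} (\<lambda>t. q t * (c * y t) + c * r t)"
    by (simp_all add: distrib_left mult.left_commute flip: integral_mult_right)
qed

lemma sturm_solution_zero: "sturm_solution l q (\<lambda>x. 0) (\<lambda>x. 0) (\<lambda>x. 0)"
  by (simp add: sturm_solution_def)

lemma sturm_solution_sum:
  assumes "q absolutely_integrable_on {0..l}" "finite J"
    and "\<And>j. j \<in> J \<Longrightarrow> r j absolutely_integrable_on {0..l}"
    and "\<And>j. j \<in> J \<Longrightarrow> sturm_solution l q (r j) (y j) (z j)"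
  shows "sturm_solution l q (\<lambda>x. \<Sum>j\<in>J. c j * r j x) (\<lambda>x. \<Sum>j\<in>J. c j * y j x) (\<lambda>x. \<Sum>j\<in>J. c j * z j x)"
  using assms(2-4)
proof (induction J rule: finite_induct)
  case empty
  then show ?case by (simp add: sturm_solution_zero)
next
  case (insert k J)
  have "(\<lambda>x. \<Sum>j\<in>J. c j * r j x) absolutely_integrable_on {0..l}"
    using insert by (intro absolutely_integrable_sum set_integrable_mult_right) auto
  then have "sturm_solution l q (\<lambda>x. c k * r k x + (\<Sum>j\<in>J. c j * r j x))
      (\<lambda>x. c k * y k x + (\<Sum>j\<in>J. c j * y j x)) (\<lambda>x. c k * z k x + (\<Sum>j\<in>J. c j * z j x))"
    using insert.IH insert.prems
    by (intro sturm_solution_add[OF assms(1)] sturm_solution_cmult set_integrable_mult_right) auto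
  then show ?case
    using insert.hyps by simp
qed

lemma sturm_solution_diff:
  assumes "q absolutely_integrable_on {0..l}"
    "r1 absolutely_integrable_on {0..l}" "r2 absolutely_integrable_on {0..l}"
    "sturm_solution l q r1 y1 z1" "sturm_solution l q r2 y2 z2"
  shows "sturm_solution l q (\<lambda>x. r1 x - r2 x) (\<lambda>x. y1 x - y2 x) (\<lambda>x. z1 x - z2 x)"
  using sturm_solution_add[OF assms(1,2) set_integrable_mult_right[OF assms(3)] assms(4)
      sturm_solution_cmult[OF assms(5)], of "-1"] by simp

text \<open>The difference solves the homogeneous equation with zero data, so the Gronwall bound
  applies with G = 0.\<close>

lemma sturm_solution_unique:
  assumes q: "q absolutely_integrable_on {0..l}" and r: "r absolutely_integrable_on {0..l}"
    and "sturm_solution l q r y1 z1" "sturm_solution l q r y2 z2"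
    and init: "y1 0 = y2 0" "z1 0 = z2 0" and x: "x \<in> {0..l}"
  shows "y1 x = y2 x" "z1 x = z2 x"
proof -
  define d where "d t = y1 t - y2 t" for t
  define e where "e t = z1 t - z2 t" for t
  have sol: "sturm_solution l q (\<lambda>x. 0) d e"
    using sturm_solution_diff[OF q r r assms(3,4)] by (simp add: d_def[abs_def] e_def[abs_def])
  have d: "d x = integral {0..x} e" and e: "e x = integral {0..x} (\<lambda>t. q t * d t)"
    if "x \<in> {0..l}" for x
    using sol that init unfolding sturm_solution_def by (auto simp: d_def e_def)
  have d0: "d t = 0" if t: "t \<in> {0..l}" for t
  proof -
    have "norm (d t) \<le> 2 * 0 * exp ((2 * integral {0..l} (\<lambda>x. norm (q x)) + 1) * l)"
    proof (rule iterated_integral_gronwall[OF q _ order_refl _ t])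
      show "continuous_on {0..l} d"
        using sol by (simp add: sturm_solution_def)
      fix x assume x: "x \<in> {0..l}"
      have "integral {0..x} e = integral {0..x} (\<lambda>t. integral {0..t} (\<lambda>s. q s * d s))"
        using x by (intro integral_cong e) auto
      then show "norm (d x - integral {0..x} (\<lambda>t. integral {0..t} (\<lambda>s. q s * d s))) \<le> 0"
        using d[OF x] by simp
    qed
    then show ?thesis by simp
  qed
  then show "y1 x = y2 x"
    using x by (simp add: d_def)
  have "e x = integral {0..x} (\<lambda>t. 0)"
    unfolding e[OF x] using x d0 by (intro integral_cong) auto
  then show "z1 x = z2 x"
    by (simp add: e_def)
qed

section \<open>Continuous dependence on the spectral parameter\<close>

text \<open>Continuity in \<open>x\<close> for each parameter and a Lipschitz bound in the
  parameter, uniform in \<open>x\<close>, add up to joint continuity. The constant may depend on the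
  centre \<mu>, as Gronwall constants do.\<close>

lemma continuous_on_prod_of_locally_Lipschitz:
  fixes F :: "real \<Rightarrow> real \<Rightarrow> complex"
  assumes cont: "\<And>\<mu>. continuous_on S (F \<mu>)"
    and lip: "\<And>\<mu>. \<exists>C. \<forall>\<alpha> x. \<bar>\<alpha> - \<mu>\<bar> \<le> 1 \<longrightarrow> x \<in> S \<longrightarrow> norm (F \<alpha> x - F \<mu> x) \<le> C * \<bar>\<alpha> - \<mu>\<bar>"
  shows "continuous_on (UNIV \<times> S) (\<lambda>p. F (fst p) (snd p))"
  unfolding continuous_on_def
proof
  fix p :: "real \<times> real" assume p: "p \<in> UNIV \<times> S"
  define \<mu> where "\<mu> = fst p"
  let ?A = "at p within UNIV \<times> S"
  obtain C where C: "\<And>\<alpha> x. \<bar>\<alpha> - \<mu>\<bar> \<le> 1 \<Longrightarrow> x \<in> S \<Longrightarrow> norm (F \<alpha> x - F \<mu> x) \<le> C * \<bar>\<alpha> - \<mu>\<bar>"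
    using lip[of \<mu>] by blast
  have id: "((\<lambda>p'. p') \<longlongrightarrow> p) ?A" by (rule tendsto_ident_at)
  have fst: "((\<lambda>p'. C * \<bar>fst p' - \<mu>\<bar>) \<longlongrightarrow> C * \<bar>fst p - \<mu>\<bar>) ?A"
    by (intro tendsto_intros id)
  have "eventually (\<lambda>p'. \<bar>fst p' - \<mu>\<bar> < 1) ?A"
    using order_tendstoD(2)[OF tendsto_rabs[OF tendsto_diff[OF tendsto_fst[OF id] tendsto_const[of \<mu>]]], of 1]
    by (simp add: \<mu>_def)
  moreover have "eventually (\<lambda>p'. p' \<in> UNIV \<times> S) ?A"
    by (simp add: eventually_at_filter)
  ultimately have "eventually (\<lambda>p'. norm (F (fst p') (snd p') - F \<mu> (snd p')) \<le> C * \<bar>fst p' - \<mu>\<bar>) ?A"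
    by eventually_elim (auto intro!: C)
  then have "((\<lambda>p'. F (fst p') (snd p') - F \<mu> (snd p')) \<longlongrightarrow> 0) ?A"
    by (rule Lim_null_comparison) (use fst in \<open>simp add: \<mu>_def\<close>)
  moreover have "continuous_on (UNIV \<times> S) (\<lambda>p'. F \<mu> (snd p'))"
    by (rule continuous_on_compose2[OF cont]) (auto intro: continuous_intros)
  then have "((\<lambda>p'. F \<mu> (snd p')) \<longlongrightarrow> F \<mu> (snd p)) ?A"
    using p unfolding continuous_on_def by blast
  ultimately have "((\<lambda>p'. (F (fst p') (snd p') - F \<mu> (snd p')) + F \<mu> (snd p')) \<longlongrightarrow> 0 + F \<mu> (snd p)) ?A"
    by (rule tendsto_add)
  then show "((\<lambda>p. F (fst p) (snd p)) \<longlongrightarrow> F (fst p) (snd p)) ?A"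
    by (simp add: \<mu>_def)
qed

lemma absolutely_integrable_const_real: "(\<lambda>x. c) absolutely_integrable_on {a..b}"
  for a b :: real and c :: "'a::euclidean_space"
  by (intro absolutely_integrable_continuous_real continuous_on_const)

text \<open>The difference of the solutions for \<alpha> and \<mu> has zero data and satisfies the
  equation for \<alpha> with forcing (\<mu> - \<alpha>) times \<open>Y \<mu>\<close>; Gronwall makes
  it of order |\<alpha> - \<mu>|, uniformly in x.\<close>

lemma sturm_solution_continuous_parameter:
  assumes V: "V absolutely_integrable_on {0..l}" and r: "r absolutely_integrable_on {0..l}"
    and l: "0 \<le> l"
    and sol: "\<And>\<alpha>::real. sturm_solution l (\<lambda>x. V x - of_real \<alpha>) r (Y \<alpha>) (Z \<alpha>)"
    and init: "\<And>\<alpha>. Y \<alpha> 0 = a" "\<And>\<alpha>. Z \<alpha> 0 = b"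
  shows "continuous_on (UNIV \<times> {0..l}) (\<lambda>p. Y (fst p) (snd p))"
    and "continuous_on (UNIV \<times> {0..l}) (\<lambda>p. Z (fst p) (snd p))"
proof -
  have Vl: "(\<lambda>x. V x - of_real \<alpha>) absolutely_integrable_on {0..l}" for \<alpha> :: real
    using V absolutely_integrable_const_real by (rule set_integral_diff(1))
  have contY: "continuous_on {0..l} (Y \<alpha>)" and contZ: "continuous_on {0..l} (Z \<alpha>)" for \<alpha>
    using sol[of \<alpha>] by (simp_all add: sturm_solution_def)
  have key: "\<exists>C. \<forall>\<alpha> x. \<bar>\<alpha> - \<mu>\<bar> \<le> 1 \<longrightarrow> x \<in> {0..l} \<longrightarrow>
      norm (Y \<alpha> x - Y \<mu> x) \<le> C * \<bar>\<alpha> - \<mu>\<bar> \<and> norm (Z \<alpha> x - Z \<mu> x) \<le> C * \<bar>\<alpha> - \<mu>\<bar>" for \<mu>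
  proof -
    have "bounded (Y \<mu> ` {0..l})"
      by (intro compact_imp_bounded compact_continuous_image contY) auto
    then obtain M where M: "M > 0" "\<And>x. x \<in> {0..l} \<Longrightarrow> norm (Y \<mu> x) \<le> M"
      unfolding bounded_pos by auto
    \<comment> \<open>A bound for the L1 norm of V - \<alpha> that serves all \<alpha> within
      distance 1 of \<mu>.\<close>
    define Q where "Q = integral {0..l} (\<lambda>x. norm (V x)) + (\<bar>\<mu>\<bar> + 1) * l"
    \<comment> \<open>The Gronwall bound for a doubly integrated forcing of size M |\<alpha> -
      \<mu>| on a segment of length l, with the factor |\<alpha> - \<mu>| taken out.\<close>
    define C where "C = 2 * (l * (l * M)) * exp ((2 * Q + 1) * l)"
    have nV: "(\<lambda>x. norm (V x)) integrable_on {0..l}"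
      using V by (simp add: absolutely_integrable_on_def)
    have Q0: "Q \<ge> 0"
      unfolding Q_def using l nV by (intro add_nonneg_nonneg integral_nonneg) auto
    have C0: "C \<ge> 0"
      unfolding C_def using l M by simp
    \<comment> \<open>One constant for both components: C alone bounds the values, Q * C + l * M the
      derivatives.\<close>
    have "norm (Y \<alpha> x - Y \<mu> x) \<le> (C + Q * C + l * M) * \<bar>\<alpha> - \<mu>\<bar> \<and>
          norm (Z \<alpha> x - Z \<mu> x) \<le> (C + Q * C + l * M) * \<bar>\<alpha> - \<mu>\<bar>"
      if \<alpha>: "\<bar>\<alpha> - \<mu>\<bar> \<le> 1" and x: "x \<in> {0..l}" for \<alpha> x
    proof -
      define q where "q x = V x - of_real \<alpha>" for x
      define d where "d x = Y \<alpha> x - Y \<mu> x" for x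
      define h where "h x = of_real (\<mu> - \<alpha>) * Y \<mu> x" for x
      have q: "q absolutely_integrable_on {0..l}"
        using Vl by (simp add: q_def[abs_def])
      have "integral {0..l} (\<lambda>x. norm (q x)) \<le> integral {0..l} (\<lambda>x. norm (V x) + (\<bar>\<mu>\<bar> + 1))"
      proof (rule integral_le)
        show "(\<lambda>x. norm (q x)) integrable_on {0..l}"
          using q by (simp add: absolutely_integrable_on_def)
        show "(\<lambda>x. norm (V x) + (\<bar>\<mu>\<bar> + 1)) integrable_on {0..l}"
          by (intro integrable_add nV integrable_const_ivl)
        fix x
        have "norm (q x) \<le> norm (V x) + \<bar>\<alpha>\<bar>"
          using norm_triangle_ineq4[of "V x" "of_real \<alpha>"] by (simp add: q_def)
        then show "norm (q x) \<le> norm (V x) + (\<bar>\<mu>\<bar> + 1)"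
          using \<alpha> by linarith
      qed
      also have "\<dots> = Q"
        using l by (subst integral_add[OF nV integrable_const_ivl]) (simp add: Q_def mult.commute)
      finally have Q: "integral {0..l} (\<lambda>x. norm (q x)) \<le> Q" .
      have contd: "continuous_on {0..l} d"
        unfolding d_def by (intro continuous_on_diff contY)
      have hM: "norm (h x) \<le> \<bar>\<alpha> - \<mu>\<bar> * M" if "x \<in> {0..l}" for x
        using M(2)[OF that] by (auto simp: h_def norm_mult abs_minus_commute simp flip: of_real_diff intro!: mult_left_mono)
      have conth: "continuous_on {0..l} h"
        unfolding h_def by (intro continuous_on_mult_left contY)
      have h_le: "norm (integral {0..x} h) \<le> l * (\<bar>\<alpha> - \<mu>\<bar> * M)" if x: "x \<in> {0..l}" for x
      proof -
        have "norm (integral {0..x} h) \<le> \<bar>\<alpha> - \<mu>\<bar> * M * (x - 0)"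
          using x hM conth by (intro integral_bound) (auto elim: continuous_on_subset)
        also have "\<dots> \<le> \<bar>\<alpha> - \<mu>\<bar> * M * l"
          using x M by (intro mult_left_mono) auto
        finally show ?thesis by (simp add: mult.commute)
      qed
      have qd: "(\<lambda>s. q s * d s) integrable_on {0..x}" and hint: "h integrable_on {0..x}" if "x \<le> l" for x
        using absolutely_integrable_mult_continuous[OF q contd] integrable_continuous_real[OF conth] that
        by (auto simp: absolutely_integrable_on_def intro: integrable_on_subinterval)
      have Zd: "Z \<alpha> x - Z \<mu> x = integral {0..x} (\<lambda>s. q s * d s) + integral {0..x} h"
        if x: "x \<in> {0..l}" for x
      proof -
        have int: "(\<lambda>t. (V t - of_real \<nu>) * Y \<nu> t + r t) integrable_on {0..x}" for \<nu>
          using sturm_rhs_integrable[OF Vl r contY, of x] x by (simp add: absolutely_integrable_on_def)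
        have "Z \<alpha> x - Z \<mu> x = integral {0..x} (\<lambda>t. (V t - of_real \<alpha>) * Y \<alpha> t + r t)
            - integral {0..x} (\<lambda>t. (V t - of_real \<mu>) * Y \<mu> t + r t)"
          using sol[of \<alpha>] sol[of \<mu>] x init(2)[of \<alpha>] init(2)[of \<mu>] unfolding sturm_solution_def by simp
        also have "\<dots> = integral {0..x} (\<lambda>t. ((V t - of_real \<alpha>) * Y \<alpha> t + r t)
            - ((V t - of_real \<mu>) * Y \<mu> t + r t))"
          by (rule integral_diff[OF int int, symmetric])
        also have "\<dots> = integral {0..x} (\<lambda>s. q s * d s + h s)"
          by (intro integral_cong) (simp add: q_def d_def h_def algebra_simps)
        also have "\<dots> = integral {0..x} (\<lambda>s. q s * d s) + integral {0..x} h"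
          using x by (intro integral_add qd hint) auto
        finally show ?thesis .
      qed
      have dY: "norm (d x) \<le> C * \<bar>\<alpha> - \<mu>\<bar>" if x: "x \<in> {0..l}" for x
      proof -
        have "norm (d x) \<le> 2 * (l * (l * (\<bar>\<alpha> - \<mu>\<bar> * M))) * exp ((2 * Q + 1) * l)"
        proof (rule iterated_integral_gronwall[OF q contd Q _ x])
          fix x assume x: "x \<in> {0..l}"
          have int: "(\<lambda>t. integral {0..t} (\<lambda>s. q s * d s)) integrable_on {0..x}"
            "(\<lambda>t. integral {0..t} h) integrable_on {0..x}"
            using x qd[of x] hint[of x]
            by (auto intro!: integrable_continuous_real indefinite_integral_continuous_1)
          have Zint: "Z \<nu> integrable_on {0..x}" for \<nu>
            using x by (auto intro!: integrable_continuous_real continuous_on_subset[OF contZ])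
          have "d x = integral {0..x} (Z \<alpha>) - integral {0..x} (Z \<mu>)"
            using sol[of \<alpha>] sol[of \<mu>] x init(1)[of \<alpha>] init(1)[of \<mu>]
            unfolding sturm_solution_def d_def by simp
          also have "\<dots> = integral {0..x} (\<lambda>t. Z \<alpha> t - Z \<mu> t)"
            by (rule integral_diff[OF Zint Zint, symmetric])
          also have "\<dots> = integral {0..x} (\<lambda>t. integral {0..t} (\<lambda>s. q s * d s) + integral {0..t} h)"
            using x by (intro integral_cong Zd) auto
          also have "\<dots> = integral {0..x} (\<lambda>t. integral {0..t} (\<lambda>s. q s * d s))
              + integral {0..x} (\<lambda>t. integral {0..t} h)"
            by (rule integral_add[OF int])
          finally have "norm (d x - integral {0..x} (\<lambda>t. integral {0..t} (\<lambda>s. q s * d s)))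
              = norm (integral {0..x} (\<lambda>t. integral {0..t} h))"
            by simp
          also have "\<dots> \<le> l * (\<bar>\<alpha> - \<mu>\<bar> * M) * (x - 0)"
            using x h_le hint[of x] by (intro integral_bound indefinite_integral_continuous_1) auto
          also have "\<dots> \<le> l * (\<bar>\<alpha> - \<mu>\<bar> * M) * l"
            using x M l by (intro mult_left_mono) auto
          finally show "norm (d x - integral {0..x} (\<lambda>t. integral {0..t} (\<lambda>s. q s * d s)))
              \<le> l * (l * (\<bar>\<alpha> - \<mu>\<bar> * M))"
            by (simp add: mult.commute)
        qed
        then show ?thesis by (simp add: C_def ac_simps)
      qed
      have "norm (Z \<alpha> x - Z \<mu> x) \<le> Q * (C * \<bar>\<alpha> - \<mu>\<bar>) + l * (\<bar>\<alpha> - \<mu>\<bar> * M)"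
        unfolding Zd[OF x]
        using norm_triangle_ineq[of "integral {0..x} (\<lambda>s. q s * d s)" "integral {0..x} h"] h_le[OF x]
          norm_integral_mult_le[OF q contd Q x, of "C * \<bar>\<alpha> - \<mu>\<bar>"] dY x by fastforce
      moreover have "0 \<le> C * \<bar>\<alpha> - \<mu>\<bar>" "0 \<le> Q * (C * \<bar>\<alpha> - \<mu>\<bar>)" "0 \<le> l * (\<bar>\<alpha> - \<mu>\<bar> * M)"
        using C0 Q0 l M by auto
      ultimately show ?thesis
        using dY[OF x] unfolding d_def by (auto simp: algebra_simps)
    qed
    then show ?thesis by blast
  qed
  show "continuous_on (UNIV \<times> {0..l}) (\<lambda>p. Y (fst p) (snd p))"
    using key by (intro continuous_on_prod_of_locally_Lipschitz contY) meson
  show "continuous_on (UNIV \<times> {0..l}) (\<lambda>p. Z (fst p) (snd p))"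
    using key by (intro continuous_on_prod_of_locally_Lipschitz contZ) meson
qed

section \<open>Integration by parts and the Lagrange identity\<close>

lemma indefinite_integral_increment:
  fixes f f' :: "real \<Rightarrow> 'a::euclidean_space"
  assumes "0 \<le> a" "a \<le> b" "f' integrable_on {0..b}"
    and "f a = f 0 + integral {0..a} f'" "f b = f 0 + integral {0..b} f'"
  shows "f b - f a = integral {a..b} f'"
  using Henstock_Kurzweil_Integration.integral_combine[OF assms(1-3)]
  unfolding assms(4,5) by (simp add: algebra_simps)

text \<open>
  No almost-everywhere differentiation is needed: the difference of the two sides, as a function of
  the upper limit, changes by at most a multiple of \<open>(b - a) \<integral>\<^sub>a\<^sup>b \<bar>h\<bar>\<close> on \<open>[a, b]\<close>, so its
  derivative vanishes everywhere.
\<close>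

lemma integral_by_parts_absolutely_integrable:
  fixes y z w h :: "real \<Rightarrow> complex"
  assumes z: "continuous_on {0..l} z" and h: "h absolutely_integrable_on {0..l}" and l: "0 \<le> l"
    and y_eq: "\<And>x. x \<in> {0..l} \<Longrightarrow> y x = y 0 + integral {0..x} z"
    and w_eq: "\<And>x. x \<in> {0..l} \<Longrightarrow> w x = w 0 + integral {0..x} h"
  shows "integral {0..l} (\<lambda>t. z t * w t + y t * h t) = y l * w l - y 0 * w 0"
proof -
  have hint: "h integrable_on {a..b}" and nhint: "(\<lambda>x. norm (h x)) integrable_on {a..b}"
    and zint: "z integrable_on {a..b}" if "0 \<le> a" "b \<le> l" for a b
    using that h integrable_continuous_real[OF z]
    by (auto simp: absolutely_integrable_on_def intro: integrable_on_subinterval)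
  have "continuous_on {0..l} (\<lambda>x. w 0 + integral {0..x} h)"
    by (intro continuous_intros indefinite_integral_continuous_1 hint) auto
  then have w: "continuous_on {0..l} w"
    by (rule continuous_on_eq) (rule w_eq[symmetric])
  have "continuous_on {0..l} (\<lambda>x. y 0 + integral {0..x} z)"
    by (intro continuous_intros indefinite_integral_continuous_1 zint) auto
  then have y: "continuous_on {0..l} y"
    by (rule continuous_on_eq) (rule y_eq[symmetric])
  define g where "g t = z t * w t + y t * h t" for t
  have "(\<lambda>t. h t * y t + w t * z t) absolutely_integrable_on {0..l}"
    by (intro set_integral_add(1) absolutely_integrable_mult_continuous h y
        absolutely_integrable_continuous_real continuous_on_mult w z)
  then have gint: "g integrable_on {a..b}" if "0 \<le> a" "b \<le> l" for a b
    using that unfolding g_def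
    by (auto simp: absolutely_integrable_on_def algebra_simps intro: integrable_on_subinterval)
  obtain B where B: "B > 0" "\<And>x. x \<in> {0..l} \<Longrightarrow> norm (z x) \<le> B"
    using compact_imp_bounded[OF compact_continuous_image[OF z]] unfolding bounded_pos by auto
  define H where "H x = integral {0..x} (\<lambda>t. norm (h t))" for x
  have H: "continuous_on {0..l} H"
    unfolding H_def using nhint by (intro indefinite_integral_continuous_1) auto
  have y_incr: "y b - y a = integral {a..b} z" and w_incr: "w b - w a = integral {a..b} h"
    and H_incr: "H b - H a = integral {a..b} (\<lambda>t. norm (h t))" if "0 \<le> a" "a \<le> b" "b \<le> l" for a b
    using that zint hint nhint
    by (auto intro!: indefinite_integral_increment[OF that(1,2)] y_eq w_eq simp: H_def)
  define D where "D x = y x * w x - integral {0..x} g" for x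
  have D_incr: "norm (D b - D a) \<le> 2 * B * (b - a) * (H b - H a)"
    if ab: "0 \<le> a" "a \<le> b" "b \<le> l" for a b
  proof -
    \<comment> \<open>The increment of the product is split with \<open>w\<close> frozen at a and
      \<open>y\<close> frozen at b. After subtraction of g, each remaining term contains an
      increment of \<open>w\<close> or of \<open>y\<close> over a part of [a, b], which supplies the
      second small factor.\<close>
    have "D b - D a = w a * (y b - y a) + y b * (w b - w a) - (integral {0..b} g - integral {0..a} g)"
      by (simp add: D_def algebra_simps)
    also have "integral {0..b} g - integral {0..a} g = integral {a..b} g"
      using ab gint by (intro indefinite_integral_increment) auto
    also have "w a * (y b - y a) + y b * (w b - w a) - integral {a..b} g
        = integral {a..b} (\<lambda>t. w a * z t + y b * h t - g t)"
      unfolding y_incr[OF ab] w_incr[OF ab]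
      using ab zint[of a b] hint[of a b] gint[of a b]
      by (subst Henstock_Kurzweil_Integration.integral_diff;
          (subst Henstock_Kurzweil_Integration.integral_add)?;
          auto intro!: integrable_add integrable_on_mult_right)
    also have "norm \<dots> \<le> integral {a..b} (\<lambda>t. B * (H b - H a) + B * (b - a) * norm (h t))"
    proof (rule integral_norm_bound_integral)
      show "(\<lambda>t. w a * z t + y b * h t - g t) integrable_on {a..b}"
        using ab zint[of a b] hint[of a b] gint[of a b]
        by (intro integrable_diff integrable_add integrable_on_mult_right) auto
      show "(\<lambda>t. B * (H b - H a) + B * (b - a) * norm (h t)) integrable_on {a..b}"
        using ab nhint[of a b] by (intro integrable_add integrable_on_mult_right integrable_const_ivl) auto
      fix t assume t: "t \<in> {a..b}"
      have "norm (w t - w a) \<le> integral {a..t} (\<lambda>s. norm (h s))"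
        using t ab w_incr[of a t] hint[of a t] nhint[of a t]
        by (auto intro!: integral_norm_bound_integral)
      also have "\<dots> = H t - H a"
        using t ab by (intro H_incr[symmetric]) auto
      also have "\<dots> \<le> H b - H a"
        using t ab nhint[of t b] H_incr[of t b] integral_nonneg[of "\<lambda>s. norm (h s)" "{t..b}"] by auto
      finally have 1: "norm (w t - w a) \<le> H b - H a" .
      have "norm (y b - y t) \<le> B * (b - t)"
        using t ab B(2) y_incr[of t b]
        by (auto intro!: integral_bound continuous_on_subset[OF z])
      also have "\<dots> \<le> B * (b - a)"
        using t B by (intro mult_left_mono) auto
      finally have 2: "norm (y b - y t) \<le> B * (b - a)" .
      have "w a * z t + y b * h t - g t = z t * (w a - w t) + (y b - y t) * h t"
        by (simp add: g_def algebra_simps)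
      also have "norm \<dots> \<le> norm (z t) * norm (w t - w a) + norm (y b - y t) * norm (h t)"
        by (rule norm_triangle_le) (simp add: norm_mult norm_minus_commute)
      also have "\<dots> \<le> B * (H b - H a) + B * (b - a) * norm (h t)"
        using 1 2 B(1) B(2)[of t] t ab by (intro add_mono mult_mono) auto
      finally show "norm (w a * z t + y b * h t - g t) \<le> B * (H b - H a) + B * (b - a) * norm (h t)" .
    qed
    also have "\<dots> = B * (H b - H a) * (b - a) + B * (b - a) * integral {a..b} (\<lambda>t. norm (h t))"
      using ab nhint[of a b]
      by (subst Henstock_Kurzweil_Integration.integral_add)
        (auto intro!: integrable_on_mult_right)
    also have "\<dots> = 2 * B * (b - a) * (H b - H a)"
      unfolding H_incr[OF ab, symmetric] by (simp add: algebra_simps)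
    finally show ?thesis .
  qed
  have D_deriv: "(D has_derivative (\<lambda>h. 0)) (at x within {0..l})" if x: "x \<in> {0..l}" for x
    unfolding has_derivative_within_alt
  proof (intro conjI allI impI bounded_linear_zero)
    fix e :: real assume e: "e > 0"
    then have "e / (2 * B) > 0" using B by simp
    \<comment> \<open>Continuity of \<open>H\<close> alone makes this factor small; \<open>h\<close>
      has no pointwise bound.\<close>
    then obtain d where d: "d > 0" "\<And>x'. x' \<in> {0..l} \<Longrightarrow> dist x' x < d \<Longrightarrow> dist (H x') (H x) < e / (2 * B)"
      using H x unfolding continuous_on_iff by meson
    show "\<exists>d>0. \<forall>y\<in>{0..l}. norm (y - x) < d \<longrightarrow> norm (D y - D x - 0) \<le> e * norm (y - x)"
    proof (intro exI[of _ d] conjI ballI impI d)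
      fix x' assume x': "x' \<in> {0..l}" "norm (x' - x) < d"
      then have Hd: "\<bar>H x' - H x\<bar> \<le> e / (2 * B)"
        using d(2)[of x'] by (auto simp: dist_real_def)
      have "norm (D x' - D x) \<le> 2 * B * \<bar>x' - x\<bar> * \<bar>H x' - H x\<bar>"
      proof (cases "x \<le> x'")
        case True
        then have "norm (D x' - D x) \<le> 2 * B * (x' - x) * (H x' - H x)"
          using x x' by (intro D_incr) auto
        also have "\<dots> \<le> 2 * B * \<bar>x' - x\<bar> * \<bar>H x' - H x\<bar>"
          using True B by (auto intro!: mult_left_mono)
        finally show ?thesis .
      next
        case False
        then have "norm (D x - D x') \<le> 2 * B * (x - x') * (H x - H x')"
          using x x' by (intro D_incr) auto
        also have "\<dots> \<le> 2 * B * \<bar>x - x'\<bar> * \<bar>H x - H x'\<bar>"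
          using False B by (auto intro!: mult_left_mono)
        finally show ?thesis by (simp add: norm_minus_commute abs_minus_commute)
      qed
      also have "\<dots> \<le> 2 * B * \<bar>x' - x\<bar> * (e / (2 * B))"
        using Hd B by (intro mult_left_mono) auto
      also have "\<dots> = e * norm (x' - x)"
        using B by simp
      finally show "norm (D x' - D x - 0) \<le> e * norm (x' - x)" by simp
    qed
  qed
  obtain c where "\<And>x. x \<in> {0..l} \<Longrightarrow> D x = c"
    using has_derivative_zero_constant[of "{0..l}" D] D_deriv by auto
  then have "D l = D 0"
    using l by simp
  then show ?thesis
    using l unfolding g_def[symmetric] by (simp add: D_def algebra_simps)
qed

text \<open>Two integrations by parts, one for cnj y1 z2 and one for y2 cnj z1; on subtraction the
  products of first derivatives cancel. Distinct coefficients accommodate two spectral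
  parameters.\<close>

lemma sturm_lagrange_identity:
  assumes q1: "q1 absolutely_integrable_on {0..l}" and q2: "q2 absolutely_integrable_on {0..l}"
    and r1: "r1 absolutely_integrable_on {0..l}" and r2: "r2 absolutely_integrable_on {0..l}"
    and l: "0 \<le> l"
    and s1: "sturm_solution l q1 r1 y1 z1" and s2: "sturm_solution l q2 r2 y2 z2"
  shows "integral {0..l} (\<lambda>t. cnj (y1 t) * (q2 t * y2 t + r2 t) - cnj (q1 t * y1 t + r1 t) * y2 t)
    = (cnj (y1 l) * z2 l - cnj (z1 l) * y2 l) - (cnj (y1 0) * z2 0 - cnj (z1 0) * y2 0)"
proof -
  define h1 where "h1 t = q1 t * y1 t + r1 t" for t
  define h2 where "h2 t = q2 t * y2 t + r2 t" for t
  have c: "continuous_on {0..l} y1" "continuous_on {0..l} z1" "continuous_on {0..l} y2" "continuous_on {0..l} z2"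
    using s1 s2 by (simp_all add: sturm_solution_def)
  have h: "h1 absolutely_integrable_on {0..l}" "h2 absolutely_integrable_on {0..l}"
    unfolding h1_def h2_def using c
    by (auto intro: sturm_rhs_integrable[OF q1 r1] sturm_rhs_integrable[OF q2 r2])
  have hc: "(\<lambda>t. cnj (h1 t)) absolutely_integrable_on {0..l}"
    using h(1) by (intro absolutely_integrable_linear[OF _ bounded_linear_cnj, unfolded o_def])
  have e: "y1 x = y1 0 + integral {0..x} z1" "z1 x = z1 0 + integral {0..x} h1"
    "y2 x = y2 0 + integral {0..x} z2" "z2 x = z2 0 + integral {0..x} h2" if "x \<in> {0..l}" for x
    using s1 s2 that unfolding sturm_solution_def h1_def h2_def by blast+
  have "integral {0..l} (\<lambda>t. cnj (z1 t) * z2 t + cnj (y1 t) * h2 t) = cnj (y1 l) * z2 l - cnj (y1 0) * z2 0"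
  proof (rule integral_by_parts_absolutely_integrable[OF _ h(2) l])
    fix x assume "x \<in> {0..l}"
    then show "z2 x = z2 0 + integral {0..x} h2" by (rule e)
    show "cnj (y1 x) = cnj (y1 0) + integral {0..x} (\<lambda>t. cnj (z1 t))"
      using arg_cong[OF e(1)[OF \<open>x \<in> {0..l}\<close>], of cnj] by (simp add: integral_cnj)
  qed (intro continuous_on_cnj c)
  moreover have "integral {0..l} (\<lambda>t. z2 t * cnj (z1 t) + y2 t * cnj (h1 t)) = y2 l * cnj (z1 l) - y2 0 * cnj (z1 0)"
  proof (rule integral_by_parts_absolutely_integrable[OF c(4) hc l])
    fix x assume "x \<in> {0..l}"
    then show "y2 x = y2 0 + integral {0..x} z2" by (rule e)
    show "cnj (z1 x) = cnj (z1 0) + integral {0..x} (\<lambda>t. cnj (h1 t))"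
      using arg_cong[OF e(2)[OF \<open>x \<in> {0..l}\<close>], of cnj] by (simp add: integral_cnj)
  qed
  moreover have "(\<lambda>t. cnj (z1 t) * z2 t + cnj (y1 t) * h2 t) integrable_on {0..l}"
  proof -
    have "(\<lambda>t. h2 t * cnj (y1 t) + cnj (z1 t) * z2 t) absolutely_integrable_on {0..l}"
      by (intro set_integral_add(1) absolutely_integrable_mult_continuous h
          absolutely_integrable_continuous_real continuous_on_mult continuous_on_cnj c)
    then show ?thesis
      by (simp add: absolutely_integrable_on_def algebra_simps)
  qed
  moreover have "(\<lambda>t. z2 t * cnj (z1 t) + y2 t * cnj (h1 t)) integrable_on {0..l}"
  proof -
    have "(\<lambda>t. cnj (h1 t) * y2 t + z2 t * cnj (z1 t)) absolutely_integrable_on {0..l}"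
      by (intro set_integral_add(1) absolutely_integrable_mult_continuous hc
          absolutely_integrable_continuous_real continuous_on_mult continuous_on_cnj c)
    then show ?thesis
      by (simp add: absolutely_integrable_on_def algebra_simps)
  qed
  ultimately have "integral {0..l} (\<lambda>t. (cnj (z1 t) * z2 t + cnj (y1 t) * h2 t)
        - (z2 t * cnj (z1 t) + y2 t * cnj (h1 t)))
      = (cnj (y1 l) * z2 l - cnj (y1 0) * z2 0) - (y2 l * cnj (z1 l) - y2 0 * cnj (z1 0))"
    by (subst Henstock_Kurzweil_Integration.integral_diff) auto
  then show ?thesis
    unfolding h1_def[symmetric] h2_def[symmetric] by (simp add: algebra_simps)
qed

section \<open>Linear systems and self-adjoint vertex conditions\<close>

lemma continuous_on_det:
  fixes N :: "'p::topological_space \<Rightarrow> complex mat"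
  assumes carrier: "\<And>p. N p \<in> carrier_mat n n"
    and cont: "\<And>i j. i < n \<Longrightarrow> j < n \<Longrightarrow> continuous_on P (\<lambda>p. N p $$ (i, j))"
  shows "continuous_on P (\<lambda>p. Determinant.det (N p))"
  unfolding det_def'[OF carrier]
proof (intro continuous_on_sum continuous_on_mult continuous_on_prod continuous_on_const)
  fix \<pi> i assume "\<pi> \<in> {\<pi>. \<pi> permutes {0..<n}}" "i \<in> {0..<n}"
  then have "i < n" "\<pi> i < n"
    using permutes_in_image[of \<pi> "{0..<n}" i] by auto
  then show "continuous_on P (\<lambda>p. N p $$ (i, \<pi> i))"
    by (rule cont)
qed

lemma continuous_on_adj_mat:
  fixes N :: "'p::topological_space \<Rightarrow> complex mat"
  assumes carrier: "\<And>p. N p \<in> carrier_mat n n"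
    and cont: "\<And>i j. i < n \<Longrightarrow> j < n \<Longrightarrow> continuous_on P (\<lambda>p. N p $$ (i, j))"
    and ij: "i < n" "j < n"
  shows "continuous_on P (\<lambda>p. adj_mat (N p) $$ (i, j))"
proof -
  have "continuous_on P (\<lambda>p. Determinant.det (mat_delete (N p) j i))"
  proof (rule continuous_on_det)
    show "mat_delete (N p) j i \<in> carrier_mat (n - 1) (n - 1)" for p
      using carrier[of p] unfolding mat_delete_def by auto
    fix i' j' assume "i' < n - 1" "j' < n - 1"
    then show "continuous_on P (\<lambda>p. mat_delete (N p) j i $$ (i', j'))"
      using carrier_matD[OF carrier] by (auto simp: mat_delete_def intro!: cont)
  qed
  moreover have "adj_mat (N p) $$ (i, j) = (- 1) ^ (j + i) * Determinant.det (mat_delete (N p) j i)" for p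
    using carrier[of p] ij by (auto simp: adj_mat_def cofactor_def)
  ultimately show ?thesis
    by (simp add: continuous_on_mult_left)
qed

text \<open>Injectivity at \<open>q\<close> means a nonzero determinant. By continuity the
  determinant stays nonzero on an open set, where Cramer's rule gives the solution as a continuous
  function. Rows and columns keep their own index sets and are numbered only inside the
  proof.\<close>

lemma continuous_linear_system:
  fixes M :: "'i \<Rightarrow> 'j \<Rightarrow> 'p::topological_space \<Rightarrow> complex" and b :: "'i \<Rightarrow> complex"
  assumes fin: "finite I" "finite J" and card: "card I = card J"
    and P: "open P" "q \<in> P"
    and cont: "\<And>i j. i \<in> I \<Longrightarrow> j \<in> J \<Longrightarrow> continuous_on P (M i j)"
    and inj: "\<And>x. (\<And>i. i \<in> I \<Longrightarrow> (\<Sum>j\<in>J. M i j q * x j) = 0) \<Longrightarrow> \<forall>j\<in>J. x j = 0"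
  obtains T X where "open T" "q \<in> T" "T \<subseteq> P"
    and "\<And>p x. p \<in> T \<Longrightarrow> (\<And>i. i \<in> I \<Longrightarrow> (\<Sum>j\<in>J. M i j p * x j) = 0) \<Longrightarrow> \<forall>j\<in>J. x j = 0"
    and "\<And>j. j \<in> J \<Longrightarrow> continuous_on T (X j)"
    and "\<And>p i. p \<in> T \<Longrightarrow> i \<in> I \<Longrightarrow> (\<Sum>j\<in>J. M i j p * X j p) = b i"
proof -
  define n where "n = card I"
  obtain f where f: "bij_betw f {0..<n} I"
    using ex_bij_betw_nat_finite[OF fin(1)] unfolding n_def by blast
  obtain g where g: "bij_betw g {0..<n} J"
    using ex_bij_betw_nat_finite[OF fin(2)] unfolding n_def card by blast
  define N where "N p = Matrix.mat n n (\<lambda>(i, j). M (f i) (g j) p)" for p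
  have N: "N p \<in> carrier_mat n n" for p
    by (simp add: N_def)
  have fI: "f i \<in> I" and gJ: "g i \<in> J" if "i < n" for i
    using that f g by (auto simp: bij_betw_def)
  have Ncont: "continuous_on P (\<lambda>p. N p $$ (i, j))" if "i < n" "j < n" for i j
    using that cont[OF fI gJ] by (simp add: N_def)
  have mult: "(N p *\<^sub>v v) $ k = (\<Sum>j\<in>J. M (f k) j p * x j)"
    if "k < n" "v \<in> carrier_vec n" "\<And>i. i < n \<Longrightarrow> v $ i = x (g i)" for p k v x
  proof -
    have "(N p *\<^sub>v v) $ k = (\<Sum>i=0..<n. M (f k) (g i) p * x (g i))"
      using that by (auto simp: N_def scalar_prod_def intro!: sum.cong)
    also have "\<dots> = (\<Sum>j\<in>J. M (f k) j p * x j)"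
      by (rule sum.reindex_bij_betw[OF g])
    finally show ?thesis .
  qed
  have inj_iff: "Determinant.det (N p) \<noteq> 0 \<longleftrightarrow>
      (\<forall>x. (\<forall>i\<in>I. (\<Sum>j\<in>J. M i j p * x j) = 0) \<longrightarrow> (\<forall>j\<in>J. x j = 0))" for p
  proof (intro iffI allI impI notI)
    fix x assume det: "Determinant.det (N p) \<noteq> 0" and x: "\<forall>i\<in>I. (\<Sum>j\<in>J. M i j p * x j) = 0"
    define v where "v = Matrix.vec n (\<lambda>k. x (g k))"
    have "N p *\<^sub>v v = 0\<^sub>v n"
    proof (rule eq_vecI)
      fix k assume "k < dim_vec (0\<^sub>v n)"
      then show "(N p *\<^sub>v v) $ k = 0\<^sub>v n $ k"
        using mult[of k v x p] x fI[of k] by (simp add: v_def)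
    qed (simp add: N_def)
    then have "v = 0\<^sub>v n"
      using det det_0_iff_vec_prod_zero[OF N, of p] vec_carrier[of n "\<lambda>k. x (g k)"]
      unfolding v_def by blast
    then have "x (g k) = 0" if "k < n" for k
      using that index_vec[of k n "\<lambda>k. x (g k)"] by (simp add: v_def)
    then show "\<forall>j\<in>J. x j = 0"
      using g by (force simp: bij_betw_def)
  next
    assume inj: "\<forall>x. (\<forall>i\<in>I. (\<Sum>j\<in>J. M i j p * x j) = 0) \<longrightarrow> (\<forall>j\<in>J. x j = 0)"
      and "Determinant.det (N p) = 0"
    then obtain v where v: "v \<in> carrier_vec n" "v \<noteq> 0\<^sub>v n" "N p *\<^sub>v v = 0\<^sub>v n"
      using det_0_iff_vec_prod_zero[OF N, of p] by auto
    define x where "x j = v $ (the_inv_into {0..<n} g j)" for j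
    have xg: "v $ k = x (g k)" if "k < n" for k
      using that g by (simp add: x_def bij_betw_def the_inv_into_f_f)
    have "(\<Sum>j\<in>J. M i j p * x j) = 0" if "i \<in> I" for i
    proof -
      obtain k where k: "k < n" "i = f k"
        using \<open>i \<in> I\<close> f by (auto simp: bij_betw_def)
      then show ?thesis
        using mult[OF k(1) v(1) xg, of p] v(3) by simp
    qed
    then have "\<forall>j\<in>J. x j = 0"
      using inj by blast
    then have "v = 0\<^sub>v n"
      using v(1) xg gJ by (intro eq_vecI) auto
    with v(2) show False by simp
  qed
  have detcont: "continuous_on P (\<lambda>p. Determinant.det (N p))"
    by (rule continuous_on_det[OF N Ncont])
  define T where "T = P \<inter> (\<lambda>p. Determinant.det (N p)) -` (- {0})"
  \<comment> \<open>Cramer's rule: the adjugate over the determinant, with rows and columns renamed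
    through \<open>f\<close> and \<open>g\<close>.\<close>
  define X where "X j p = inverse (Determinant.det (N p)) *
      (\<Sum>k<n. adj_mat (N p) $$ (the_inv_into {0..<n} g j, k) * b (f k))" for j p
  show thesis
  proof (rule that)
    show "open T"
      unfolding T_def by (rule continuous_open_preimage[OF detcont P(1)]) auto
    have "Determinant.det (N q) \<noteq> 0"
      unfolding inj_iff using inj by blast
    then show "q \<in> T"
      using P(2) by (simp add: T_def)
    show TP: "T \<subseteq> P" by (auto simp: T_def)
    fix p assume p: "p \<in> T"
    then have det: "Determinant.det (N p) \<noteq> 0" by (simp add: T_def)
    then show "\<forall>j\<in>J. x j = 0" if "\<And>i. i \<in> I \<Longrightarrow> (\<Sum>j\<in>J. M i j p * x j) = 0" for x
      using that unfolding inj_iff by blast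
    fix i assume "i \<in> I"
    then obtain k where k: "k < n" "i = f k"
      using f by (auto simp: bij_betw_def)
    define v where "v = inverse (Determinant.det (N p)) \<cdot>\<^sub>v (adj_mat (N p) *\<^sub>v Matrix.vec n (\<lambda>k. b (f k)))"
    have adj: "adj_mat (N p) \<in> carrier_mat n n"
      by (rule adj_mat(1)[OF N])
    have "(\<Sum>j\<in>J. M (f k) j p * X j p) = (N p *\<^sub>v v) $ k"
    proof (rule mult[OF k(1), symmetric])
      show "v \<in> carrier_vec n"
        using adj by (simp add: v_def)
      fix m assume "m < n"
      then show "v $ m = X (g m) p"
        using adj g
        by (simp add: v_def X_def bij_betw_def the_inv_into_f_f scalar_prod_def atLeast0LessThan)
    qed
    also have "N p *\<^sub>v v = inverse (Determinant.det (N p)) \<cdot>\<^sub>v ((N p * adj_mat (N p)) *\<^sub>v Matrix.vec n (\<lambda>k. b (f k)))"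
      unfolding v_def using adj N[of p] by (simp add: mult_mat_vec)
    also have "\<dots> $ k = b (f k)"
      unfolding adj_mat(2)[OF N] using det k by simp
    finally show "(\<Sum>j\<in>J. M i j p * X j p) = b i"
      using k by simp
  next
    fix j assume j: "j \<in> J"
    then have inv: "the_inv_into {0..<n} g j < n"
      using g the_inv_into_into[of g "{0..<n}" j "{0..<n}"] by (auto simp: bij_betw_def)
    have TP: "T \<subseteq> P" by (auto simp: T_def)
    show "continuous_on T (X j)"
      unfolding X_def using inv
      by (intro continuous_on_mult continuous_on_inverse continuous_on_sum continuous_on_const
          continuous_on_subset[OF detcont TP]
          continuous_on_subset[OF continuous_on_adj_mat[OF N Ncont] TP])
        (auto simp: T_def)
  qed
qed

text \<open>The case of constant coefficients over a dummy parameter space: for a square system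
  uniqueness implies existence.\<close>

lemma linear_system_solvable:
  fixes M :: "'i \<Rightarrow> 'j \<Rightarrow> complex"
  assumes "finite I" "finite J" "card I = card J"
    and inj: "\<And>x. (\<And>i. i \<in> I \<Longrightarrow> (\<Sum>j\<in>J. M i j * x j) = 0) \<Longrightarrow> \<forall>j\<in>J. x j = 0"
  obtains x where "\<And>i. i \<in> I \<Longrightarrow> (\<Sum>j\<in>J. M i j * x j) = b i"
proof (rule continuous_linear_system[OF assms(1-3), of UNIV "0::real" "\<lambda>i j _. M i j" b])
  show "\<forall>j\<in>J. x j = 0" if "\<And>i. i \<in> I \<Longrightarrow> (\<Sum>j\<in>J. M i j * x j) = 0" for x
    using that by (rule inj)
  fix T :: "real set" and X :: "'j \<Rightarrow> real \<Rightarrow> complex"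
  assume "0 \<in> T" and sol: "\<And>p i. p \<in> T \<Longrightarrow> i \<in> I \<Longrightarrow> (\<Sum>j\<in>J. M i j * X j p) = b i"
  show thesis
    by (rule that[of "\<lambda>j. X j 0"]) (rule sol[OF \<open>0 \<in> T\<close>])
qed simp_all

section \<open>Self-adjoint vertex conditions and the boundary form\<close>

lemma sum_cnj_mult_self_eq_0:
  fixes x :: "nat \<Rightarrow> complex"
  assumes "(\<Sum>i<d. cnj (x i) * x i) = 0" "i < d"
  shows "x i = 0"
proof -
  have "cnj z * z = of_real ((norm z)\<^sup>2)" for z
    by (simp only: complex_norm_square mult.commute)
  then have "of_real (\<Sum>i<d. (norm (x i))\<^sup>2) = (0 :: complex)"
    using assms(1) by simp
  then have "(\<Sum>i<d. (norm (x i))\<^sup>2) = 0"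
    by (simp only: of_real_eq_0_iff)
  then show ?thesis
    using assms(2) by (simp add: sum_nonneg_eq_0_iff)
qed

lemma sum_mult_sum_swap:
  fixes f g :: "'a \<Rightarrow> 'b \<Rightarrow> 'c::comm_semiring_0"
  shows "(\<Sum>j\<in>J. (\<Sum>i\<in>I. f i j) * (\<Sum>k\<in>K. g k j)) = (\<Sum>i\<in>I. \<Sum>k\<in>K. \<Sum>j\<in>J. f i j * g k j)"
proof -
  have "(\<Sum>j\<in>J. (\<Sum>i\<in>I. f i j) * (\<Sum>k\<in>K. g k j)) = (\<Sum>i\<in>I. \<Sum>j\<in>J. \<Sum>k\<in>K. f i j * g k j)"
    unfolding sum_product by (rule sum.swap)
  also have "\<dots> = (\<Sum>i\<in>I. \<Sum>k\<in>K. \<Sum>j\<in>J. f i j * g k j)"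
    by (intro sum.cong refl sum.swap)
  finally show ?thesis .
qed

lemma lagrangian_boundary_form:
  fixes A B :: "nat \<Rightarrow> nat \<Rightarrow> complex"
  assumes indep: "\<And>x. (\<And>j. j < d \<Longrightarrow> (\<Sum>i<d. cnj (A i j) * x i) = 0) \<Longrightarrow>
      (\<And>j. j < d \<Longrightarrow> (\<Sum>i<d. cnj (B i j) * x i) = 0) \<Longrightarrow> \<forall>i<d. x i = 0"
    and herm: "\<And>i k. i < d \<Longrightarrow> k < d \<Longrightarrow> (\<Sum>j<d. A i j * cnj (B k j)) = (\<Sum>j<d. B i j * cnj (A k j))"
    and F: "\<And>i. i < d \<Longrightarrow> (\<Sum>j<d. A i j * F j + B i j * F' j) = 0"
    and G: "\<And>i. i < d \<Longrightarrow> (\<Sum>j<d. A i j * G j + B i j * G' j) = 0"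
  shows "(\<Sum>j<d. cnj (F j) * G' j - cnj (F' j) * G j) = 0"
proof -
  text \<open>
    \<open>B\<^sup>* \<plusminus> \<i> A\<^sup>*\<close> is injective because \<open>A B\<^sup>*\<close> being Hermitian makes the mixed terms of
    its squared norm cancel.  Hence every solution of \<open>A F + B F' = 0\<close> has the form
    \<open>F = B\<^sup>* \<xi>\<close>, \<open>F' = - A\<^sup>* \<xi>\<close>, and the boundary form is \<open>\<xi>\<^sup>* (A G + B G')\<close>.
  \<close>
  have kernel: "\<forall>i<d. x i = 0"
    if c: "c = \<i> \<or> c = - \<i>" and x: "\<And>j. j < d \<Longrightarrow> (\<Sum>i<d. (cnj (B i j) + c * cnj (A i j)) * x i) = 0"
    for x c
  proof -
    define a where "a j = (\<Sum>i<d. cnj (A i j) * x i)" for j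
    define b where "b j = (\<Sum>i<d. cnj (B i j) * x i)" for j
    have ba: "b j = - c * a j" if "j < d" for j
    proof -
      have "b j + c * a j = 0"
        using x[OF that]
        by (simp add: a_def b_def distrib_right sum.distrib sum_distrib_left mult.assoc)
      then show ?thesis
        by (simp add: eq_neg_iff_add_eq_0)
    qed
    have ab: "(\<Sum>j<d. cnj (a j) * b j) = (\<Sum>j<d. cnj (b j) * a j)"
    proof -
      have "(\<Sum>j<d. cnj (a j) * b j)
          = (\<Sum>j<d. (\<Sum>i<d. cnj (x i) * A i j) * (\<Sum>k<d. x k * cnj (B k j)))"
        by (simp add: a_def b_def mult.commute)
      also have "\<dots> = (\<Sum>i<d. \<Sum>k<d. cnj (x i) * x k * (\<Sum>j<d. A i j * cnj (B k j)))"
        unfolding sum_mult_sum_swap by (simp add: sum_distrib_left mult_ac)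
      also have "\<dots> = (\<Sum>i<d. \<Sum>k<d. cnj (x i) * x k * (\<Sum>j<d. B i j * cnj (A k j)))"
        by (intro sum.cong refl arg_cong2[where f = "(*)"] herm) auto
      also have "\<dots> = (\<Sum>j<d. (\<Sum>i<d. cnj (x i) * B i j) * (\<Sum>k<d. x k * cnj (A k j)))"
        unfolding sum_mult_sum_swap by (simp add: sum_distrib_left mult_ac)
      also have "\<dots> = (\<Sum>j<d. cnj (b j) * a j)"
        by (simp add: a_def b_def mult.commute)
      finally show ?thesis .
    qed
    \<comment> \<open>With b = - c a the two equal sums become - c and c times the squared norm of
      a, because cnj (- c) = c for c = \<i> and c = - \<i>; so a = 0.\<close>
    have "(\<Sum>j<d. cnj (a j) * b j) = - c * (\<Sum>j<d. cnj (a j) * a j)"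
      by (simp add: ba sum_distrib_left ac_simps)
    moreover have "(\<Sum>j<d. cnj (b j) * a j) = c * (\<Sum>j<d. cnj (a j) * a j)"
      using c by (auto simp: ba sum_distrib_left sum_negf ac_simps)
    ultimately have "(\<Sum>j<d. cnj (a j) * a j) = 0"
      using ab c by auto
    then have "a j = 0" if "j < d" for j
      using that by (rule sum_cnj_mult_self_eq_0)
    with ba show ?thesis
      by (intro indep) (auto simp: a_def b_def)
  qed
  \<comment> \<open>At first only this one combination of F and F' is matched by \<xi>. That both
    vectors are matched separately is \<open>FK\<close>, obtained by showing that the discrepancy
    \<open>E\<close> vanishes.\<close>
  obtain \<xi> where \<xi>: "\<And>j. j < d \<Longrightarrow> (\<Sum>i<d. (cnj (B i j) + (- \<i>) * cnj (A i j)) * \<xi> i) = F j + \<i> * F' j"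
    by (rule linear_system_solvable[of "{..<d}" "{..<d}" "\<lambda>j i. cnj (B i j) + (- \<i>) * cnj (A i j)"
          "\<lambda>j. F j + \<i> * F' j"]) (use kernel[of "- \<i>"] in auto)
  define K where "K j = (\<Sum>i<d. cnj (B i j) * \<xi> i)" for j
  define K' where "K' j = - (\<Sum>i<d. cnj (A i j) * \<xi> i)" for j
  have KF: "K j + \<i> * K' j = F j + \<i> * F' j" if "j < d" for j
    using \<xi>[OF that] by (simp add: K_def K'_def algebra_simps sum.distrib sum_distrib_left sum_negf sum_subtractf)
  define E where "E j = F' j - K' j" for j
  have FE: "F j - K j = - \<i> * E j" if "j < d" for j
    using KF[OF that] by (simp add: E_def algebra_simps)
  have K: "(\<Sum>j<d. A i j * K j + B i j * K' j) = 0" if "i < d" for i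
  proof -
    have "(\<Sum>j<d. A i j * K j + B i j * K' j)
        = (\<Sum>j<d. \<Sum>k<d. \<xi> k * (A i j * cnj (B k j))) - (\<Sum>j<d. \<Sum>k<d. \<xi> k * (B i j * cnj (A k j)))"
      by (simp add: K_def K'_def sum.distrib sum_subtractf sum_distrib_left sum_negf ac_simps)
    also have "\<dots> = (\<Sum>k<d. \<xi> k * (\<Sum>j<d. A i j * cnj (B k j))) - (\<Sum>k<d. \<xi> k * (\<Sum>j<d. B i j * cnj (A k j)))"
      by (subst (1 2) sum.swap) (simp add: sum_distrib_left)
    also have "\<dots> = 0"
      using herm that by simp
    finally show ?thesis .
  qed
  \<comment> \<open>E lies in the kernel of B - \<i> A. This matrix is the adjoint of the one
    treated in \<open>kernel\<close> for c = \<i>, which is injective and hence surjective, so E =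
    \<open>\<eta>\<close> under that matrix is orthogonal to itself.\<close>
  have E0: "E j = 0" if "j < d" for j
  proof -
    have N: "(\<Sum>j<d. (B k j + (- \<i>) * A k j) * E j) = 0" if "k < d" for k
    proof -
      have "(\<Sum>j<d. (B k j + (- \<i>) * A k j) * E j) = (\<Sum>j<d. A k j * (F j - K j) + B k j * (F' j - K' j))"
        by (intro sum.cong) (auto simp: FE E_def algebra_simps)
      also have "\<dots> = (\<Sum>j<d. A k j * F j + B k j * F' j) - (\<Sum>j<d. A k j * K j + B k j * K' j)"
        by (simp add: algebra_simps sum.distrib sum_subtractf)
      also have "\<dots> = 0"
        using F K that by simp
      finally show ?thesis .
    qed
    obtain \<eta> where \<eta>: "\<And>j. j < d \<Longrightarrow> (\<Sum>i<d. (cnj (B i j) + \<i> * cnj (A i j)) * \<eta> i) = E j"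
      by (rule linear_system_solvable[of "{..<d}" "{..<d}" "\<lambda>j i. cnj (B i j) + \<i> * cnj (A i j)" E])
         (use kernel[of \<i>] in auto)
    have "(\<Sum>j<d. cnj (E j) * E j) = (\<Sum>j<d. \<Sum>i<d. cnj (\<eta> i) * ((B i j + (- \<i>) * A i j) * E j))"
      by (intro sum.cong refl, subst (1) \<eta>[symmetric]) (auto simp: sum_distrib_right sum_distrib_left mult_ac)
    also have "\<dots> = (\<Sum>i<d. cnj (\<eta> i) * (\<Sum>j<d. (B i j + (- \<i>) * A i j) * E j))"
      by (subst sum.swap) (simp only: sum_distrib_left)
    also have "\<dots> = 0"
      using N by simp
    finally show ?thesis
      using that by (rule sum_cnj_mult_self_eq_0)
  qed
  have FK: "F j = K j" "F' j = K' j" if "j < d" for j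
    using FE[OF that] E0[OF that] by (auto simp: E_def)
  have "(\<Sum>j<d. cnj (F j) * G' j - cnj (F' j) * G j)
      = (\<Sum>j<d. \<Sum>i<d. cnj (\<xi> i) * (A i j * G j + B i j * G' j))"
    by (intro sum.cong refl) (auto simp: FK K_def K'_def sum_distrib_right sum_distrib_left sum.distrib algebra_simps)
  also have "\<dots> = (\<Sum>i<d. cnj (\<xi> i) * (\<Sum>j<d. A i j * G j + B i j * G' j))"
    by (subst sum.swap) (simp only: sum_distrib_left)
  also have "\<dots> = 0"
    using G by simp
  finally show ?thesis .
qed

text \<open>Full rank makes the listed columns span the whole space, so \<open>x\<close> is a
  combination of vectors orthogonal to it and thus orthogonal to itself.\<close>

lemma orthogonal_to_full_rank_cols:
  fixes x :: "nat \<Rightarrow> complex"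
  assumes vs: "set vs \<subseteq> carrier_vec d" and rank: "vec_space.rank d (mat_of_cols d vs) = d"
    and orth: "\<And>v. v \<in> set vs \<Longrightarrow> (\<Sum>i<d. cnj (v $ i) * x i) = 0"
  shows "\<forall>i<d. x i = 0"
proof -
  interpret vec_space "TYPE(complex)" d .
  have M: "mat_of_cols d vs \<in> carrier_mat d (length vs)" by simp
  have cols: "cols (mat_of_cols d vs) = vs"
    using vs by (rule cols_mat_of_cols)
  obtain S where S: "finite S" "maximal S (\<lambda>T. T \<subseteq> set vs \<and> lin_indpt T)"
    using maximal_exists_superset[of "set vs" "\<lambda>T. T \<subseteq> set vs \<and> lin_indpt T" "{}"]
    by (auto simp: lin_dep_def)
  then have Sv: "S \<subseteq> set vs" and li: "lin_indpt S"
    by (auto simp: maximal_def)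
  have "card S = d"
    using rank_card_indpt[OF M] S(2) rank unfolding cols by simp
  then have "basis S"
    using dim_li_is_basis[OF fin_dim S(1) _ li] Sv vs dim_is_n by auto
  then have span: "span S = carrier_vec d"
    by (simp add: basis_def)
  define y where "y = Matrix.vec d x"
  have "y \<in> span S" by (simp add: span y_def)
  then obtain a where a: "y = lincomb a S"
    using S(1) Sv vs finite_span[of S] by auto
  have "(\<Sum>i<d. cnj (x i) * x i) = (\<Sum>i<d. cnj (\<Sum>v\<in>S. a v * v $ i) * x i)"
  proof (intro sum.cong refl)
    fix i assume "i \<in> {..<d}"
    then have "x i = lincomb a S $ i"
      using a by (metis index_vec lessThan_iff y_def)
    also have "\<dots> = (\<Sum>v\<in>S. a v * v $ i)"
      using \<open>i \<in> {..<d}\<close> Sv vs by (intro lincomb_index) auto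
    finally have "x i = (\<Sum>v\<in>S. a v * v $ i)" .
    then show "cnj (x i) * x i = cnj (\<Sum>v\<in>S. a v * v $ i) * x i" by simp
  qed
  also have "\<dots> = (\<Sum>v\<in>S. cnj (a v) * (\<Sum>i<d. cnj (v $ i) * x i))"
    by (simp add: sum_distrib_right sum_distrib_left sum.swap[of _ S] ac_simps)
  also have "\<dots> = 0"
    using orth Sv by (intro sum.neutral) auto
  finally have "(\<Sum>i<d. cnj (x i) * x i) = 0" .
  then show ?thesis
    using sum_cnj_mult_self_eq_0 by blast
qed

text \<open>Full rank of the block matrix (A B) says that no nonzero vector is annihilated by both
  adjoints; this is the form in which \<open>lagrangian_boundary_form\<close> takes it.\<close>

lemma self_adjoint_condition_boundary_form:
  assumes sa: "self_adjoint_condition d A B"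
    and F: "A *\<^sub>v Matrix.vec d F + B *\<^sub>v Matrix.vec d F' = 0\<^sub>v d"
    and G: "A *\<^sub>v Matrix.vec d G + B *\<^sub>v Matrix.vec d G' = 0\<^sub>v d"
  shows "(\<Sum>j<d. cnj (F j) * G' j - cnj (F' j) * G j) = 0"
proof -
  have A: "A \<in> carrier_mat d d" and B: "B \<in> carrier_mat d d"
    and rank: "vec_space.rank d (mat_of_cols d (cols A @ cols B)) = d"
    and herm: "mat_adjoint (A * mat_adjoint B) = A * mat_adjoint B"
    using sa by (auto simp: self_adjoint_condition_def)
  have adj: "mat_adjoint C $$ (i, j) = cnj (C $$ (j, i))" if "C \<in> carrier_mat d d" "i < d" "j < d" for C i j
    using that by (auto simp: mat_adjoint_def mat_of_rows_def conjugate_complex_def)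
  have adjB: "mat_adjoint B \<in> carrier_mat d d"
    using B by (auto simp: mat_adjoint_def)
  have AB: "A * mat_adjoint B \<in> carrier_mat d d"
    using A adjB by simp
  have ABij: "(A * mat_adjoint B) $$ (i, k) = (\<Sum>j<d. A $$ (i, j) * cnj (B $$ (k, j)))" if "i < d" "k < d" for i k
    using that A B adjB adj[OF B] by (auto simp: scalar_prod_def atLeast0LessThan intro!: sum.cong)
  show ?thesis
  proof (rule lagrangian_boundary_form[of d "\<lambda>i j. A $$ (i, j)" "\<lambda>i j. B $$ (i, j)"])
    fix x :: "nat \<Rightarrow> complex"
    assume "\<And>j. j < d \<Longrightarrow> (\<Sum>i<d. cnj (A $$ (i, j)) * x i) = 0"
      "\<And>j. j < d \<Longrightarrow> (\<Sum>i<d. cnj (B $$ (i, j)) * x i) = 0"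
    then show "\<forall>i<d. x i = 0"
      using A B by (intro orthogonal_to_full_rank_cols[OF _ rank]) (auto simp: cols_def)
  next
    fix i k assume ik: "i < d" "k < d"
    have "(A * mat_adjoint B) $$ (i, k) = cnj ((A * mat_adjoint B) $$ (k, i))"
      using adj[OF AB ik] herm by simp
    then show "(\<Sum>j<d. A $$ (i, j) * cnj (B $$ (k, j))) = (\<Sum>j<d. B $$ (i, j) * cnj (A $$ (k, j)))"
      using ik by (simp add: ABij mult.commute)
  next
    have *: "(\<Sum>j<d. A $$ (i, j) * H j + B $$ (i, j) * H' j) = 0"
      if "A *\<^sub>v Matrix.vec d H + B *\<^sub>v Matrix.vec d H' = 0\<^sub>v d" "i < d" for H H' i
    proof -
      have "(A *\<^sub>v Matrix.vec d H + B *\<^sub>v Matrix.vec d H') $ i = 0"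
        using that by simp
      then show ?thesis
        using that(2) A B by (simp add: scalar_prod_def atLeast0LessThan sum.distrib)
    qed
    fix i assume "i < d"
    then show "(\<Sum>j<d. A $$ (i, j) * F j + B $$ (i, j) * F' j) = 0"
      and "(\<Sum>j<d. A $$ (i, j) * G j + B $$ (i, j) * G' j) = 0"
      using *[OF F] *[OF G] by auto
  qed
qed

section \<open>Sobolev functions as solutions of the equation\<close>

text \<open>The segment has finite measure and t <= 1 + t^2. The theory of the equation above rests
  on integrability, not on square integrability.\<close>

lemma L2_seg_absolutely_integrable:
  fixes h :: "real \<Rightarrow> 'a::euclidean_space"
  assumes "L2_seg l h"
  shows "h absolutely_integrable_on {0..l}"
proof -
  have h: "h \<in> borel_measurable (lebesgue_on {0..l})" "integrable (lebesgue_on {0..l}) (\<lambda>x. (norm (h x))\<^sup>2)"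
    using assms by (auto simp: L2_seg_def)
  interpret finite_measure "lebesgue_on {0..l}"
    by (rule finite_measure_lebesgue_on) auto
  have "integrable (lebesgue_on {0..l}) (norm \<circ> h)"
  proof (rule Bochner_Integration.integrable_bound)
    show "integrable (lebesgue_on {0..l}) (\<lambda>x. 1 + (norm (h x))\<^sup>2)"
      using h(2) by (intro Bochner_Integration.integrable_add) auto
    show "norm \<circ> h \<in> borel_measurable (lebesgue_on {0..l})"
      using h(1) by (auto simp: o_def)
    have "t \<le> 1 + t\<^sup>2" for t :: real
      using zero_le_power2[of "t - 1/2"] by (simp add: power2_eq_square algebra_simps)
    then show "AE x in lebesgue_on {0..l}. norm ((norm \<circ> h) x) \<le> norm (1 + (norm (h x))\<^sup>2)"
      by (intro AE_I2) (auto simp: abs_of_nonneg)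
  qed
  then show ?thesis
    using h(1) by (simp add: absolutely_integrable_measurable)
qed

text \<open>Serves the way back from solutions to \<open>H2_seg\<close>, which asks for a square
  integrable second derivative.\<close>

lemma L2_seg_mult_continuous:
  fixes q y :: "real \<Rightarrow> complex"
  assumes q: "L2_seg l q" and y: "continuous_on {0..l} y"
  shows "L2_seg l (\<lambda>x. q x * y x)"
proof -
  have ym: "y \<in> borel_measurable (lebesgue_on {0..l})"
    using y by (intro continuous_imp_measurable_on_sets_lebesgue) auto
  have "bounded (y ` {0..l})"
    by (intro compact_imp_bounded compact_continuous_image y) auto
  then obtain M where M: "\<And>x. x \<in> {0..l} \<Longrightarrow> norm (y x) \<le> M"
    unfolding bounded_iff by blast
  have m: "(\<lambda>x. q x * y x) \<in> borel_measurable (lebesgue_on {0..l})"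
    using q ym by (auto simp: L2_seg_def)
  moreover have "integrable (lebesgue_on {0..l}) (\<lambda>x. (norm (q x * y x))\<^sup>2)"
  proof (rule Bochner_Integration.integrable_bound)
    show "integrable (lebesgue_on {0..l}) (\<lambda>x. (norm (q x))\<^sup>2 * M\<^sup>2)"
      using q by (intro Bochner_Integration.integrable_mult_left) (auto simp: L2_seg_def)
    show "(\<lambda>x. (norm (q x * y x))\<^sup>2) \<in> borel_measurable (lebesgue_on {0..l})"
      using m by measurable
    show "AE x in lebesgue_on {0..l}. norm ((norm (q x * y x))\<^sup>2) \<le> norm ((norm (q x))\<^sup>2 * M\<^sup>2)"
      by (intro AE_I2) (auto simp: norm_mult power_mult_distrib intro!: mult_left_mono power_mono M)
  qed
  ultimately show ?thesis
    by (simp add: L2_seg_def)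
qed

lemma L2_seg_shift:
  assumes "L2_seg l V"
  shows "L2_seg l (\<lambda>x. complex_of_real (V x) - of_real c)"
proof -
  have V: "V \<in> borel_measurable (lebesgue_on {0..l})" "integrable (lebesgue_on {0..l}) (\<lambda>x. (V x)\<^sup>2)"
    using assms by (auto simp: L2_seg_def)
  interpret finite_measure "lebesgue_on {0..l}"
    by (rule finite_measure_lebesgue_on) auto
  have m: "(\<lambda>x. complex_of_real (V x) - of_real c) \<in> borel_measurable (lebesgue_on {0..l})"
    using V(1) by measurable
  moreover have "integrable (lebesgue_on {0..l}) (\<lambda>x. (norm (complex_of_real (V x) - of_real c))\<^sup>2)"
  proof (rule Bochner_Integration.integrable_bound)
    show "integrable (lebesgue_on {0..l}) (\<lambda>x. 2 * (V x)\<^sup>2 + 2 * c\<^sup>2)"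
      using V(2) by (intro Bochner_Integration.integrable_add Bochner_Integration.integrable_mult_right) auto
    show "(\<lambda>x. (norm (complex_of_real (V x) - of_real c))\<^sup>2) \<in> borel_measurable (lebesgue_on {0..l})"
      using m by measurable
    have "(V x - c)\<^sup>2 \<le> 2 * (V x)\<^sup>2 + 2 * c\<^sup>2" for x
      using zero_le_power2[of "V x + c"] by (simp add: power2_eq_square algebra_simps)
    moreover have "norm (complex_of_real (V x) - of_real c) = \<bar>V x - c\<bar>" for x
      by (metis norm_of_real of_real_diff)
    ultimately show "AE x in lebesgue_on {0..l}. norm ((norm (complex_of_real (V x) - of_real c))\<^sup>2)
        \<le> norm (2 * (V x)\<^sup>2 + 2 * c\<^sup>2)"
      by (intro AE_I2) auto
  qed
  ultimately show ?thesis
    by (simp add: L2_seg_def)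
qed

text \<open>\<open>f\<close> may differ from \<open>y\<close> outside the segment: functions in the
  operator domain are cut off there, while solutions are continued. The derivative within the
  segment does not see this.\<close>

lemma sturm_solution_has_vector_derivative:
  assumes sol: "sturm_solution l q r y z" and x: "x \<in> {0..l}"
    and f: "\<And>x. x \<in> {0..l} \<Longrightarrow> f x = y x"
  shows "(f has_vector_derivative z x) (at x within {0..l})"
proof -
  have "((\<lambda>u. y 0 + integral {0..u} z) has_vector_derivative z x) (at x within {0..l})"
    using has_vector_derivative_add[OF has_vector_derivative_const
        integral_has_vector_derivative[OF sturm_solutionD(2)[OF sol] x], of "y 0"]
    by simp
  then show ?thesis
  proof (rule has_vector_derivative_transform[OF x, rotated])
    fix u assume u: "u \<in> {0..l}"
    show "f u = y 0 + integral {0..u} z"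
      unfolding f[OF u] by (rule sturm_solutionD(3)[OF sol u])
  qed
qed

lemma sturm_solution_seg_deriv:
  assumes "sturm_solution l q r y z" "x \<in> {0..l}" "0 < l"
    and "\<And>x. x \<in> {0..l} \<Longrightarrow> f x = y x"
  shows "seg_deriv l f x = z x"
  unfolding seg_deriv_def
  using sturm_solution_has_vector_derivative[OF assms(1,2,4)] assms(2,3)
  by (intro vector_derivative_within_closed_interval) auto

lemma sturm_solution_imp_H2_seg:
  assumes sol: "sturm_solution l q r y z" and l: "0 < l"
    and L2: "L2_seg l (\<lambda>x. q x * y x + r x)"
    and f: "\<And>x. x \<in> {0..l} \<Longrightarrow> f x = y x"
  shows "H2_seg l f (\<lambda>x. q x * y x + r x)"
  unfolding H2_seg_def
proof (intro conjI ballI L2)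
  fix x assume x: "x \<in> {0..l}"
  show "f differentiable (at x within {0..l})"
    using sturm_solution_has_vector_derivative[OF sol x f] by (rule differentiableI_vector)
  have "integrable (lebesgue_on {0..x}) (\<lambda>x. q x * y x + r x)"
    using absolutely_integrable_on_subinterval[OF L2_seg_absolutely_integrable[OF L2], of 0 x] x
    by (simp add: absolutely_integrable_imp_integrable)
  then have "integral\<^sup>L (lebesgue_on {0..x}) (\<lambda>x. q x * y x + r x) = integral {0..x} (\<lambda>x. q x * y x + r x)"
    by (intro lebesgue_integral_eq_integral) auto
  moreover have "seg_deriv l f x = z x" "seg_deriv l f 0 = z 0"
    using x l f by (auto intro!: sturm_solution_seg_deriv[OF sol])
  ultimately show "seg_deriv l f x = seg_deriv l f 0 + integral\<^sup>L (lebesgue_on {0..x}) (\<lambda>x. q x * y x + r x)"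
    using sturm_solutionD(4)[OF sol x] by simp
qed

text \<open>\<open>f\<close> is differentiable at every point of the segment, so the fundamental
  theorem recovers it from its derivative; the null set where the equation fails disappears under
  the integral that recovers the derivative.\<close>

lemma H2_seg_imp_sturm_solution:
  assumes H2: "H2_seg l f h" and l: "0 < l"
    and ae: "AE x in lebesgue_on {0..l}. h x = q x * f x + r x"
  shows "sturm_solution l q r f (seg_deriv l f)"
proof -
  have h: "h absolutely_integrable_on {0..l}"
    using H2 by (intro L2_seg_absolutely_integrable) (simp add: H2_seg_def)
  have diff: "(f has_vector_derivative seg_deriv l f x) (at x within {0..l})" if "x \<in> {0..l}" for x
    unfolding seg_deriv_def
  proof (rule vector_derivative_works[THEN iffD1])
    show "f differentiable (at x within {0..l})"
      using H2 that unfolding H2_seg_def by blast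
  qed
  have f: "continuous_on {0..l} f"
    using diff has_vector_derivative_continuous unfolding continuous_on_eq_continuous_within by blast
  define N where "N = {x \<in> {0..l}. h x \<noteq> q x * f x + r x}"
  have "AE x in lebesgue. x \<in> {0..l} \<longrightarrow> h x = q x * f x + r x"
    using ae by (simp add: AE_restrict_space_iff)
  then have "AE x in lebesgue. x \<notin> N"
    by eventually_elim (auto simp: N_def)
  then obtain N' where N': "{x \<in> space lebesgue. \<not> x \<notin> N} \<subseteq> N'" "emeasure lebesgue N' = 0" "N' \<in> sets lebesgue"
    by (rule AE_E)
  have "negligible N'"
    unfolding negligible_iff_null_sets by (rule null_setsI[OF N'(2,3)])
  then have N: "negligible N"
    by (rule negligible_subset) (use N'(1) in auto)
  have zeq: "seg_deriv l f x = seg_deriv l f 0 + integral {0..x} h" if x: "x \<in> {0..l}" for x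
  proof -
    have "integrable (lebesgue_on {0..x}) h"
      using absolutely_integrable_on_subinterval[OF h, of 0 x] x
      by (simp add: absolutely_integrable_imp_integrable)
    then have "integral\<^sup>L (lebesgue_on {0..x}) h = integral {0..x} h"
      by (intro lebesgue_integral_eq_integral) auto
    then show ?thesis
      using H2 x unfolding H2_seg_def by metis
  qed
  have "continuous_on {0..l} (\<lambda>x. seg_deriv l f 0 + integral {0..x} h)"
    using h by (intro continuous_intros indefinite_integral_continuous_1)
      (simp add: absolutely_integrable_on_def)
  then have z: "continuous_on {0..l} (seg_deriv l f)"
    by (rule continuous_on_eq) (rule zeq[symmetric])
  show ?thesis
    unfolding sturm_solution_def
  proof (intro conjI ballI f z)
    fix x assume x: "x \<in> {0..l}"
    have "(seg_deriv l f has_integral f x - f 0) {0..x}"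
      using x by (intro fundamental_theorem_of_calculus)
        (auto intro!: has_vector_derivative_within_subset[OF diff])
    then show "f x = f 0 + integral {0..x} (seg_deriv l f)"
      by (simp add: integral_unique)
    have "integral {0..x} h = integral {0..x} (\<lambda>t. q t * f t + r t)"
      using x by (intro integral_spike[OF N]) (auto simp: N_def)
    then show "seg_deriv l f x = seg_deriv l f 0 + integral {0..x} (\<lambda>t. q t * f t + r t)"
      using zeq[OF x] by simp
  qed
qed

text \<open>Rescaling to [0, 1] moves the variable limit into the integrand, where continuity in the
  parameter is standard. The rescaling divides by \<open>\<tau> p\<close>, hence the
  positivity.\<close>

lemma continuous_on_integral_upper:
  fixes h :: "'p::metric_space \<Rightarrow> real \<Rightarrow> complex"
  assumes h: "continuous_on (T \<times> {0..l}) (\<lambda>p. h (fst p) (snd p))"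
    and \<tau>: "continuous_on T \<tau>" "\<And>p. p \<in> T \<Longrightarrow> 0 < \<tau> p \<and> \<tau> p \<le> l"
  shows "continuous_on T (\<lambda>p. integral {0..\<tau> p} (h p))"
proof -
  have eq: "integral (cbox 0 1) (\<lambda>x. of_real (\<tau> p) * h p (\<tau> p * x)) = integral {0..\<tau> p} (h p)" if p: "p \<in> T" for p
  proof -
    have t: "0 < \<tau> p" "\<tau> p \<le> l" using \<tau>(2)[OF p] by auto
    have "continuous_on {0..\<tau> p} (h p)"
      using t p by (intro continuous_on_compose2[OF h, of _ "\<lambda>x. (p, x)", simplified])
        (auto intro!: continuous_intros)
    then have "(h p has_integral integral {0..\<tau> p} (h p)) {0..\<tau> p}"
      by (simp add: integrable_continuous_real integrable_integral)
    from has_integral_stretch_real[OF this, of "\<tau> p"] t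
    have "((\<lambda>x. h p (\<tau> p * x)) has_integral (1 / \<tau> p) *\<^sub>R integral {0..\<tau> p} (h p)) ((\<lambda>x. x / \<tau> p) ` {0..\<tau> p})"
      by simp
    moreover have "(\<lambda>x. x / \<tau> p) ` {0..\<tau> p} = cbox 0 1"
      using t by (simp add: image_divide_atLeastAtMost)
    ultimately have "((\<lambda>x. of_real (\<tau> p) * h p (\<tau> p * x)) has_integral
        of_real (\<tau> p) * ((1 / \<tau> p) *\<^sub>R integral {0..\<tau> p} (h p))) (cbox 0 1)"
      by (intro has_integral_mult_right) simp
    then have "integral (cbox 0 1) (\<lambda>x. of_real (\<tau> p) * h p (\<tau> p * x))
        = of_real (\<tau> p) * ((1 / \<tau> p) *\<^sub>R integral {0..\<tau> p} (h p))"
      by (rule integral_unique)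
    also have "\<dots> = integral {0..\<tau> p} (h p)"
      using t by (simp add: scaleR_conv_of_real)
    finally show ?thesis .
  qed
  have "continuous_on T (\<lambda>p. integral (cbox 0 1) (\<lambda>x. of_real (\<tau> p) * h p (\<tau> p * x)))"
  proof (rule integral_continuous_on_param)
    have \<tau>': "continuous_on (T \<times> {0..1}) (\<lambda>p. \<tau> (fst p :: 'p))"
      by (rule continuous_on_compose2[OF \<tau>(1)]) (auto intro: continuous_intros)
    have "continuous_on (T \<times> {0..1}) (\<lambda>p. h (fst p) (\<tau> (fst p) * snd p))"
    proof (rule continuous_on_compose2[OF h, of _ "\<lambda>p. (fst p, \<tau> (fst p) * snd p)", simplified])
      show "continuous_on (T \<times> {0..1}) (\<lambda>x. (fst x, \<tau> (fst x) * snd x))"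
        using \<tau>' by (auto intro!: continuous_intros)
      have "\<tau> p * x \<le> l" "0 \<le> \<tau> p * x" if "p \<in> T" "0 \<le> x" "x \<le> 1" for p x
        using \<tau>(2)[OF that(1)] that order_trans[OF mult_left_le[of x "\<tau> p"]] by auto
      then show "(\<lambda>x. (fst x, \<tau> (fst x) * snd x)) ` (T \<times> {0..1}) \<subseteq> T \<times> {0..l}"
        by auto
    qed
    with \<tau>' show "continuous_on (T \<times> cbox 0 1) (\<lambda>(p, x). of_real (\<tau> p) * h p (\<tau> p * x))"
      unfolding case_prod_beta cbox_interval by (auto intro!: continuous_intros)
  qed
  then show ?thesis
    by (rule continuous_on_eq) (rule eq)
qed

text \<open>The one-sided derivative at 0 of a nondegenerate segment is unique. This recovers the
  initial derivative of a solution that is known to vanish.\<close>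

lemma sturm_solution_vanishing:
  assumes "sturm_solution l q r y z" "0 < l" "\<And>x. x \<in> {0..l} \<Longrightarrow> y x = 0"
  shows "z 0 = 0"
proof -
  have "seg_deriv l (\<lambda>x. 0) 0 = z 0"
    using assms by (intro sturm_solution_seg_deriv[OF assms(1)]) auto
  moreover have "seg_deriv l (\<lambda>x. 0) 0 = (\<lambda>x. 0) 0"
    using assms(2) by (intro sturm_solution_seg_deriv[OF sturm_solution_zero]) auto
  ultimately show ?thesis by simp
qed

lemma has_vector_derivative_quotient_tendsto:
  fixes f :: "real \<Rightarrow> complex"
  assumes "(f has_vector_derivative D) (at x)"
  shows "((\<lambda>t. (f t - f x) / of_real (t - x)) \<longlongrightarrow> D) (at x)"
proof -
  have "((\<lambda>t. (Re (f t) - Re (f x)) / (t - x)) \<longlongrightarrow> Re D) (at x)"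
    "((\<lambda>t. (Im (f t) - Im (f x)) / (t - x)) \<longlongrightarrow> Im D) (at x)"
    using assms unfolding has_vector_derivative_complex_iff has_field_derivative_iff by auto
  then show ?thesis
    unfolding tendsto_complex_iff by (simp add: Re_divide_of_real Im_divide_of_real del: of_real_diff)
qed

lemma continuous_real_positive_nbhd:
  fixes f :: "real \<Rightarrow> real"
  assumes "continuous_on {a<..<b} f" "c \<in> {a<..<b}" "f c > 0"
  obtains d where "d > 0" "\<And>x. \<bar>x - c\<bar> < d \<Longrightarrow> f x > 0"
proof -
  have "open {a<..<b}" by simp
  then have "isCont f c"
    using assms(1,2) continuous_on_eq_continuous_at by blast
  then have "eventually (\<lambda>x. f x > 0) (nhds c)"
    using order_tendstoD(1)[of f "f c" "nhds c" 0] assms(3) by (simp add: isCont_def tendsto_at_iff_tendsto_nhds)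
  then show thesis
    using that unfolding eventually_nhds_metric dist_real_def by blast
qed

section \<open>Quantum graphs with a loose edge\<close>

lemma set_length_simps [simp]:
  "graph (set_length \<Gamma> e s) = graph \<Gamma>" "pot (set_length \<Gamma> e s) = pot \<Gamma>"
  "star (set_length \<Gamma> e s) = star \<Gamma>" "condA (set_length \<Gamma> e s) = condA \<Gamma>"
  "condB (set_length \<Gamma> e s) = condB \<Gamma>"
  by (simp_all add: set_length_def)

lemma set_length_invariants [simp]:
  "ends_at (set_length \<Gamma> e s) = ends_at \<Gamma>" "degree_at (set_length \<Gamma> e s) = degree_at \<Gamma>"
  "satisfies_at (set_length \<Gamma> e s) = satisfies_at \<Gamma>"
  by (simp_all add: fun_eq_iff ends_at_def degree_at_def satisfies_at_def)

text \<open>Every length below \<open>S\<close> is admissible, so beyond any given length there is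
  room to continue solutions with the same potential.\<close>

locale dirichlet_loose_edge =
  fixes \<Gamma> :: "('v, 'e) qgraph" and e0 :: 'e and S :: real
  assumes loose: "loose_edge \<Gamma> e0"
    and dirichlet: "dirichlet_at \<Gamma> (head (graph \<Gamma>) e0)"
    and quantum_graph: "\<And>s. 0 < s \<Longrightarrow> s < S \<Longrightarrow> compact_quantum_graph (set_length \<Gamma> e0 s)"
    and S_pos: "0 < S"
begin

abbreviation E where "E \<equiv> arcs (graph \<Gamma>)"
abbreviation "Vs \<equiv> verts (graph \<Gamma>)"
abbreviation "vh \<equiv> head (graph \<Gamma>) e0"

definition len :: "real \<Rightarrow> 'e \<Rightarrow> real" where
  "len s = (elen \<Gamma>)(e0 := s)"

text \<open>The coefficient q when - u'' + V u = \<alpha> u is written as u'' = q u. The type is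
  complex to fit the theory above, but the values are real, which is what cancels the potential in
  Green's identity.\<close>

definition shifted_pot :: "real \<Rightarrow> 'e \<Rightarrow> real \<Rightarrow> complex" where
  "shifted_pot \<alpha> e x = of_real (pot \<Gamma> e x) - of_real \<alpha>"

lemma len_e0 [simp]: "len s e0 = s"
  by (simp add: len_def)

lemma elen_len: "elen (set_length \<Gamma> e0 s) = len s"
  by (simp add: len_def set_length_def)

lemma len_mono: "s \<le> t \<Longrightarrow> len s e \<le> len t e"
  by (simp add: len_def)

lemma qg0: "compact_quantum_graph (set_length \<Gamma> e0 (S / 2))"
  using S_pos by (intro quantum_graph) auto

lemma fin_digraph_graph: "fin_digraph (graph \<Gamma>)"
  using compact_quantum_graph.fin_digraph[OF qg0] by simp

lemma finite_E: "finite E" and finite_Vs: "finite Vs"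
  using fin_digraph.finite_arcs[OF fin_digraph_graph] fin_digraph.finite_verts[OF fin_digraph_graph] by auto

lemma head_tail_in_Vs: "e \<in> E \<Longrightarrow> head (graph \<Gamma>) e \<in> Vs" "e \<in> E \<Longrightarrow> tail (graph \<Gamma>) e \<in> Vs"
  using fin_digraph_graph unfolding fin_digraph_def wf_digraph_def by auto

lemma e0_in_E: "e0 \<in> E" and degree_vh: "degree_at \<Gamma> vh = 1"
  using loose by (auto simp: loose_edge_def)

lemma vh_in_Vs: "vh \<in> Vs"
  by (rule head_tail_in_Vs(1)[OF e0_in_E])

lemma len_pos: "e \<in> E \<Longrightarrow> 0 < s \<Longrightarrow> 0 < len s e"
  using compact_quantum_graph.elen_pos[OF qg0, of e] by (auto simp: elen_len len_def)

lemma pot_L2_len: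
  assumes "e \<in> E" "0 < s" "s < S"
  shows "L2_seg (len s e) (pot \<Gamma> e)"
  using compact_quantum_graph.pot_L2[OF quantum_graph[OF assms(2,3)], of e] assms(1)
  by (simp add: elen_len)

lemma shifted_pot_L2:
  assumes "e \<in> E" "0 < s" "s < S"
  shows "L2_seg (len s e) (shifted_pot \<alpha> e)"
  using L2_seg_shift[OF pot_L2_len[OF assms]] by (simp add: shifted_pot_def[abs_def])

lemma shifted_pot_integrable:
  assumes "e \<in> E" "0 < s" "s < S"
  shows "shifted_pot \<alpha> e absolutely_integrable_on {0..len s e}"
  by (rule L2_seg_absolutely_integrable[OF shifted_pot_L2[OF assms]])

section \<open>Edge ends and their vertices\<close>

lemma star_ends: "v \<in> Vs \<Longrightarrow> distinct (star \<Gamma> v) \<and> set (star \<Gamma> v) = ends_at \<Gamma> v"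
  using compact_quantum_graph.star[OF qg0, of v] by simp

lemma vertex_condition: "v \<in> Vs \<Longrightarrow> self_adjoint_condition (degree_at \<Gamma> v) (condA \<Gamma> v) (condB \<Gamma> v)"
  using compact_quantum_graph.conditions[OF qg0, of v] by simp

lemma finite_ends: "finite (ends_at \<Gamma> v)"
  using finite_E by (auto simp: ends_at_def out_arcs_def in_arcs_def)

lemma length_star:
  assumes "v \<in> Vs"
  shows "length (star \<Gamma> v) = degree_at \<Gamma> v"
proof -
  have "length (star \<Gamma> v) = card (ends_at \<Gamma> v)"
    using star_ends[OF assms] distinct_card by metis
  also have "\<dots> = card (out_arcs (graph \<Gamma>) v \<times> {False}) + card (in_arcs (graph \<Gamma>) v \<times> {True})"
    unfolding ends_at_def using finite_E
    by (intro card_Un_disjoint) (auto simp: out_arcs_def in_arcs_def)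
  also have "\<dots> = degree_at \<Gamma> v"
    by (simp add: degree_at_def in_degree_def out_degree_def card_cartesian_product)
  finally show ?thesis .
qed

lemma star_nth:
  assumes "v \<in> Vs" "i < degree_at \<Gamma> v"
  shows "fst (star \<Gamma> v ! i) \<in> E"
proof -
  have "star \<Gamma> v ! i \<in> ends_at \<Gamma> v"
    using star_ends[OF assms(1)] length_star[OF assms(1)] nth_mem[of i "star \<Gamma> v"] assms(2) by simp
  then show ?thesis
    by (auto simp: ends_at_def out_arcs_def in_arcs_def)
qed

lemma star_vh: "star \<Gamma> vh = [(e0, True)]"
proof -
  have "(e0, True) \<in> set (star \<Gamma> vh)"
    using star_ends[OF vh_in_Vs] e0_in_E by (simp add: ends_at_def in_arcs_def)
  then show ?thesis
    using length_star[OF vh_in_Vs] degree_vh by (cases "star \<Gamma> vh") auto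
qed

text \<open>Each edge end lies at exactly one vertex, so the sets \<open>ends_at\<close> partition
  the ends of all edges. With \<phi> constant it is the handshake identity, which makes the bordered
  system square.\<close>

lemma sum_over_ends:
  fixes \<phi> :: "'e \<times> bool \<Rightarrow> 'a::comm_monoid_add"
  shows "(\<Sum>v\<in>Vs. \<Sum>i<degree_at \<Gamma> v. \<phi> (star \<Gamma> v ! i)) = (\<Sum>e\<in>E. \<phi> (e, False) + \<phi> (e, True))"
proof -
  have "(\<Sum>v\<in>Vs. \<Sum>i<degree_at \<Gamma> v. \<phi> (star \<Gamma> v ! i)) = (\<Sum>v\<in>Vs. \<Sum>\<epsilon>\<in>ends_at \<Gamma> v. \<phi> \<epsilon>)"
  proof (rule sum.cong[OF refl])
    fix v assume v: "v \<in> Vs"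
    show "(\<Sum>i<degree_at \<Gamma> v. \<phi> (star \<Gamma> v ! i)) = (\<Sum>\<epsilon>\<in>ends_at \<Gamma> v. \<phi> \<epsilon>)"
      using star_ends[OF v] length_star[OF v]
      by (intro sum.reindex_bij_betw bij_betw_nth) auto
  qed
  also have "\<dots> = (\<Sum>\<epsilon>\<in>(\<Union>v\<in>Vs. ends_at \<Gamma> v). \<phi> \<epsilon>)"
    by (rule sum.UNION_disjoint[symmetric])
      (auto simp: finite_Vs finite_ends, auto simp: ends_at_def in_arcs_def out_arcs_def)
  also have "(\<Union>v\<in>Vs. ends_at \<Gamma> v) = E \<times> UNIV"
  proof (intro equalityI subsetI)
    fix \<epsilon> assume "\<epsilon> \<in> E \<times> (UNIV :: bool set)"
    then show "\<epsilon> \<in> (\<Union>v\<in>Vs. ends_at \<Gamma> v)"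
      using head_tail_in_Vs by (cases "snd \<epsilon>") (auto simp: ends_at_def in_arcs_def out_arcs_def)
  qed (auto simp: ends_at_def in_arcs_def out_arcs_def)
  also have "(\<Sum>\<epsilon>\<in>E \<times> UNIV. \<phi> \<epsilon>) = (\<Sum>e\<in>E. \<Sum>b\<in>UNIV. \<phi> (e, b))"
    by (simp add: sum.cartesian_product)
  also have "\<dots> = (\<Sum>e\<in>E. \<phi> (e, False) + \<phi> (e, True))"
    by (simp add: UNIV_bool add.commute)
  finally show ?thesis .
qed

text \<open>
  The functions \<open>u\<close> may be defined on longer edges; the length \<open>s\<close> of the loose edge only
  determines where they are evaluated.
\<close>

definition ev :: "real \<Rightarrow> ('e \<Rightarrow> real \<Rightarrow> complex) \<Rightarrow> 'e \<times> bool \<Rightarrow> complex" where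
  "ev s u \<epsilon> = (if snd \<epsilon> then u (fst \<epsilon>) (len s (fst \<epsilon>)) else u (fst \<epsilon>) 0)"

definition ed :: "real \<Rightarrow> ('e \<Rightarrow> real \<Rightarrow> complex) \<Rightarrow> 'e \<times> bool \<Rightarrow> complex" where
  "ed s u' \<epsilon> = (if snd \<epsilon> then - u' (fst \<epsilon>) (len s (fst \<epsilon>)) else u' (fst \<epsilon>) 0)"

text \<open>The derivative enters as an independent argument, so that the defect is linear in the
  pair and involves no differentiation.\<close>

definition defect :: "real \<Rightarrow> ('e \<Rightarrow> real \<Rightarrow> complex) \<Rightarrow> ('e \<Rightarrow> real \<Rightarrow> complex) \<Rightarrow> 'v \<Rightarrow> nat \<Rightarrow> complex" where
  "defect s u u' v i = (\<Sum>j<degree_at \<Gamma> v. condA \<Gamma> v $$ (i, j) * ev s u (star \<Gamma> v ! j)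
     + condB \<Gamma> v $$ (i, j) * ed s u' (star \<Gamma> v ! j))"

lemma satisfies_at_iff:
  assumes v: "v \<in> Vs"
  shows "satisfies_at \<Gamma> v (vec_of_list (map F (star \<Gamma> v))) (vec_of_list (map F' (star \<Gamma> v))) \<longleftrightarrow>
    (\<forall>i<degree_at \<Gamma> v. (\<Sum>j<degree_at \<Gamma> v. condA \<Gamma> v $$ (i, j) * F (star \<Gamma> v ! j)
       + condB \<Gamma> v $$ (i, j) * F' (star \<Gamma> v ! j)) = 0)"
proof -
  define d where "d = degree_at \<Gamma> v"
  have AB: "condA \<Gamma> v \<in> carrier_mat d d" "condB \<Gamma> v \<in> carrier_mat d d"
    using vertex_condition[OF v] by (auto simp: self_adjoint_condition_def d_def)
  have vec: "vec_of_list (map H (star \<Gamma> v)) = Matrix.vec d (\<lambda>j. H (star \<Gamma> v ! j))"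
    for H :: "'e \<times> bool \<Rightarrow> complex"
    using length_star[OF v] by (intro eq_vecI) (auto simp: d_def vec_of_list_index)
  have "(condA \<Gamma> v *\<^sub>v Matrix.vec d (\<lambda>j. F (star \<Gamma> v ! j)) + condB \<Gamma> v *\<^sub>v Matrix.vec d (\<lambda>j. F' (star \<Gamma> v ! j))) $ i
      = (\<Sum>j<d. condA \<Gamma> v $$ (i, j) * F (star \<Gamma> v ! j) + condB \<Gamma> v $$ (i, j) * F' (star \<Gamma> v ! j))"
    if "i < d" for i
    using that AB by (simp add: scalar_prod_def atLeast0LessThan sum.distrib)
  then show ?thesis
    unfolding satisfies_at_def vec d_def[symmetric] using AB
    by (auto simp: Matrix.vec_eq_iff)
qed

lemma vertex_boundary_form:
  assumes v: "v \<in> Vs"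
    and u: "\<And>i. i < degree_at \<Gamma> v \<Longrightarrow> defect s u u' v i = 0"
    and w: "\<And>i. i < degree_at \<Gamma> v \<Longrightarrow> defect s w w' v i = 0"
  shows "(\<Sum>j<degree_at \<Gamma> v. cnj (ev s u (star \<Gamma> v ! j)) * ed s w' (star \<Gamma> v ! j)
    - cnj (ed s u' (star \<Gamma> v ! j)) * ev s w (star \<Gamma> v ! j)) = 0"
proof (rule self_adjoint_condition_boundary_form[OF vertex_condition[OF v]])
  have AB: "condA \<Gamma> v \<in> carrier_mat (degree_at \<Gamma> v) (degree_at \<Gamma> v)"
    "condB \<Gamma> v \<in> carrier_mat (degree_at \<Gamma> v) (degree_at \<Gamma> v)"
    using vertex_condition[OF v] by (auto simp: self_adjoint_condition_def)
  have *: "condA \<Gamma> v *\<^sub>v Matrix.vec (degree_at \<Gamma> v) (\<lambda>j. ev s u (star \<Gamma> v ! j))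
      + condB \<Gamma> v *\<^sub>v Matrix.vec (degree_at \<Gamma> v) (\<lambda>j. ed s u' (star \<Gamma> v ! j)) = 0\<^sub>v (degree_at \<Gamma> v)"
    if "\<And>i. i < degree_at \<Gamma> v \<Longrightarrow> defect s u u' v i = 0" for u u'
    using that AB
    by (intro eq_vecI) (auto simp: defect_def scalar_prod_def atLeast0LessThan sum.distrib)
  show "condA \<Gamma> v *\<^sub>v Matrix.vec (degree_at \<Gamma> v) (\<lambda>j. ev s u (star \<Gamma> v ! j))
      + condB \<Gamma> v *\<^sub>v Matrix.vec (degree_at \<Gamma> v) (\<lambda>j. ed s u' (star \<Gamma> v ! j)) = 0\<^sub>v (degree_at \<Gamma> v)"
    using u by (rule *)
  show "condA \<Gamma> v *\<^sub>v Matrix.vec (degree_at \<Gamma> v) (\<lambda>j. ev s w (star \<Gamma> v ! j))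
      + condB \<Gamma> v *\<^sub>v Matrix.vec (degree_at \<Gamma> v) (\<lambda>j. ed s w' (star \<Gamma> v ! j)) = 0\<^sub>v (degree_at \<Gamma> v)"
    using w by (rule *)
qed

text \<open>The Dirichlet hypothesis describes the solution set of the condition rather than
  particular matrices; degree 1 turns the vector of values into the single number
  \<open>u e0 s\<close>.\<close>

lemma dirichlet_value:
  assumes "\<And>i. i < degree_at \<Gamma> vh \<Longrightarrow> defect s u u' vh i = 0"
  shows "u e0 s = 0"
proof -
  have "satisfies_at \<Gamma> vh (vec_of_list (map (ev s u) (star \<Gamma> vh))) (vec_of_list (map (ed s u') (star \<Gamma> vh)))"
    unfolding satisfies_at_iff[OF vh_in_Vs] using assms by (simp add: defect_def)
  moreover have "vec_of_list (map F (star \<Gamma> vh)) \<in> carrier_vec (degree_at \<Gamma> vh)"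
    for F :: "'e \<times> bool \<Rightarrow> complex"
    by (intro carrier_vecI) (simp add: length_star[OF vh_in_Vs])
  ultimately have "vec_of_list (map (ev s u) (star \<Gamma> vh)) = 0\<^sub>v (degree_at \<Gamma> vh)"
    using dirichlet unfolding dirichlet_at_def by blast
  then have "vec_of_list (map (ev s u) (star \<Gamma> vh)) $ 0 = 0\<^sub>v 1 $ 0"
    unfolding degree_vh by (rule arg_cong)
  then show ?thesis
    by (simp add: star_vh ev_def vec_of_list_index)
qed

section \<open>Boundary value problems and Green's identity on the graph\<close>

text \<open>This is u'' = (V - \<alpha>) u + \<kappa> g, hence the sign - \<kappa> g when the
  equation is solved for - u'' + V u. The case \<kappa> = 0 is the eigenvalue equation.\<close>

definition edge_solutions where
  "edge_solutions s \<alpha> \<kappa> g u u' \<longleftrightarrow>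
     (\<forall>e\<in>E. sturm_solution (len s e) (shifted_pot \<alpha> e) (\<lambda>x. \<kappa> * g e x) (u e) (u' e))"

definition vertex_conditions where
  "vertex_conditions s u u' \<longleftrightarrow> (\<forall>v\<in>Vs. \<forall>i<degree_at \<Gamma> v. defect s u u' v i = 0)"

lemma vertex_conditions_dirichlet: "vertex_conditions s u u' \<Longrightarrow> u e0 s = 0"
  using dirichlet_value[of s u u'] vh_in_Vs unfolding vertex_conditions_def by blast

definition ip :: "real \<Rightarrow> ('e \<Rightarrow> real \<Rightarrow> complex) \<Rightarrow> ('e \<Rightarrow> real \<Rightarrow> complex) \<Rightarrow> complex" where
  "ip s u w = (\<Sum>e\<in>E. integral {0..len s e} (\<lambda>x. cnj (u e x) * w e x))"

definition edge_continuous :: "real \<Rightarrow> ('e \<Rightarrow> real \<Rightarrow> complex) \<Rightarrow> bool" where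
  "edge_continuous s g \<longleftrightarrow> (\<forall>e\<in>E. continuous_on {0..len s e} (g e))"

lemma edge_solutions_continuous:
  "edge_solutions s \<alpha> \<kappa> g u u' \<Longrightarrow> edge_continuous s u"
  "edge_solutions s \<alpha> \<kappa> g u u' \<Longrightarrow> edge_continuous s u'"
  unfolding edge_solutions_def edge_continuous_def by (auto dest: sturm_solutionD)

lemma edge_solutions_mono:
  "edge_solutions t \<alpha> \<kappa> g u u' \<Longrightarrow> s \<le> t \<Longrightarrow> edge_solutions s \<alpha> \<kappa> g u u'"
  unfolding edge_solutions_def using sturm_solution_restrict len_mono by blast

lemma edge_continuous_mono: "edge_continuous t g \<Longrightarrow> s \<le> t \<Longrightarrow> edge_continuous s g"
  unfolding edge_continuous_def using len_mono
  by (meson atLeastatMost_subset_iff continuous_on_subset order_refl)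

lemma ip_integrable:
  assumes "edge_continuous s u" "edge_continuous s w" "e \<in> E"
  shows "(\<lambda>x. cnj (u e x) * w e x) integrable_on {0..len s e}"
  using assms unfolding edge_continuous_def
  by (intro integrable_continuous_real continuous_on_mult continuous_on_cnj) auto

lemma ip_cnj: "ip s w u = cnj (ip s u w)"
  by (simp add: ip_def integral_cnj mult.commute)

text \<open>Sum of the Lagrange identities of all edges. The real potential cancels; the difference
  of the spectral parameters and the two forcing terms remain.\<close>

lemma green_edges:
  assumes t: "0 < t" "t < S" and g: "edge_continuous t g"
    and u: "edge_solutions t \<alpha> \<kappa> g u u'" and w: "edge_solutions t \<beta> \<kappa>' g w w'"
  shows "(of_real \<alpha> - of_real \<beta>) * ip t u w + \<kappa>' * ip t u g - cnj \<kappa> * ip t g w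
    = (\<Sum>e\<in>E. (cnj (u e (len t e)) * w' e (len t e) - cnj (u' e (len t e)) * w e (len t e))
        - (cnj (u e 0) * w' e 0 - cnj (u' e 0) * w e 0))"
proof -
  have cu: "edge_continuous t u" and cw: "edge_continuous t w"
    using u w by (auto dest: edge_solutions_continuous)
  have "(of_real \<alpha> - of_real \<beta>) * integral {0..len t e} (\<lambda>x. cnj (u e x) * w e x)
      + \<kappa>' * integral {0..len t e} (\<lambda>x. cnj (u e x) * g e x)
      - cnj \<kappa> * integral {0..len t e} (\<lambda>x. cnj (g e x) * w e x)
      = (cnj (u e (len t e)) * w' e (len t e) - cnj (u' e (len t e)) * w e (len t e))
        - (cnj (u e 0) * w' e 0 - cnj (u' e 0) * w e 0)" if e: "e \<in> E" for e
  proof -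
    have ge: "(\<lambda>x. c * g e x) absolutely_integrable_on {0..len t e}" for c
      using g e by (intro absolutely_integrable_continuous_real continuous_on_mult_left)
        (auto simp: edge_continuous_def)
    have int: "(\<lambda>x. cnj (u e x) * w e x) integrable_on {0..len t e}"
      "(\<lambda>x. cnj (u e x) * g e x) integrable_on {0..len t e}"
      "(\<lambda>x. cnj (g e x) * w e x) integrable_on {0..len t e}"
      using ip_integrable g cu cw e by blast+
    have "integral {0..len t e} (\<lambda>x. (of_real \<alpha> - of_real \<beta>) * (cnj (u e x) * w e x)
          + \<kappa>' * (cnj (u e x) * g e x) - cnj \<kappa> * (cnj (g e x) * w e x))
        = integral {0..len t e} (\<lambda>x. cnj (u e x) * (shifted_pot \<beta> e x * w e x + \<kappa>' * g e x)
          - cnj (shifted_pot \<alpha> e x * u e x + \<kappa> * g e x) * w e x)"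
      by (intro integral_cong) (simp add: shifted_pot_def algebra_simps)
    also have "\<dots> = (cnj (u e (len t e)) * w' e (len t e) - cnj (u' e (len t e)) * w e (len t e))
        - (cnj (u e 0) * w' e 0 - cnj (u' e 0) * w e 0)"
      using u w e len_pos[OF e t(1)] ge
      by (intro sturm_lagrange_identity shifted_pot_integrable[OF e t]) (auto simp: edge_solutions_def)
    finally show ?thesis
      using int
      by (simp add: Henstock_Kurzweil_Integration.integral_diff Henstock_Kurzweil_Integration.integral_add
          integrable_add integrable_on_mult_right)
  qed
  then show ?thesis
    unfolding ip_def sum_distrib_left sum.distrib[symmetric] sum_subtractf[symmetric]
    by (intro sum.cong) auto
qed

text \<open>A vertex whose condition holds for both functions contributes 0. The end-vertex is left
  out on purpose: a solution belonging to another length satisfies every condition but that one, and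
  its boundary term there produces the derivative of the eigenvalue.\<close>

lemma green:
  assumes t: "0 < t" "t < S" and g: "edge_continuous t g"
    and u: "edge_solutions t \<alpha> \<kappa> g u u'" and w: "edge_solutions t \<beta> \<kappa>' g w w'"
    and vu: "\<And>v i. v \<in> Vs \<Longrightarrow> v \<noteq> vh \<Longrightarrow> i < degree_at \<Gamma> v \<Longrightarrow> defect t u u' v i = 0"
    and vw: "\<And>v i. v \<in> Vs \<Longrightarrow> v \<noteq> vh \<Longrightarrow> i < degree_at \<Gamma> v \<Longrightarrow> defect t w w' v i = 0"
  shows "(of_real \<alpha> - of_real \<beta>) * ip t u w + \<kappa>' * ip t u g - cnj \<kappa> * ip t g w
    = cnj (u e0 t) * w' e0 t - cnj (u' e0 t) * w e0 t"
proof -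
  \<comment> \<open>The boundary form at one edge end, with derivatives taken into the edge. The
    sign at the head turns the end-point differences on the edges into minus the sum over all
    ends.\<close>
  define \<phi> where "\<phi> \<epsilon> = cnj (ev t u \<epsilon>) * ed t w' \<epsilon> - cnj (ed t u' \<epsilon>) * ev t w \<epsilon>" for \<epsilon>
  have "(\<Sum>e\<in>E. (cnj (u e (len t e)) * w' e (len t e) - cnj (u' e (len t e)) * w e (len t e))
        - (cnj (u e 0) * w' e 0 - cnj (u' e 0) * w e 0)) = - (\<Sum>e\<in>E. \<phi> (e, False) + \<phi> (e, True))"
    unfolding sum_negf[symmetric] by (intro sum.cong refl) (simp add: \<phi>_def ev_def ed_def)
  also have "(\<Sum>e\<in>E. \<phi> (e, False) + \<phi> (e, True)) = (\<Sum>v\<in>Vs. \<Sum>i<degree_at \<Gamma> v. \<phi> (star \<Gamma> v ! i))"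
    by (rule sum_over_ends[symmetric])
  also have "\<dots> = (\<Sum>i<degree_at \<Gamma> vh. \<phi> (star \<Gamma> vh ! i))
      + (\<Sum>v\<in>Vs - {vh}. \<Sum>i<degree_at \<Gamma> v. \<phi> (star \<Gamma> v ! i))"
    by (rule sum.remove[OF finite_Vs vh_in_Vs])
  also have "(\<Sum>v\<in>Vs - {vh}. \<Sum>i<degree_at \<Gamma> v. \<phi> (star \<Gamma> v ! i)) = 0"
    using vertex_boundary_form[of _ t u u' w w'] vu vw by (intro sum.neutral) (auto simp: \<phi>_def)
  also have "(\<Sum>i<degree_at \<Gamma> vh. \<phi> (star \<Gamma> vh ! i)) = \<phi> (e0, True)"
    by (simp add: degree_vh star_vh)
  finally show ?thesis
    unfolding green_edges[OF t g u w] by (simp add: \<phi>_def ev_def ed_def)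
qed

lemma green_bvp:
  assumes t: "0 < t" "t < S" and g: "edge_continuous t g"
    and u: "edge_solutions t \<alpha> \<kappa> g u u'" "vertex_conditions t u u'"
    and w: "edge_solutions t \<beta> \<kappa>' g w w'" "vertex_conditions t w w'"
  shows "(of_real \<alpha> - of_real \<beta>) * ip t u w + \<kappa>' * ip t u g - cnj \<kappa> * ip t g w = 0"
proof -
  have "cnj (u e0 t) * w' e0 t - cnj (u' e0 t) * w e0 t = 0"
    by (simp add: vertex_conditions_dirichlet[OF u(2)] vertex_conditions_dirichlet[OF w(2)])
  moreover have "defect t u u' v i = 0" "defect t w w' v i = 0"
    if "v \<in> Vs" "i < degree_at \<Gamma> v" for v i
    using u(2) w(2) that unfolding vertex_conditions_def by blast+
  ultimately show ?thesis
    using green[OF t g u(1) w(1)] by metis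
qed

section \<open>Eigenspaces as solution spaces of boundary value problems\<close>

lemma end_value_eq: "end_value (set_length \<Gamma> e0 s) f \<epsilon> = ev s f \<epsilon>"
  by (cases \<epsilon>; cases "snd \<epsilon>") (auto simp: ev_def elen_len)

lemma end_deriv_eq: "end_deriv (set_length \<Gamma> e0 s) f \<epsilon> = ed s (\<lambda>e. seg_deriv (len s e) (f e)) \<epsilon>"
  by (cases \<epsilon>; cases "snd \<epsilon>") (auto simp: ed_def elen_len)

lemma defect_cong:
  assumes "v \<in> Vs" "i < degree_at \<Gamma> v" "0 < s"
    and "\<And>e x. e \<in> E \<Longrightarrow> x \<in> {0..len s e} \<Longrightarrow> u e x = w e x"
    and "\<And>e x. e \<in> E \<Longrightarrow> x \<in> {0..len s e} \<Longrightarrow> u' e x = w' e x"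
  shows "defect s u u' v i = defect s w w' v i"
  unfolding defect_def ev_def ed_def
  using assms star_nth[OF assms(1)] len_pos[OF _ assms(3)]
  by (intro sum.cong refl arg_cong2[where f = "(+)"] arg_cong2[where f = "(*)"]) (auto simp: less_imp_le)

lemma vertex_conditions_cong:
  assumes "0 < s"
    and "\<And>e x. e \<in> E \<Longrightarrow> x \<in> {0..len s e} \<Longrightarrow> u e x = w e x"
    and "\<And>e x. e \<in> E \<Longrightarrow> x \<in> {0..len s e} \<Longrightarrow> u' e x = w' e x"
  shows "vertex_conditions s u u' \<longleftrightarrow> vertex_conditions s w w'"
  unfolding vertex_conditions_def using defect_cong[OF _ _ assms] by simp

lemma vertex_conditions_iff:
  "vertex_conditions s f (\<lambda>e. seg_deriv (len s e) (f e)) \<longleftrightarrow>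
    (\<forall>v \<in> Vs. satisfies_at \<Gamma> v (vec_of_list (map (end_value (set_length \<Gamma> e0 s) f) (star \<Gamma> v)))
      (vec_of_list (map (end_deriv (set_length \<Gamma> e0 s) f) (star \<Gamma> v))))"
  unfolding end_value_eq[abs_def] end_deriv_eq[abs_def] vertex_conditions_def defect_def
  using satisfies_at_iff by simp

text \<open>The forcing has coefficient 0, so \<open>g\<close> is arbitrary and can be chosen to
  match the other solution in Green's identity.\<close>

lemma eigenspaceD:
  assumes f: "f \<in> eigenspace (set_length \<Gamma> e0 s) (of_real \<alpha>)" and s: "0 < s"
  shows "edge_solutions s \<alpha> 0 g f (\<lambda>e. seg_deriv (len s e) (f e))"
    and "vertex_conditions s f (\<lambda>e. seg_deriv (len s e) (f e))"
    and "\<not> (e \<in> E \<and> x \<in> {0..len s e}) \<Longrightarrow> f e x = 0"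
proof -
  have dom: "f \<in> ham_dom (set_length \<Gamma> e0 s)"
    and ham: "\<And>e. e \<in> E \<Longrightarrow> \<exists>h. H2_seg (len s e) (f e) h \<and>
      (AE x in lebesgue_on {0..len s e}. of_real \<alpha> * f e x = - h x + of_real (pot \<Gamma> e x) * f e x)"
    using f unfolding eigenspace_def ham_def elen_len by auto
  show "vertex_conditions s f (\<lambda>e. seg_deriv (len s e) (f e))"
    using dom unfolding vertex_conditions_iff ham_dom_def by simp
  show "f e x = 0" if "\<not> (e \<in> E \<and> x \<in> {0..len s e})"
    using dom that unfolding ham_dom_def elen_len by simp
  show "edge_solutions s \<alpha> 0 g f (\<lambda>e. seg_deriv (len s e) (f e))"
    unfolding edge_solutions_def
  proof
    fix e assume e: "e \<in> E"
    obtain h where h: "H2_seg (len s e) (f e) h"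
      and ae: "AE x in lebesgue_on {0..len s e}. of_real \<alpha> * f e x = - h x + of_real (pot \<Gamma> e x) * f e x"
      using ham[OF e] by blast
    show "sturm_solution (len s e) (shifted_pot \<alpha> e) (\<lambda>x. 0 * g e x) (f e) (seg_deriv (len s e) (f e))"
    proof (rule H2_seg_imp_sturm_solution[OF h len_pos[OF e s]])
      show "AE x in lebesgue_on {0..len s e}. h x = shifted_pot \<alpha> e x * f e x + 0 * g e x"
        using ae by eventually_elim (simp add: shifted_pot_def algebra_simps)
    qed
  qed
qed

text \<open>The solution may live on longer edges; the eigenfunction is its restriction, continued
  by zero as \<open>ham_dom\<close> demands.\<close>

lemma eigenspaceI:
  assumes u: "edge_solutions s \<alpha> 0 g u u'" "vertex_conditions s u u'" and s: "0 < s" "s < S"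
    and f: "\<And>e x. f e x = (if e \<in> E \<and> x \<in> {0..len s e} then u e x else 0)"
  shows "f \<in> eigenspace (set_length \<Gamma> e0 s) (of_real \<alpha>)"
    and "e \<in> E \<Longrightarrow> x \<in> {0..len s e} \<Longrightarrow> seg_deriv (len s e) (f e) x = u' e x"
proof -
  have sol: "sturm_solution (len s e) (shifted_pot \<alpha> e) (\<lambda>x. 0 * g e x) (u e) (u' e)"
    and fu: "\<And>x. x \<in> {0..len s e} \<Longrightarrow> f e x = u e x" if "e \<in> E" for e
    using u(1) that f by (auto simp: edge_solutions_def)
  show deriv: "seg_deriv (len s e) (f e) x = u' e x" if "e \<in> E" "x \<in> {0..len s e}" for e x
    using that(2) len_pos[OF that(1) s(1)] fu[OF that(1)] by (rule sturm_solution_seg_deriv[OF sol[OF that(1)]])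
  have H2: "H2_seg (len s e) (f e) (\<lambda>x. shifted_pot \<alpha> e x * u e x + 0 * g e x)" if e: "e \<in> E" for e
  proof (rule sturm_solution_imp_H2_seg[OF sol[OF e] len_pos[OF e s(1)] _ fu[OF e]])
    show "L2_seg (len s e) (\<lambda>x. shifted_pot \<alpha> e x * u e x + 0 * g e x)"
      using L2_seg_mult_continuous[OF shifted_pot_L2[OF e s] sturm_solutionD(1)[OF sol[OF e]]] by simp
  qed
  have "vertex_conditions s f (\<lambda>e. seg_deriv (len s e) (f e))"
    using u(2) vertex_conditions_cong[OF s(1), of f u "\<lambda>e. seg_deriv (len s e) (f e)" u'] fu deriv by simp
  then have dom: "f \<in> ham_dom (set_length \<Gamma> e0 s)"
    using H2 f unfolding vertex_conditions_iff ham_dom_def elen_len by auto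
  have "\<exists>h. H2_seg (len s e) (f e) h \<and>
      (AE x in lebesgue_on {0..len s e}. of_real \<alpha> * f e x = - h x + of_real (pot \<Gamma> e x) * f e x)"
    if e: "e \<in> E" for e
  proof (intro exI conjI)
    show "AE x in lebesgue_on {0..len s e}. of_real \<alpha> * f e x
        = - (shifted_pot \<alpha> e x * u e x + 0 * g e x) + of_real (pot \<Gamma> e x) * f e x"
      using fu[OF e] by (intro AE_I2) (simp add: shifted_pot_def algebra_simps)
  qed (rule H2[OF e])
  then show "f \<in> eigenspace (set_length \<Gamma> e0 s) (of_real \<alpha>)"
    using dom unfolding eigenspace_def ham_def elen_len by simp
qed

subsection \<open>The bordered problem\<close>

lemma vertex_conditionsD:
  "vertex_conditions s u u' \<Longrightarrow> v \<in> Vs \<Longrightarrow> i < degree_at \<Gamma> v \<Longrightarrow> defect s u u' v i = 0"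
  unfolding vertex_conditions_def by blast

lemma edge_solutionsD:
  "edge_solutions s \<alpha> \<kappa> g u u' \<Longrightarrow> e \<in> E \<Longrightarrow>
    sturm_solution (len s e) (shifted_pot \<alpha> e) (\<lambda>x. \<kappa> * g e x) (u e) (u' e)"
  unfolding edge_solutions_def by blast

lemma forcing_integrable:
  assumes "edge_continuous s g" "e \<in> E"
  shows "(\<lambda>x. c * g e x) absolutely_integrable_on {0..len s e}"
  using assms unfolding edge_continuous_def
  by (intro absolutely_integrable_continuous_real continuous_on_mult_left) auto

lemma continuous_on_len: "continuous_on A (\<lambda>s. len s e)"
  by (cases "e = e0") (simp_all add: len_def)

text \<open>
  Index \<open>Some (e, False)\<close> stands for the initial value on the edge \<open>e\<close>, index \<open>Some (e, True)\<close>
  for the initial derivative, and index \<open>None\<close> for the coefficient of the forcing term \<open>g\<close>.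
\<close>

lemma basis_solutions:
  assumes L: "0 < L" "L < S" and g: "edge_continuous L g"
  obtains Y Z :: "('e \<times> bool) option \<Rightarrow> 'e \<Rightarrow> real \<Rightarrow> real \<Rightarrow> complex" where
    "\<And>j \<alpha>. edge_solutions L \<alpha> (if j = None then 1 else 0) g (\<lambda>e. Y j e \<alpha>) (\<lambda>e. Z j e \<alpha>)"
    "\<And>j e \<alpha>. e \<in> E \<Longrightarrow> Y j e \<alpha> 0 = (if j = Some (e, False) then 1 else 0)"
    "\<And>j e \<alpha>. e \<in> E \<Longrightarrow> Z j e \<alpha> 0 = (if j = Some (e, True) then 1 else 0)"
    "\<And>j e. e \<in> E \<Longrightarrow> continuous_on (UNIV \<times> {0..len L e}) (\<lambda>p. Y j e (fst p) (snd p))"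
    "\<And>j e. e \<in> E \<Longrightarrow> continuous_on (UNIV \<times> {0..len L e}) (\<lambda>p. Z j e (fst p) (snd p))"
proof -
  \<comment> \<open>All data are zero except the single one named by the index; for
    \<open>None\<close> the initial data vanish and only the forcing is switched on.\<close>
  define k :: "('e \<times> bool) option \<Rightarrow> complex" where "k j = (if j = None then 1 else 0)" for j
  define a :: "('e \<times> bool) option \<Rightarrow> 'e \<Rightarrow> complex" where "a j e = (if j = Some (e, False) then 1 else 0)" for j e
  define b :: "('e \<times> bool) option \<Rightarrow> 'e \<Rightarrow> complex" where "b j e = (if j = Some (e, True) then 1 else 0)" for j e
  have "\<exists>w. e \<in> E \<longrightarrow> sturm_solution (len L e) (shifted_pot \<alpha> e) (\<lambda>x. k j * g e x) (fst w) (snd w)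
      \<and> fst w 0 = a j e \<and> snd w 0 = b j e" for j e \<alpha>
  proof (cases "e \<in> E")
    case True
    obtain y z where "sturm_solution (len L e) (shifted_pot \<alpha> e) (\<lambda>x. k j * g e x) y z" "y 0 = a j e" "z 0 = b j e"
      by (rule sturm_solution_exists[OF shifted_pot_integrable[OF True L] forcing_integrable[OF g True]
            less_imp_le[OF len_pos[OF True L(1)]]])
    then show ?thesis
      by (intro exI[of _ "(y, z)"]) simp
  qed simp
  \<comment> \<open>A single choice over the triples (j, e, \<alpha>) makes the solutions functions
    of all three arguments.\<close>
  then have "\<forall>p. \<exists>w. fst (snd p) \<in> E \<longrightarrow>
      sturm_solution (len L (fst (snd p))) (shifted_pot (snd (snd p)) (fst (snd p)))
        (\<lambda>x. k (fst p) * g (fst (snd p)) x) (fst w) (snd w)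
      \<and> fst w 0 = a (fst p) (fst (snd p)) \<and> snd w 0 = b (fst p) (fst (snd p))"
    by blast
  from choice[OF this] obtain W0 where W0: "\<forall>p. fst (snd p) \<in> E \<longrightarrow>
      sturm_solution (len L (fst (snd p))) (shifted_pot (snd (snd p)) (fst (snd p)))
        (\<lambda>x. k (fst p) * g (fst (snd p)) x) (fst (W0 p)) (snd (W0 p))
      \<and> fst (W0 p) 0 = a (fst p) (fst (snd p)) \<and> snd (W0 p) 0 = b (fst p) (fst (snd p))" ..
  define W where "W j e \<alpha> = W0 (j, e, \<alpha>)" for j e \<alpha>
  have W: "\<And>j e \<alpha>. e \<in> E \<Longrightarrow>
      sturm_solution (len L e) (shifted_pot \<alpha> e) (\<lambda>x. k j * g e x) (fst (W j e \<alpha>)) (snd (W j e \<alpha>))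
      \<and> fst (W j e \<alpha>) 0 = a j e \<and> snd (W j e \<alpha>) 0 = b j e"
    unfolding W_def using W0 by fastforce
  define Y where "Y j e \<alpha> = fst (W j e \<alpha>)" for j e \<alpha>
  define Z where "Z j e \<alpha> = snd (W j e \<alpha>)" for j e \<alpha>
  have sol: "sturm_solution (len L e) (shifted_pot \<alpha> e) (\<lambda>x. k j * g e x) (Y j e \<alpha>) (Z j e \<alpha>)"
    and init: "Y j e \<alpha> 0 = a j e" "Z j e \<alpha> 0 = b j e" if "e \<in> E" for j e \<alpha>
    using W[OF that] by (simp_all add: Y_def Z_def)
  have cont: "continuous_on (UNIV \<times> {0..len L e}) (\<lambda>p. Y j e (fst p) (snd p))"
    "continuous_on (UNIV \<times> {0..len L e}) (\<lambda>p. Z j e (fst p) (snd p))" if e: "e \<in> E" for j e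
  proof -
    have V: "(\<lambda>x. complex_of_real (pot \<Gamma> e x)) absolutely_integrable_on {0..len L e}"
      using shifted_pot_integrable[OF e L, of 0] by (simp add: shifted_pot_def[abs_def])
    note sol' = sol[OF e, unfolded shifted_pot_def[abs_def]]
    show "continuous_on (UNIV \<times> {0..len L e}) (\<lambda>p. Y j e (fst p) (snd p))"
      "continuous_on (UNIV \<times> {0..len L e}) (\<lambda>p. Z j e (fst p) (snd p))"
      by (rule sturm_solution_continuous_parameter[OF V forcing_integrable[OF g e]
            less_imp_le[OF len_pos[OF e L(1)]] sol' init(1)[OF e] init(2)[OF e]])+
  qed
  show thesis
  proof (rule that[of Y Z])
    show "edge_solutions L \<alpha> (if j = None then 1 else 0) g (\<lambda>e. Y j e \<alpha>) (\<lambda>e. Z j e \<alpha>)" for j \<alpha>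
      using sol unfolding edge_solutions_def k_def by blast
    show "Y j e \<alpha> 0 = (if j = Some (e, False) then 1 else 0)"
      "Z j e \<alpha> 0 = (if j = Some (e, True) then 1 else 0)" if "e \<in> E" for j e \<alpha>
      using init[OF that] by (simp_all add: a_def b_def)
  qed (rule cont; assumption)+
qed

text \<open>Unknowns are two initial data per edge and the coefficient of \<open>g\<close>;
  equations are the vertex conditions and one normalization. Uniqueness for the boundary value
  problem at the base point is invertibility of the matrix, and this persists on an open set. The
  edges keep the length \<open>L\<close>, so the matrix depends on s only through points of
  evaluation and limits of integration.\<close>

lemma bordered_system:
  assumes s0: "0 < s0" "s0 < L" and L: "L < S" and g: "edge_continuous L g"
    and unique: "\<And>\<kappa> u u'. edge_solutions s0 \<alpha>0 \<kappa> g u u' \<Longrightarrow> vertex_conditions s0 u u' \<Longrightarrow>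
      ip s0 g u = 0 \<Longrightarrow> \<kappa> = 0 \<and> (\<forall>e\<in>E. \<forall>x\<in>{0..len s0 e}. u e x = 0)"
  obtains T :: "(real \<times> real) set" and \<kappa> :: "real \<times> real \<Rightarrow> complex"
    and U U' :: "real \<times> real \<Rightarrow> 'e \<Rightarrow> real \<Rightarrow> complex" where
    "open T" "(\<alpha>0, s0) \<in> T" "T \<subseteq> UNIV \<times> {0<..<L}"
    "\<And>p. p \<in> T \<Longrightarrow> edge_solutions L (fst p) (\<kappa> p) g (U p) (U' p)"
    "\<And>p. p \<in> T \<Longrightarrow> vertex_conditions (snd p) (U p) (U' p)"
    "\<And>p. p \<in> T \<Longrightarrow> ip (snd p) g (U p) = 1"
    "continuous_on T \<kappa>"
    "\<And>e. e \<in> E \<Longrightarrow> continuous_on (T \<times> {0..len L e}) (\<lambda>p. U (fst p) e (snd p))"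
    "\<And>e. e \<in> E \<Longrightarrow> continuous_on (T \<times> {0..len L e}) (\<lambda>p. U' (fst p) e (snd p))"
    "\<And>p \<kappa> u u'. p \<in> T \<Longrightarrow> edge_solutions (snd p) (fst p) \<kappa> g u u' \<Longrightarrow> vertex_conditions (snd p) u u' \<Longrightarrow>
      ip (snd p) g u = 0 \<Longrightarrow> \<kappa> = 0 \<and> (\<forall>e\<in>E. \<forall>x\<in>{0..len (snd p) e}. u e x = 0)"
proof -
  have L0: "0 < L" using s0 by simp
  obtain Y Z :: "('e \<times> bool) option \<Rightarrow> 'e \<Rightarrow> real \<Rightarrow> real \<Rightarrow> complex" where
    sol: "\<And>j \<alpha>. edge_solutions L \<alpha> (if j = None then 1 else 0) g (\<lambda>e. Y j e \<alpha>) (\<lambda>e. Z j e \<alpha>)"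
    and Y0: "\<And>j e \<alpha>. e \<in> E \<Longrightarrow> Y j e \<alpha> 0 = (if j = Some (e, False) then 1 else 0)"
    and Z0: "\<And>j e \<alpha>. e \<in> E \<Longrightarrow> Z j e \<alpha> 0 = (if j = Some (e, True) then 1 else 0)"
    and Ycont: "\<And>j e. e \<in> E \<Longrightarrow> continuous_on (UNIV \<times> {0..len L e}) (\<lambda>p. Y j e (fst p) (snd p))"
    and Zcont: "\<And>j e. e \<in> E \<Longrightarrow> continuous_on (UNIV \<times> {0..len L e}) (\<lambda>p. Z j e (fst p) (snd p))"
  proof (rule basis_solutions[OF L0 L g], goal_cases)
    case (1 Y Z)
    show ?case by (rule 1(1)[OF 1(2-6)])
  qed
  define J :: "('e \<times> bool) option set" where "J = insert None (Some ` (E \<times> UNIV))"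
  define I :: "('v \<times> nat) option set" where "I = insert None (Some ` (SIGMA v:Vs. {..<degree_at \<Gamma> v}))"
  have finJ: "finite J" and finI: "finite I"
    using finite_E finite_Vs by (auto simp: J_def I_def)
  \<comment> \<open>The sum of the degrees is twice the number of edges.\<close>
  have "card (SIGMA v:Vs. {..<degree_at \<Gamma> v}) = card (E \<times> (UNIV :: bool set))"
    using sum_over_ends[of "\<lambda>_. 1 :: nat"] finite_E finite_Vs by (simp add: card_SigmaI card_cartesian_product)
  then have card: "card I = card J"
    using finite_E finite_Vs by (simp add: I_def J_def card_image image_iff)
  \<comment> \<open>Row \<open>None\<close> is the pairing with \<open>g\<close>; the other rows are
    the components of the vertex conditions.\<close>
  define R where "R i s u u' = (case i of None \<Rightarrow> ip s g u | Some (v, m) \<Rightarrow> defect s u u' v m)"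
    for i :: "('v \<times> nat) option" and s u u'
  define M where "M i j p = R i (snd p) (\<lambda>e. Y j e (fst p)) (\<lambda>e. Z j e (fst p))" for i j and p :: "real \<times> real"
  define CU where "CU c \<alpha> e x = (\<Sum>j\<in>J. c j * Y j e \<alpha> x)" for c \<alpha> e x
  define CU' where "CU' c \<alpha> e x = (\<Sum>j\<in>J. c j * Z j e \<alpha> x)" for c \<alpha> e x
  have R_zero: "(\<forall>i\<in>I. R i s u u' = 0) \<longleftrightarrow> vertex_conditions s u u' \<and> ip s g u = 0" for s u u'
    by (auto simp: I_def R_def vertex_conditions_def)
  have cY: "continuous_on {0..len s e} (Y j e \<alpha>)" if "e \<in> E" "s \<le> L" for j e \<alpha> s
    using edge_continuous_mono[OF edge_solutions_continuous(1)[OF sol] that(2)] that(1)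
    unfolding edge_continuous_def by blast
  have R_lin: "R i s (CU c \<alpha>) (CU' c \<alpha>) = (\<Sum>j\<in>J. M i j (\<alpha>, s) * c j)" if s: "s \<le> L" for i s c \<alpha>
  proof (cases i)
    case None
    have "integral {0..len s e} (\<lambda>x. cnj (g e x) * CU c \<alpha> e x)
        = (\<Sum>j\<in>J. c j * integral {0..len s e} (\<lambda>x. cnj (g e x) * Y j e \<alpha> x))" if e: "e \<in> E" for e
    proof -
      have int: "(\<lambda>x. cnj (g e x) * Y j e \<alpha> x) integrable_on {0..len s e}" for j
        using edge_continuous_mono[OF g s] cY[OF e s] e unfolding edge_continuous_def
        by (intro integrable_continuous_real continuous_on_mult continuous_on_cnj) auto
      have "integral {0..len s e} (\<lambda>x. cnj (g e x) * CU c \<alpha> e x)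
          = integral {0..len s e} (\<lambda>x. \<Sum>j\<in>J. c j * (cnj (g e x) * Y j e \<alpha> x))"
        by (intro integral_cong) (simp add: CU_def sum_distrib_left mult_ac)
      also have "\<dots> = (\<Sum>j\<in>J. integral {0..len s e} (\<lambda>x. c j * (cnj (g e x) * Y j e \<alpha> x)))"
        using int finJ by (intro integral_sum integrable_on_mult_right)
      finally show ?thesis by simp
    qed
    then have "ip s g (CU c \<alpha>) = (\<Sum>e\<in>E. \<Sum>j\<in>J. c j * integral {0..len s e} (\<lambda>x. cnj (g e x) * Y j e \<alpha> x))"
      by (simp add: ip_def)
    also have "\<dots> = (\<Sum>j\<in>J. ip s g (\<lambda>e. Y j e \<alpha>) * c j)"
      by (subst sum.swap) (simp add: ip_def sum_distrib_left mult.commute)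
    finally show ?thesis
      by (simp add: None R_def M_def)
  next
    case (Some vm)
    obtain v m where vm: "vm = (v, m)" by (cases vm)
    have ev: "ev s (CU c \<alpha>) \<epsilon> = (\<Sum>j\<in>J. c j * ev s (\<lambda>e. Y j e \<alpha>) \<epsilon>)" for \<epsilon>
      by (simp add: ev_def CU_def)
    have ed: "ed s (CU' c \<alpha>) \<epsilon> = (\<Sum>j\<in>J. c j * ed s (\<lambda>e. Z j e \<alpha>) \<epsilon>)" for \<epsilon>
      by (simp add: ed_def CU'_def sum_negf)
    have "defect s (CU c \<alpha>) (CU' c \<alpha>) v m = (\<Sum>j\<in>J. defect s (\<lambda>e. Y j e \<alpha>) (\<lambda>e. Z j e \<alpha>) v m * c j)"
      unfolding defect_def ev ed sum_distrib_left sum_distrib_right sum.distrib[symmetric]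
      by (subst sum.swap) (simp add: algebra_simps)
    then show ?thesis
      by (simp add: Some vm R_def M_def)
  qed
  have CU_sol: "edge_solutions L \<alpha> (c None) g (CU c \<alpha>) (CU' c \<alpha>)" for c \<alpha>
    unfolding edge_solutions_def
  proof
    fix e assume e: "e \<in> E"
    have "sturm_solution (len L e) (shifted_pot \<alpha> e) (\<lambda>x. \<Sum>j\<in>J. c j * ((if j = None then 1 else 0) * g e x))
        (\<lambda>x. \<Sum>j\<in>J. c j * Y j e \<alpha> x) (\<lambda>x. \<Sum>j\<in>J. c j * Z j e \<alpha> x)"
      by (rule sturm_solution_sum[OF shifted_pot_integrable[OF e L0 L] finJ
            forcing_integrable[OF g e] edge_solutionsD[OF sol e]])
    moreover have "(\<Sum>j\<in>J. c j * ((if j = None then 1 else 0) * g e x)) = c None * g e x" for x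
    proof -
      have "(\<Sum>j\<in>J. c j * ((if j = None then 1 else 0) * g e x)) = (\<Sum>j\<in>J. if j = None then c None * g e x else 0)"
        by (intro sum.cong) auto
      also have "\<dots> = c None * g e x"
        using finJ by (simp add: J_def)
      finally show ?thesis .
    qed
    ultimately show "sturm_solution (len L e) (shifted_pot \<alpha> e) (\<lambda>x. c None * g e x) (CU c \<alpha> e) (CU' c \<alpha> e)"
      by (simp add: CU_def[abs_def] CU'_def[abs_def])
  qed
  have init: "CU c \<alpha> e 0 = c (Some (e, False))" "CU' c \<alpha> e 0 = c (Some (e, True))" if e: "e \<in> E" for c \<alpha> e
  proof -
    have *: "(\<Sum>j\<in>J. c j * (if j = Some (e, b) then 1 else 0)) = c (Some (e, b))" for b
      using e finJ by (subst sum.mono_neutral_cong_right[of J "{Some (e, b)}"]) (auto simp: J_def)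
    show "CU c \<alpha> e 0 = c (Some (e, False))" "CU' c \<alpha> e 0 = c (Some (e, True))"
      unfolding CU_def CU'_def Y0[OF e] Z0[OF e] by (rule *)+
  qed
  \<comment> \<open>From the matrix to the problem: a solution on the graph of length s is
    determined by \<kappa> and its initial data, hence is the combination of basis solutions with
    these coefficients.\<close>
  have bvp_unique: "\<kappa> = 0 \<and> (\<forall>e\<in>E. \<forall>x\<in>{0..len s e}. u e x = 0)"
    if s: "0 < s" "s \<le> L"
      and inj: "\<And>x. (\<And>i. i \<in> I \<Longrightarrow> (\<Sum>j\<in>J. M i j (\<alpha>, s) * x j) = 0) \<Longrightarrow> \<forall>j\<in>J. x j = 0"
      and u: "edge_solutions s \<alpha> \<kappa> g u u'" "vertex_conditions s u u'" "ip s g u = 0"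
    for s \<alpha> \<kappa> u u'
  proof -
    define c where "c j = (case j of None \<Rightarrow> \<kappa> | Some (e, b) \<Rightarrow> if b then u' e 0 else u e 0)" for j
    have eq: "CU c \<alpha> e x = u e x" "CU' c \<alpha> e x = u' e x" if e: "e \<in> E" and x: "x \<in> {0..len s e}" for e x
    proof -
      have sS: "s < S" using s L by simp
      have 1: "sturm_solution (len s e) (shifted_pot \<alpha> e) (\<lambda>x. \<kappa> * g e x) (CU c \<alpha> e) (CU' c \<alpha> e)"
        using edge_solutionsD[OF edge_solutions_mono[OF CU_sol s(2)] e, of \<alpha> c] by (simp add: c_def)
      note 2 = edge_solutionsD[OF u(1) e]
      have 3: "CU c \<alpha> e 0 = u e 0" "CU' c \<alpha> e 0 = u' e 0"
        using init[OF e] by (simp_all add: c_def)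
      note q = shifted_pot_integrable[OF e s(1) sS] forcing_integrable[OF edge_continuous_mono[OF g s(2)] e]
      show "CU c \<alpha> e x = u e x" "CU' c \<alpha> e x = u' e x"
        by (rule sturm_solution_unique[OF q 1 2 3 x])+
    qed
    have "ip s g (CU c \<alpha>) = ip s g u"
      unfolding ip_def using eq by (intro sum.cong refl integral_cong) auto
    moreover have "vertex_conditions s (CU c \<alpha>) (CU' c \<alpha>)"
      using vertex_conditions_cong[OF s(1), of "CU c \<alpha>" u "CU' c \<alpha>" u'] eq u(2) by simp
    ultimately have "\<forall>i\<in>I. R i s (CU c \<alpha>) (CU' c \<alpha>) = 0"
      unfolding R_zero using u(3) by simp
    then have c0: "\<forall>j\<in>J. c j = 0"
      unfolding R_lin[OF s(2)] by (intro inj) auto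
    then have "c None = 0"
      by (simp add: J_def)
    moreover have "u e x = 0" if "e \<in> E" "x \<in> {0..len s e}" for e x
      using eq(1)[OF that] c0 by (simp add: CU_def)
    ultimately show ?thesis
      by (simp add: c_def)
  qed
  \<comment> \<open>From the problem to the matrix: a null vector yields a solution that vanishes on
    the graph, and the entries of the vector are \<kappa> and the initial values and derivatives of
    that solution.\<close>
  have matrix_inj: "\<forall>j\<in>J. x j = 0"
    if "\<And>i. i \<in> I \<Longrightarrow> (\<Sum>j\<in>J. M i j (\<alpha>0, s0) * x j) = 0" for x
  proof -
    have "vertex_conditions s0 (CU x \<alpha>0) (CU' x \<alpha>0)" "ip s0 g (CU x \<alpha>0) = 0"
      using R_zero[of s0 "CU x \<alpha>0" "CU' x \<alpha>0"] R_lin[of s0 _ x \<alpha>0] that s0(2) by simp_all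
    moreover have sol0: "edge_solutions s0 \<alpha>0 (x None) g (CU x \<alpha>0) (CU' x \<alpha>0)"
      using s0(2) by (intro edge_solutions_mono[OF CU_sol]) simp
    ultimately have x0: "x None = 0" and U0: "\<And>e t. e \<in> E \<Longrightarrow> t \<in> {0..len s0 e} \<Longrightarrow> CU x \<alpha>0 e t = 0"
      using unique by blast+
    have "x (Some (e, b)) = 0" if e: "e \<in> E" for e b
    proof (cases b)
      case True
      then show ?thesis
        using sturm_solution_vanishing[OF edge_solutionsD[OF sol0 e] len_pos[OF e s0(1)] U0[OF e]] init(2)[OF e]
        by simp
    next
      case False
      then show ?thesis
        using U0[OF e, of 0] init(1)[OF e] len_pos[OF e s0(1)] by simp
    qed
    then show ?thesis
      using x0 by (auto simp: J_def)
  qed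
  define P where "P = (UNIV :: real set) \<times> {0<..<L}"
  have P: "open P" "(\<alpha>0, s0) \<in> P"
    using s0 by (auto simp: P_def intro: open_Times)
  have len_snd: "continuous_on P (\<lambda>p. len (snd p) e)" for e
    by (rule continuous_on_compose2[OF continuous_on_len[of UNIV]]) (auto intro: continuous_intros)
  have len_P: "0 < len (snd p) e \<and> len (snd p) e \<le> len L e" if "p \<in> P" "e \<in> E" for p e
    using that len_pos[of e "snd p"] len_mono[of "snd p" L e] by (auto simp: P_def)
  have at_end: "continuous_on P (\<lambda>p. F (fst p) (len (snd p) e))" "continuous_on P (\<lambda>p. F (fst p) 0)"
    if e: "e \<in> E" and F: "continuous_on (UNIV \<times> {0..len L e}) (\<lambda>p. F (fst p) (snd p))"
    for e and F :: "real \<Rightarrow> real \<Rightarrow> complex"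
  proof -
    have 1: "continuous_on P (\<lambda>p. (fst p, len (snd p) e))"
      by (intro continuous_on_Pair continuous_on_fst continuous_on_id len_snd)
    have 2: "(\<lambda>p. (fst p, len (snd p) e)) ` P \<subseteq> UNIV \<times> {0..len L e}"
      using len_P[OF _ e] by (force intro: less_imp_le)
    show "continuous_on P (\<lambda>p. F (fst p) (len (snd p) e))"
      using continuous_on_compose2[OF F 1 2] by simp
    have 3: "continuous_on P (\<lambda>p. (fst p, 0 :: real))"
      by (intro continuous_on_Pair continuous_on_fst continuous_on_id continuous_on_const)
    have 4: "(\<lambda>p. (fst p, 0 :: real)) ` P \<subseteq> UNIV \<times> {0..len L e}"
      using len_pos[OF e L0] by auto
    show "continuous_on P (\<lambda>p. F (fst p) 0)"
      using continuous_on_compose2[OF F 3 4] by simp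
  qed
  have Mcont: "continuous_on P (M i j)" if i: "i \<in> I" for i j
  proof (cases i)
    case None
    have "continuous_on P (\<lambda>p. integral {0..len (snd p) e} (\<lambda>x. cnj (g e x) * Y j e (fst p) x))" if e: "e \<in> E" for e
    proof (rule continuous_on_integral_upper[OF _ len_snd len_P[OF _ e]])
      have ge: "continuous_on {0..len L e} (g e)"
        using g e by (simp add: edge_continuous_def)
      have "continuous_on (P \<times> {0..len L e}) (\<lambda>p. g e (snd p))"
        by (rule continuous_on_compose2[OF ge]) (auto intro: continuous_intros)
      moreover have "continuous_on (P \<times> {0..len L e}) (\<lambda>p. Y j e (fst (fst (fst p), snd p)) (snd (fst (fst p), snd p)))"
        by (rule continuous_on_compose2[OF Ycont[OF e]]; (intro continuous_intros)?; auto)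
      ultimately show "continuous_on (P \<times> {0..len L e}) (\<lambda>p. cnj (g e (snd p)) * Y j e (fst (fst p)) (snd p))"
        by (intro continuous_on_mult continuous_on_cnj) auto
    qed
    then show ?thesis
      by (simp add: M_def[abs_def] R_def None ip_def continuous_on_sum)
  next
    case (Some vm)
    obtain v m where vm: "vm = (v, m)" by (cases vm)
    then have v: "v \<in> Vs"
      using i Some by (auto simp: I_def)
    have "continuous_on P (\<lambda>p. ev (snd p) (\<lambda>e. Y j e (fst p)) \<epsilon>)"
      "continuous_on P (\<lambda>p. ed (snd p) (\<lambda>e. Z j e (fst p)) \<epsilon>)" if "fst \<epsilon> \<in> E" for \<epsilon>
      using at_end[where F = "Y j (fst \<epsilon>)", OF that Ycont[OF that]]
        at_end[where F = "Z j (fst \<epsilon>)", OF that Zcont[OF that]]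
      by (cases "snd \<epsilon>"; simp add: ev_def ed_def continuous_on_minus)+
    then have "continuous_on P (\<lambda>p. defect (snd p) (\<lambda>e. Y j e (fst p)) (\<lambda>e. Z j e (fst p)) v m)"
      unfolding defect_def using star_nth[OF v]
      by (intro continuous_on_sum continuous_on_add continuous_on_mult_left) auto
    then show ?thesis
      by (simp add: M_def[abs_def] R_def Some vm)
  qed
  \<comment> \<open>Only the normalization row is inhomogeneous.\<close>
  define rhs :: "('v \<times> nat) option \<Rightarrow> complex" where "rhs i = (if i = None then 1 else 0)" for i
  obtain T X where T: "open T" "(\<alpha>0, s0) \<in> T" "T \<subseteq> P"
    and inj: "\<And>p x. p \<in> T \<Longrightarrow> (\<And>i. i \<in> I \<Longrightarrow> (\<Sum>j\<in>J. M i j p * x j) = 0) \<Longrightarrow> \<forall>j\<in>J. x j = 0"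
    and Xcont: "\<And>j. j \<in> J \<Longrightarrow> continuous_on T (X j)"
    and X: "\<And>p i. p \<in> T \<Longrightarrow> i \<in> I \<Longrightarrow> (\<Sum>j\<in>J. M i j p * X j p) = rhs i"
  proof (rule continuous_linear_system[where M = M and b = rhs, OF finI finJ card P], goal_cases)
    case (1 i j)
    then show ?case by (intro Mcont)
  next
    case (2 x)
    from 2(2) have "\<forall>j\<in>J. x j = 0" by (rule matrix_inj)
    with 2 show ?case by blast
  next
    case (3 T X)
    show ?case by (rule 3(1)[OF 3(2-7)])
  qed
  define U where "U p = CU (\<lambda>j. X j p) (fst p)" for p
  define U' where "U' p = CU' (\<lambda>j. X j p) (fst p)" for p
  have TP: "0 < snd p" "snd p \<le> L" if "p \<in> T" for p
    using T(3) that by (auto simp: P_def)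
  have RU: "R i (snd p) (U p) (U' p) = rhs i" if "p \<in> T" "i \<in> I" for i p
    using X[OF that] R_lin[OF TP(2)[OF that(1)], of i "\<lambda>j. X j p" "fst p"] by (simp add: U_def U'_def)
  show thesis
  proof (rule that[of T "X None" U U'])
    show "open T" "(\<alpha>0, s0) \<in> T" "T \<subseteq> UNIV \<times> {0<..<L}"
      using T by (auto simp: P_def)
    show "continuous_on T (X None)"
      by (rule Xcont) (simp add: J_def)
    show "edge_solutions L (fst p) (X None p) g (U p) (U' p)" for p
      unfolding U_def U'_def by (rule CU_sol)
    show "vertex_conditions (snd p) (U p) (U' p)" if p: "p \<in> T" for p
      unfolding vertex_conditions_def
    proof (intro ballI allI impI)
      fix v i assume "v \<in> Vs" "i < degree_at \<Gamma> v"
      then show "defect (snd p) (U p) (U' p) v i = 0"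
        using RU[OF p, of "Some (v, i)"] by (simp add: I_def R_def rhs_def)
    qed
    show "ip (snd p) g (U p) = 1" if p: "p \<in> T" for p
      using RU[OF p, of None] by (simp add: I_def R_def rhs_def)
    show "continuous_on (T \<times> {0..len L e}) (\<lambda>p. U (fst p) e (snd p))"
      "continuous_on (T \<times> {0..len L e}) (\<lambda>p. U' (fst p) e (snd p))" if e: "e \<in> E" for e
    proof -
      have X': "continuous_on (T \<times> {0..len L e}) (\<lambda>p. X j (fst p))" if "j \<in> J" for j
        by (rule continuous_on_compose2[OF Xcont[OF that]]) (auto intro: continuous_intros)
      have *: "continuous_on (T \<times> {0..len L e}) (\<lambda>p. F (fst (fst p)) (snd p))"
        if F: "continuous_on (UNIV \<times> {0..len L e}) (\<lambda>p. F (fst p) (snd p))" for F :: "real \<Rightarrow> real \<Rightarrow> complex"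
      proof -
        have "continuous_on (T \<times> {0..len L e}) (\<lambda>p. F (fst (fst (fst p), snd p)) (snd (fst (fst p), snd p)))"
          by (rule continuous_on_compose2[OF F]; (intro continuous_intros)?; auto)
        then show ?thesis by simp
      qed
      show "continuous_on (T \<times> {0..len L e}) (\<lambda>p. U (fst p) e (snd p))"
        unfolding U_def CU_def by (intro continuous_on_sum continuous_on_mult X' *[where F = "Y j e" for j, OF Ycont[OF e]])
      show "continuous_on (T \<times> {0..len L e}) (\<lambda>p. U' (fst p) e (snd p))"
        unfolding U'_def CU'_def by (intro continuous_on_sum continuous_on_mult X' *[where F = "Z j e" for j, OF Zcont[OF e]])
    qed
    show "\<kappa> = 0 \<and> (\<forall>e\<in>E. \<forall>x\<in>{0..len (snd p) e}. u e x = 0)"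
      if p: "p \<in> T" and u: "edge_solutions (snd p) (fst p) \<kappa> g u u'"
        "vertex_conditions (snd p) u u'" "ip (snd p) g u = 0" for p \<kappa> u u'
      using inj[OF p] by (intro bvp_unique[OF TP[OF p] _ u]) auto
  qed
qed

subsection \<open>The eigenvalue curve\<close>

lemma ip_cong:
  assumes "\<And>e x. e \<in> E \<Longrightarrow> x \<in> {0..len s e} \<Longrightarrow> u e x = u1 e x"
    "\<And>e x. e \<in> E \<Longrightarrow> x \<in> {0..len s e} \<Longrightarrow> w e x = w1 e x"
  shows "ip s u w = ip s u1 w1"
  unfolding ip_def using assms by (intro sum.cong refl integral_cong) auto

lemma ip_cmult: "ip s (\<lambda>e x. c * u e x) (\<lambda>e x. d * w e x) = cnj c * d * ip s u w"
proof -
  have "ip s (\<lambda>e x. c * u e x) (\<lambda>e x. d * w e x)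
      = (\<Sum>e\<in>E. integral {0..len s e} (\<lambda>x. cnj c * d * (cnj (u e x) * w e x)))"
    unfolding ip_def by (intro sum.cong refl integral_cong) (simp add: mult_ac)
  also have "\<dots> = cnj c * d * ip s u w"
    by (simp only: integral_mult_right ip_def sum_distrib_left)
  finally show ?thesis .
qed

lemma ip_cmult_right: "ip s u (\<lambda>e x. d * w e x) = d * ip s u w"
  using ip_cmult[of s 1 u d w] by simp

lemma ip_diff_right:
  assumes "edge_continuous s u" "edge_continuous s w1" "edge_continuous s w2"
  shows "ip s u (\<lambda>e x. w1 e x - w2 e x) = ip s u w1 - ip s u w2"
proof -
  have "integral {0..len s e} (\<lambda>x. cnj (u e x) * (w1 e x - w2 e x))
      = integral {0..len s e} (\<lambda>x. cnj (u e x) * w1 e x) - integral {0..len s e} (\<lambda>x. cnj (u e x) * w2 e x)"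
    if "e \<in> E" for e
    unfolding right_diff_distrib
    by (intro Henstock_Kurzweil_Integration.integral_diff ip_integrable assms that)
  then show ?thesis
    by (simp add: ip_def sum_subtractf)
qed

lemma ip_self:
  assumes "edge_continuous s u"
  shows "ip s u u = of_real (\<Sum>e\<in>E. integral {0..len s e} (\<lambda>x. (norm (u e x))\<^sup>2))"
proof -
  have "integral {0..len s e} (\<lambda>x. cnj (u e x) * u e x)
      = of_real (integral {0..len s e} (\<lambda>x. (norm (u e x))\<^sup>2))" if e: "e \<in> E" for e
  proof -
    have "(\<lambda>x. (norm (u e x))\<^sup>2) integrable_on {0..len s e}"
      using assms e unfolding edge_continuous_def
      by (intro integrable_continuous_real continuous_on_power continuous_on_norm) auto
    then have "((\<lambda>x. complex_of_real ((norm (u e x))\<^sup>2)) has_integral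
        of_real (integral {0..len s e} (\<lambda>x. (norm (u e x))\<^sup>2))) {0..len s e}"
      by (intro has_integral_of_real integrable_integral)
    moreover have "complex_of_real ((norm (u e x))\<^sup>2) = cnj (u e x) * u e x" for x
      by (simp only: complex_norm_square mult.commute)
    ultimately show ?thesis
      by (simp only: integral_unique)
  qed
  then show ?thesis
    by (simp add: ip_def)
qed

lemma ip_self_eq_0D:
  assumes u: "edge_continuous s u" and s: "0 < s" and 0: "ip s u u = 0" and e: "e \<in> E" and x: "x \<in> {0..len s e}"
  shows "u e x = 0"
proof -
  have c: "continuous_on {0..len s e} (\<lambda>x. (norm (u e x))\<^sup>2)" if "e \<in> E" for e
    using u that unfolding edge_continuous_def
    by (intro continuous_on_power continuous_on_norm) auto
  have nn: "0 \<le> integral {0..len s e} (\<lambda>x. (norm (u e x))\<^sup>2)" if "e \<in> E" for e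
    using c[OF that] by (intro integral_nonneg integrable_continuous_real) auto
  have "(\<Sum>e\<in>E. integral {0..len s e} (\<lambda>x. (norm (u e x))\<^sup>2)) = 0"
    using 0 unfolding ip_self[OF u] of_real_eq_0_iff .
  then have "integral {0..len s e} (\<lambda>x. (norm (u e x))\<^sup>2) = 0"
    using e nn sum_nonneg_eq_0_iff[OF finite_E, of "\<lambda>e. integral {0..len s e} (\<lambda>x. (norm (u e x))\<^sup>2)"] by blast
  then have "\<forall>x\<in>{0..len s e}. (norm (u e x))\<^sup>2 = 0"
    using integral_eq_0_iff[OF c[OF e] len_pos[OF e s]] by simp
  then show ?thesis
    using x by simp
qed

lemma normalized_iff:
  assumes "edge_continuous s f"
  shows "normalized (set_length \<Gamma> e0 s) f \<longleftrightarrow> ip s f f = 1"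
proof -
  have "integral\<^sup>L (lebesgue_on {0..len s e}) (\<lambda>x. (norm (f e x))\<^sup>2)
      = integral {0..len s e} (\<lambda>x. (norm (f e x))\<^sup>2)" if e: "e \<in> E" for e
  proof (rule lebesgue_integral_eq_integral)
    have "continuous_on {0..len s e} (\<lambda>x. (norm (f e x))\<^sup>2)"
      using assms e unfolding edge_continuous_def
      by (intro continuous_on_power continuous_on_norm) auto
    then show "integrable (lebesgue_on {0..len s e}) (\<lambda>x. (norm (f e x))\<^sup>2)"
      by (rule continuous_imp_integrable_real)
  qed simp
  then have "normalized (set_length \<Gamma> e0 s) f \<longleftrightarrow> (\<Sum>e\<in>E. integral {0..len s e} (\<lambda>x. (norm (f e x))\<^sup>2)) = 1"
    unfolding normalized_def elen_len by simp
  also have "\<dots> \<longleftrightarrow> ip s f f = 1"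
    unfolding ip_self[OF assms] by (simp only: of_real_eq_1_iff)
  finally show ?thesis .
qed

section \<open>Linearity of the vertex conditions and of the homogeneous problem\<close>

lemma defect_diff:
  "defect s (\<lambda>e x. u e x - w e x) (\<lambda>e x. u' e x - w' e x) v i = defect s u u' v i - defect s w w' v i"
proof -
  have eq: "ev s (\<lambda>e x. u e x - w e x) \<epsilon> = ev s u \<epsilon> - ev s w \<epsilon>"
    "ed s (\<lambda>e x. u' e x - w' e x) \<epsilon> = ed s u' \<epsilon> - ed s w' \<epsilon>" for \<epsilon>
    by (simp_all add: ev_def ed_def)
  then show ?thesis
    unfolding defect_def eq sum_subtractf[symmetric] by (intro sum.cong refl) (simp add: algebra_simps)
qed

lemma defect_cmult:
  "defect s (\<lambda>e x. c * u e x) (\<lambda>e x. c * u' e x) v i = c * defect s u u' v i"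
proof -
  have eq: "ev s (\<lambda>e x. c * u e x) \<epsilon> = c * ev s u \<epsilon>" "ed s (\<lambda>e x. c * u' e x) \<epsilon> = c * ed s u' \<epsilon>" for \<epsilon>
    by (simp_all add: ev_def ed_def)
  then show ?thesis
    unfolding defect_def eq sum_distrib_left by (intro sum.cong refl) (simp add: algebra_simps)
qed

lemma edge_solutions_homogeneous:
  "edge_solutions s \<alpha> 0 g u u' \<Longrightarrow> edge_solutions s \<alpha> 0 g1 u u'"
  unfolding edge_solutions_def by simp

lemma bvp_cmult:
  assumes "edge_solutions s \<alpha> 0 g u u'" "vertex_conditions s u u'"
  shows "edge_solutions s \<alpha> 0 g (\<lambda>e x. c * u e x) (\<lambda>e x. c * u' e x)"
    and "vertex_conditions s (\<lambda>e x. c * u e x) (\<lambda>e x. c * u' e x)"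
proof -
  show "edge_solutions s \<alpha> 0 g (\<lambda>e x. c * u e x) (\<lambda>e x. c * u' e x)"
    unfolding edge_solutions_def
  proof
    fix e assume "e \<in> E"
    then show "sturm_solution (len s e) (shifted_pot \<alpha> e) (\<lambda>x. 0 * g e x) (\<lambda>x. c * u e x) (\<lambda>x. c * u' e x)"
      using sturm_solution_cmult[OF edge_solutionsD[OF assms(1)], of e c] by simp
  qed
  show "vertex_conditions s (\<lambda>e x. c * u e x) (\<lambda>e x. c * u' e x)"
    using assms(2) unfolding vertex_conditions_def defect_cmult by simp
qed

lemma bvp_diff:
  assumes s: "0 < s" "s < S"
    and "edge_solutions s \<alpha> 0 g u u'" "vertex_conditions s u u'"
    and "edge_solutions s \<alpha> 0 g w w'" "vertex_conditions s w w'"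
  shows "edge_solutions s \<alpha> 0 g (\<lambda>e x. u e x - w e x) (\<lambda>e x. u' e x - w' e x)"
    and "vertex_conditions s (\<lambda>e x. u e x - w e x) (\<lambda>e x. u' e x - w' e x)"
proof -
  show "edge_solutions s \<alpha> 0 g (\<lambda>e x. u e x - w e x) (\<lambda>e x. u' e x - w' e x)"
    unfolding edge_solutions_def
  proof
    fix e assume e: "e \<in> E"
    have "sturm_solution (len s e) (shifted_pot \<alpha> e) (\<lambda>x. 0) (u e) (u' e)"
      "sturm_solution (len s e) (shifted_pot \<alpha> e) (\<lambda>x. 0) (w e) (w' e)"
      using edge_solutionsD[OF assms(3) e] edge_solutionsD[OF assms(5) e] by simp_all
    from sturm_solution_diff[OF shifted_pot_integrable[OF e s]
        absolutely_integrable_const_real absolutely_integrable_const_real this]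
    show "sturm_solution (len s e) (shifted_pot \<alpha> e) (\<lambda>x. 0 * g e x) (\<lambda>x. u e x - w e x) (\<lambda>x. u' e x - w' e x)"
      by simp
  qed
  show "vertex_conditions s (\<lambda>e x. u e x - w e x) (\<lambda>e x. u' e x - w' e x)"
    using assms(4,6) unfolding vertex_conditions_def defect_diff by simp
qed

text \<open>The length enters only through the head end of \<open>e0\<close>, which lies at
  \<open>vh\<close>. Hence a solution for one length keeps satisfying all other conditions when the
  length is changed.\<close>

lemma defect_indep_len:
  assumes v: "v \<in> Vs" "v \<noteq> vh"
  shows "defect t u u' v i = defect s u u' v i"
proof -
  have "ev t u (star \<Gamma> v ! j) = ev s u (star \<Gamma> v ! j)" "ed t u' (star \<Gamma> v ! j) = ed s u' (star \<Gamma> v ! j)"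
    if j: "j < degree_at \<Gamma> v" for j
  proof -
    have "star \<Gamma> v ! j \<in> ends_at \<Gamma> v"
      using star_ends[OF v(1)] length_star[OF v(1)] nth_mem[of j "star \<Gamma> v"] j by simp
    then have "star \<Gamma> v ! j \<noteq> (e0, True)"
      using v(2) by (auto simp: ends_at_def in_arcs_def)
    then show "ev t u (star \<Gamma> v ! j) = ev s u (star \<Gamma> v ! j)" "ed t u' (star \<Gamma> v ! j) = ed s u' (star \<Gamma> v ! j)"
      by (cases "star \<Gamma> v ! j"; auto simp: ev_def ed_def len_def)+
  qed
  then show ?thesis
    unfolding defect_def by (intro sum.cong refl) simp
qed

text \<open>Members of \<open>ham_dom\<close> vanish off the graph, whereas bordered solutions live
  on edges of length \<open>L\<close> and have to be cut at s.\<close>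

definition zero_extension :: "real \<Rightarrow> ('e \<Rightarrow> real \<Rightarrow> complex) \<Rightarrow> 'e \<Rightarrow> real \<Rightarrow> complex" where
  "zero_extension s u e x = (if e \<in> E \<and> x \<in> {0..len s e} then u e x else 0)"

lemma eigenspace_zero_extensionI:
  assumes "edge_solutions s \<alpha> 0 g u u'" "vertex_conditions s u u'" "0 < s" "s < S"
  shows "zero_extension s u \<in> eigenspace (set_length \<Gamma> e0 s) (of_real \<alpha>)"
  using eigenspaceI(1)[OF assms] zero_extension_def by blast

lemma eigenspace_continuous:
  assumes "f \<in> eigenspace (set_length \<Gamma> e0 s) (of_real \<alpha>)" "0 < s"
  shows "edge_continuous s f"
  using edge_solutions_continuous(1)[OF eigenspaceD(1)[OF assms, of f]] .

lemma eigenfunction_eqI: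
  assumes "f \<in> eigenspace (set_length \<Gamma> e0 s) (of_real \<alpha>)" "0 < s"
    and "\<And>e x. e \<in> E \<Longrightarrow> x \<in> {0..len s e} \<Longrightarrow> f e x = w e x"
    and "\<And>e x. \<not> (e \<in> E \<and> x \<in> {0..len s e}) \<Longrightarrow> w e x = 0"
  shows "f = w"
proof (intro ext)
  fix e x
  show "f e x = w e x"
    using assms(3,4)[of e x] eigenspaceD(3)[OF assms(1,2), of e x] by (cases "e \<in> E \<and> x \<in> {0..len s e}") auto
qed

text \<open>The two solutions carry independent parameters, and the integration runs over the graph
  belonging to the second one: this is the pairing of a continued eigenfunction with the
  eigenfunction of another length.\<close>

lemma ip_continuous:
  fixes T :: "(real \<times> real) set"
  assumes L: "L < S"
    and T: "T \<subseteq> UNIV \<times> {0<..<L}"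
    and U: "\<And>e. e \<in> E \<Longrightarrow> continuous_on (T \<times> {0..len L e}) (\<lambda>p. U (fst p) e (snd p))"
  shows "continuous_on (T \<times> T) (\<lambda>p. ip (snd (snd p)) (U (fst p)) (U (snd p)))"
  unfolding ip_def
proof (rule continuous_on_sum)
  fix e assume e: "e \<in> E"
  show "continuous_on (T \<times> T) (\<lambda>p. integral {0..len (snd (snd p)) e} (\<lambda>x. cnj (U (fst p) e x) * U (snd p) e x))"
  proof (rule continuous_on_integral_upper)
    have 1: "continuous_on ((T \<times> T) \<times> {0..len L e}) (\<lambda>p. (fst (fst p), snd p))"
      "continuous_on ((T \<times> T) \<times> {0..len L e}) (\<lambda>p. (snd (fst p), snd p))"
      by (intro continuous_intros)+
    have 2: "(\<lambda>p. (fst (fst p), snd p)) ` ((T \<times> T) \<times> {0..len L e}) \<subseteq> T \<times> {0..len L e}"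
      "(\<lambda>p. (snd (fst p), snd p)) ` ((T \<times> T) \<times> {0..len L e}) \<subseteq> T \<times> {0..len L e}"
      by auto
    show "continuous_on ((T \<times> T) \<times> {0..len L e}) (\<lambda>p. cnj (U (fst (fst p)) e (snd p)) * U (snd (fst p)) e (snd p))"
      using continuous_on_compose2[OF U[OF e] 1(1) 2(1)] continuous_on_compose2[OF U[OF e] 1(2) 2(2)]
      by (intro continuous_on_mult continuous_on_cnj) simp_all
    show "continuous_on (T \<times> T) (\<lambda>p. len (snd (snd p)) e)"
      by (rule continuous_on_compose2[OF continuous_on_len[of UNIV]]) (intro continuous_intros, simp)
    show "0 < len (snd (snd p)) e \<and> len (snd (snd p)) e \<le> len L e" if "p \<in> T \<times> T" for p
      using that T len_pos[OF e, of "snd (snd p)"] len_mono[of "snd (snd p)" L e] by force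
  qed
qed

lemma normalized_eigenfunction:
  assumes s: "0 < s" "s < S" and simple: "simple_eigenvalue (set_length \<Gamma> e0 s) (of_real \<alpha>)"
  obtains g where "g \<in> eigenspace (set_length \<Gamma> e0 s) (of_real \<alpha>)" "ip s g g = 1"
    "\<And>f. f \<in> eigenspace (set_length \<Gamma> e0 s) (of_real \<alpha>) \<Longrightarrow> \<exists>c. f = (\<lambda>e x. c * g e x)"
proof -
  let ?V = "eigenspace (set_length \<Gamma> e0 s) (of_real \<alpha>)"
  obtain h where h0: "h \<noteq> (\<lambda>e x. 0)" and V: "?V = range (\<lambda>c e x. c * h e x)"
    using simple unfolding simple_eigenvalue_def by blast
  have h: "h \<in> ?V"
    unfolding V by (rule range_eqI[of _ _ 1]) simp
  note hc = eigenspace_continuous[OF h s(1)]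
  define N where "N = (\<Sum>e\<in>E. integral {0..len s e} (\<lambda>x. (norm (h e x))\<^sup>2))"
  have ipN: "ip s h h = of_real N"
    unfolding N_def by (rule ip_self[OF hc])
  have "N \<ge> 0"
    unfolding N_def using hc
    by (intro sum_nonneg integral_nonneg integrable_continuous_real continuous_on_power continuous_on_norm)
      (auto simp: edge_continuous_def)
  moreover have "N \<noteq> 0"
  proof
    assume "N = 0"
    then have "h e x = 0" if "e \<in> E" "x \<in> {0..len s e}" for e x
      using ip_self_eq_0D[OF hc s(1) _ that] ipN by simp
    then have "h = (\<lambda>e x. 0)"
      by (intro eigenfunction_eqI[OF h s(1)]) auto
    with h0 show False ..
  qed
  ultimately have N: "N > 0" by simp
  define c where "c = complex_of_real (1 / sqrt N)"
  define g where "g = (\<lambda>e x. c * h e x)"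
  have c0: "c \<noteq> 0" using N by (simp add: c_def)
  show thesis
  proof (rule that[of g])
    show "g \<in> ?V"
      unfolding V g_def by (rule rangeI)
    have "ip s g g = cnj c * c * of_real N"
      unfolding g_def ip_cmult ipN ..
    also have "\<dots> = of_real (1 / sqrt N * (1 / sqrt N) * N)"
      unfolding c_def complex_cnj_complex_of_real of_real_mult[symmetric] ..
    also have "1 / sqrt N * (1 / sqrt N) * N = 1"
      using N by (simp add: field_simps)
    finally show "ip s g g = 1" by simp
    show "\<exists>c. f = (\<lambda>e x. c * g e x)" if "f \<in> ?V" for f
    proof -
      obtain d where "f = (\<lambda>e x. d * h e x)"
        using \<open>f \<in> ?V\<close> unfolding V by blast
      then have "f = (\<lambda>e x. (d / c) * g e x)"
        using c0 by (simp add: g_def)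
      then show ?thesis by blast
    qed
  qed
qed

section \<open>The scalar function whose zeros are the eigenvalues\<close>

text \<open>All formulas for \<open>k\<close> are instances of Green's identity; the forcing terms
  reduce to their coefficients because every bordered solution has pairing 1 with the eigenfunction
  \<open>g\<close>.\<close>

lemma simple_eigenvalue_bordered:
  assumes s0: "0 < s0" "s0 < S" and simple: "simple_eigenvalue (set_length \<Gamma> e0 s0) (of_real \<alpha>0)"
  obtains L and T :: "(real \<times> real) set" and k :: "real \<times> real \<Rightarrow> real"
    and U U' :: "real \<times> real \<Rightarrow> 'e \<Rightarrow> real \<Rightarrow> complex" where
    "L < S" "open T" "(\<alpha>0, s0) \<in> T" "T \<subseteq> UNIV \<times> {0<..<L}" "continuous_on T k"
    "\<And>\<alpha>. (\<alpha>, s0) \<in> T \<Longrightarrow> k (\<alpha>, s0) = \<alpha> - \<alpha>0"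
    "\<And>\<alpha> \<beta> s. (\<alpha>, s) \<in> T \<Longrightarrow> (\<beta>, s) \<in> T \<Longrightarrow>
      of_real (k (\<beta>, s) - k (\<alpha>, s)) = of_real (\<beta> - \<alpha>) * ip s (U (\<alpha>, s)) (U (\<beta>, s))"
    "\<And>e. e \<in> E \<Longrightarrow> continuous_on (T \<times> {0..len L e}) (\<lambda>p. U (fst p) e (snd p))"
    "\<And>e. e \<in> E \<Longrightarrow> continuous_on (T \<times> {0..len L e}) (\<lambda>p. U' (fst p) e (snd p))"
    "ip s0 (U (\<alpha>0, s0)) (U (\<alpha>0, s0)) = 1"
    "\<And>p. p \<in> T \<Longrightarrow> k p = 0 \<Longrightarrow> edge_solutions L (fst p) 0 (\<lambda>e x. 0) (U p) (U' p)"
    "\<And>p. p \<in> T \<Longrightarrow> vertex_conditions (snd p) (U p) (U' p)"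
    "\<And>p. p \<in> T \<Longrightarrow> is_eigenvalue (set_length \<Gamma> e0 (snd p)) (of_real (fst p)) \<longleftrightarrow> k p = 0"
    "\<And>p. p \<in> T \<Longrightarrow> k p = 0 \<Longrightarrow> simple_eigenvalue (set_length \<Gamma> e0 (snd p)) (of_real (fst p))"
    "\<And>p f. p \<in> T \<Longrightarrow> k p = 0 \<Longrightarrow> f \<in> eigenspace (set_length \<Gamma> e0 (snd p)) (of_real (fst p)) \<Longrightarrow>
      \<exists>c. f = (\<lambda>e x. c * zero_extension (snd p) (U p) e x)"
proof -
  \<comment> \<open>The midpoint leaves room for lengths above s0, while the potential is still
    square integrable on [0, L].\<close>
  define L where "L = (s0 + S) / 2"
  have L: "s0 < L" "L < S" using s0 by (simp_all add: L_def)
  obtain g where g: "g \<in> eigenspace (set_length \<Gamma> e0 s0) (of_real \<alpha>0)" and gg: "ip s0 g g = 1"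
    and span: "\<And>f. f \<in> eigenspace (set_length \<Gamma> e0 s0) (of_real \<alpha>0) \<Longrightarrow> \<exists>c. f = (\<lambda>e x. c * g e x)"
    using normalized_eigenfunction[OF s0 simple] by metis
  define g' where "g' e = seg_deriv (len s0 e) (g e)" for e
  have gsol: "edge_solutions s0 \<alpha>0 0 g g g'" and gvc: "vertex_conditions s0 g g'"
    and gz: "\<And>e x. \<not> (e \<in> E \<and> x \<in> {0..len s0 e}) \<Longrightarrow> g e x = 0"
    using eigenspaceD[OF g s0(1)] unfolding g'_def[abs_def] by blast+
  note gc = eigenspace_continuous[OF g s0(1)]
  \<comment> \<open>On the loose edge \<open>g\<close> vanishes at s0 by the Dirichlet condition and
    beyond s0 by convention, so the pieces fit together continuously. No other edge changes its
    length.\<close>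
  have gL: "edge_continuous L g"
    unfolding edge_continuous_def
  proof
    fix e assume e: "e \<in> E"
    have ge: "continuous_on {0..len s0 e} (g e)"
      using gc e by (simp add: edge_continuous_def)
    show "continuous_on {0..len L e} (g e)"
    proof (cases "e = e0")
      case True
      have "g e0 x = 0" if "x \<in> {s0..L}" for x
        using gz[of e0 x] vertex_conditions_dirichlet[OF gvc] that by (cases "x = s0") auto
      then have "continuous_on {s0..L} (g e0)"
        by (intro continuous_on_eq[OF continuous_on_const, of _ 0]) auto
      then have "continuous_on ({0..s0} \<union> {s0..L}) (g e0)"
        using ge True by (intro continuous_on_closed_Un) auto
      moreover have "{0..s0} \<union> {s0..L} = {0..L}"
        using s0 L by auto
      ultimately show ?thesis
        using True by simp
    next
      case False
      then show ?thesis
        using ge by (simp add: len_def)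
    qed
  qed
  \<comment> \<open>Green's identity against \<open>g\<close> gives \<kappa> <g, g> = 0. Then u is
    an eigenfunction, hence a multiple of \<open>g\<close> by simplicity, and the vanishing pairing
    makes the multiple 0.\<close>
  have unique: "\<kappa> = 0 \<and> (\<forall>e\<in>E. \<forall>x\<in>{0..len s0 e}. u e x = 0)"
    if u: "edge_solutions s0 \<alpha>0 \<kappa> g u u'" "vertex_conditions s0 u u'" "ip s0 g u = 0" for \<kappa> u u'
  proof -
    have \<kappa>: "\<kappa> = 0"
      using green_bvp[OF s0 gc gsol gvc u(1,2)] gg by simp
    have "zero_extension s0 u \<in> eigenspace (set_length \<Gamma> e0 s0) (of_real \<alpha>0)"
      using u(1) unfolding \<kappa> by (rule eigenspace_zero_extensionI[OF _ u(2) s0])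
    then obtain c where c: "zero_extension s0 u = (\<lambda>e x. c * g e x)"
      using span by blast
    have "ip s0 g u = ip s0 g (zero_extension s0 u)"
      by (rule ip_cong) (simp_all add: zero_extension_def)
    also have "\<dots> = c"
      unfolding c ip_cmult_right gg by simp
    finally have "c = 0"
      using u(3) by simp
    then have "zero_extension s0 u e x = 0" for e x
      unfolding c by simp
    then have "u e x = 0" if "e \<in> E" "x \<in> {0..len s0 e}" for e x
      using that unfolding zero_extension_def by metis
    then show ?thesis
      using \<kappa> by blast
  qed
  obtain T :: "(real \<times> real) set" and \<kappa> :: "real \<times> real \<Rightarrow> complex"
    and U U' :: "real \<times> real \<Rightarrow> 'e \<Rightarrow> real \<Rightarrow> complex" where
    T: "open T" "(\<alpha>0, s0) \<in> T" "T \<subseteq> UNIV \<times> {0<..<L}"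
    and sol: "\<And>p. p \<in> T \<Longrightarrow> edge_solutions L (fst p) (\<kappa> p) g (U p) (U' p)"
    and vc: "\<And>p. p \<in> T \<Longrightarrow> vertex_conditions (snd p) (U p) (U' p)"
    and gU: "\<And>p. p \<in> T \<Longrightarrow> ip (snd p) g (U p) = 1"
    and \<kappa>_cont: "continuous_on T \<kappa>"
    and U_cont: "\<And>e. e \<in> E \<Longrightarrow> continuous_on (T \<times> {0..len L e}) (\<lambda>p. U (fst p) e (snd p))"
    and U'_cont: "\<And>e. e \<in> E \<Longrightarrow> continuous_on (T \<times> {0..len L e}) (\<lambda>p. U' (fst p) e (snd p))"
    and T_unique: "\<And>p \<kappa> u u'. p \<in> T \<Longrightarrow> edge_solutions (snd p) (fst p) \<kappa> g u u' \<Longrightarrow>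
      vertex_conditions (snd p) u u' \<Longrightarrow> ip (snd p) g u = 0 \<Longrightarrow>
      \<kappa> = 0 \<and> (\<forall>e\<in>E. \<forall>x\<in>{0..len (snd p) e}. u e x = 0)"
  proof (rule bordered_system[OF s0(1) L gL, of \<alpha>0], goal_cases)
    case (1 \<kappa> u u')
    show ?case by (rule unique[OF 1(2-4)])
  next
    case (2 T \<kappa> U U')
    show ?case by (rule 2(1)[OF 2(2-11)])
  qed
  have TS: "0 < snd p" "snd p < S" "snd p \<le> L" if "p \<in> T" for p
    using T(3) L that by force+
  have sol_s: "edge_solutions (snd p) (fst p) (\<kappa> p) g (U p) (U' p)" if "p \<in> T" for p
    by (rule edge_solutions_mono[OF sol[OF that] TS(3)[OF that]])
  have gs: "edge_continuous (snd p) g" if "p \<in> T" for p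
    by (rule edge_continuous_mono[OF gL TS(3)[OF that]])
  \<comment> \<open>Green's identity for two spectral parameters at the same length, with both
    pairings with \<open>g\<close> equal to 1.\<close>
  have diff: "\<kappa> (\<beta>, s) - cnj (\<kappa> (\<alpha>, s)) = of_real (\<beta> - \<alpha>) * ip s (U (\<alpha>, s)) (U (\<beta>, s))"
    if "(\<alpha>, s) \<in> T" "(\<beta>, s) \<in> T" for \<alpha> \<beta> s
    using green_bvp[OF TS(1,2)[OF that(1)] gs[OF that(1)] sol_s[OF that(1)] vc[OF that(1)], of \<beta> "\<kappa> (\<beta>, s)" "U (\<beta>, s)" "U' (\<beta>, s)"]
      sol_s[OF that(2)] vc[OF that(2)] gU[OF that(1)] gU[OF that(2)] ip_cnj[of s "U (\<alpha>, s)" g]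
    by (simp add: algebra_simps)
  define k where "k p = Re (\<kappa> p)" for p
  \<comment> \<open>The preceding formula for equal parameters.\<close>
  have \<kappa>_real: "\<kappa> p = of_real (k p)" if "p \<in> T" for p
  proof -
    have "\<kappa> p = cnj (\<kappa> p)"
      using diff[of "fst p" "snd p" "fst p"] that by simp
    then show ?thesis
      by (simp add: k_def complex_eq_iff)
  qed
  have eig_zero: "f = (\<lambda>e x. 0)"
    if p: "p \<in> T" and f: "f \<in> eigenspace (set_length \<Gamma> e0 (snd p)) (of_real (fst p))" "ip (snd p) g f = 0" for p f
    using T_unique[OF p eigenspaceD(1,2)[OF f(1) TS(1)[OF p]] f(2)]
    by (intro eigenfunction_eqI[OF f(1) TS(1)[OF p]]) auto
  have F: "zero_extension (snd p) (U p) \<in> eigenspace (set_length \<Gamma> e0 (snd p)) (of_real (fst p))"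
    if "p \<in> T" "k p = 0" for p
    using sol_s[OF that(1)] \<kappa>_real[OF that(1)] that(2)
    by (intro eigenspace_zero_extensionI[OF _ vc[OF that(1)] TS(1,2)[OF that(1)]]) simp
  have gF: "ip (snd p) g (zero_extension (snd p) (U p)) = 1" if "p \<in> T" for p
    unfolding gU[OF that, symmetric] by (rule ip_cong) (simp_all add: zero_extension_def)
  \<comment> \<open>Subtracting from f the multiple with the same pairing with \<open>g\<close>
    leaves a solution of the homogeneous bordered problem, which is 0.\<close>
  have range: "\<exists>c. f = (\<lambda>e x. c * zero_extension (snd p) (U p) e x)"
    if p: "p \<in> T" "k p = 0" and f: "f \<in> eigenspace (set_length \<Gamma> e0 (snd p)) (of_real (fst p))" for p f
  proof -
    define c where "c = ip (snd p) g f"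
    note s = TS(1,2)[OF p(1)]
    note F' = eigenspaceD(1)[OF F[OF p] s(1), of g] eigenspaceD(2)[OF F[OF p] s(1)]
    note f' = eigenspaceD(1)[OF f s(1), of g] eigenspaceD(2)[OF f s(1)]
    note fw = bvp_diff[OF s f' bvp_cmult[OF F', of c]]
    have "ip (snd p) g (\<lambda>e x. f e x - c * zero_extension (snd p) (U p) e x) = c - c * 1"
      unfolding ip_diff_right[OF gs[OF p(1)] eigenspace_continuous[OF f s(1)] edge_solutions_continuous(1)[OF bvp_cmult(1)[OF F']]]
        ip_cmult_right gF[OF p(1)] c_def ..
    then have "f e x = c * zero_extension (snd p) (U p) e x" if "e \<in> E" "x \<in> {0..len (snd p) e}" for e x
      using T_unique[OF p(1) fw] that by simp
    then have "f = (\<lambda>e x. c * zero_extension (snd p) (U p) e x)"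
      by (intro eigenfunction_eqI[OF f s(1)]) (auto simp: zero_extension_def)
    then show ?thesis by blast
  qed
  have mult: "(\<lambda>e x. c * zero_extension (snd p) (U p) e x) \<in> eigenspace (set_length \<Gamma> e0 (snd p)) (of_real (fst p))"
    if p: "p \<in> T" "k p = 0" for p c
  proof -
    note s = TS(1,2)[OF p(1)]
    note F' = eigenspaceD(1)[OF F[OF p] s(1), of g] eigenspaceD(2)[OF F[OF p] s(1)]
    have "zero_extension (snd p) (\<lambda>e x. c * zero_extension (snd p) (U p) e x) = (\<lambda>e x. c * zero_extension (snd p) (U p) e x)"
      by (simp add: fun_eq_iff zero_extension_def)
    then show ?thesis
      using eigenspace_zero_extensionI[OF bvp_cmult[OF F', of c] s] by simp
  qed
  have F_nz: "zero_extension (snd p) (U p) \<noteq> (\<lambda>e x. 0)" if "p \<in> T" for p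
  proof
    assume "zero_extension (snd p) (U p) = (\<lambda>e x. 0)"
    then show False
      using gF[OF that] by (simp add: ip_def)
  qed
  have simple_p: "simple_eigenvalue (set_length \<Gamma> e0 (snd p)) (of_real (fst p))" if p: "p \<in> T" "k p = 0" for p
    unfolding simple_eigenvalue_def
    using F_nz[OF p(1)] range[OF p] mult[OF p]
    by (intro exI[of _ "zero_extension (snd p) (U p)"] conjI equalityI subsetI) auto
  have iff: "is_eigenvalue (set_length \<Gamma> e0 (snd p)) (of_real (fst p)) \<longleftrightarrow> k p = 0" if p: "p \<in> T" for p
  proof
    assume "k p = 0"
    then show "is_eigenvalue (set_length \<Gamma> e0 (snd p)) (of_real (fst p))"
      unfolding is_eigenvalue_def using F[OF p] F_nz[OF p] by blast
  next
    assume "is_eigenvalue (set_length \<Gamma> e0 (snd p)) (of_real (fst p))"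
    then obtain f where f: "f \<in> eigenspace (set_length \<Gamma> e0 (snd p)) (of_real (fst p))" "f \<noteq> (\<lambda>e x. 0)"
      unfolding is_eigenvalue_def by blast
    \<comment> \<open>An eigenfunction orthogonal to \<open>g\<close> would solve the homogeneous
      bordered problem. At equal spectral parameters Green's identity leaves only \<kappa> times
      this pairing.\<close>
    then have "ip (snd p) f g \<noteq> 0"
      using eig_zero[OF p f(1)] ip_cnj[of "snd p" f g] by auto
    moreover have "\<kappa> p * ip (snd p) f g = 0"
      using green_bvp[OF TS(1,2)[OF p] gs[OF p] eigenspaceD(1,2)[OF f(1) TS(1)[OF p]] sol_s[OF p] vc[OF p]] by simp
    ultimately show "k p = 0"
      by (simp add: k_def)
  qed
  show thesis
  proof (rule that[of L T k U U'])
    show "continuous_on T k"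
      unfolding k_def by (intro continuous_on_Re \<kappa>_cont)
    \<comment> \<open>Green's identity between \<open>g\<close> itself, with spectral parameter
      \<alpha>0 and no forcing, and the bordered solution for \<alpha>.\<close>
    show "k (\<alpha>, s0) = \<alpha> - \<alpha>0" if p: "(\<alpha>, s0) \<in> T" for \<alpha>
    proof -
      have "\<kappa> (\<alpha>, s0) = of_real (\<alpha> - \<alpha>0)"
        using green_bvp[OF s0 gc gsol gvc, of \<alpha> "\<kappa> (\<alpha>, s0)" "U (\<alpha>, s0)" "U' (\<alpha>, s0)"]
          sol_s[OF p] vc[OF p] gU[OF p] gg by (simp add: algebra_simps)
      then show ?thesis by (simp add: k_def)
    qed
    then have k0: "k (\<alpha>0, s0) = 0"
      using T(2) by simp
    show "of_real (k (\<beta>, s) - k (\<alpha>, s)) = of_real (\<beta> - \<alpha>) * ip s (U (\<alpha>, s)) (U (\<beta>, s))"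
      if "(\<alpha>, s) \<in> T" "(\<beta>, s) \<in> T" for \<alpha> \<beta> s
      using diff[OF that] unfolding \<kappa>_real[OF that(1)] \<kappa>_real[OF that(2)] by simp
    \<comment> \<open>At the base point the bordered solution is a multiple of \<open>g\<close>, and
      the pairing 1 identifies it with \<open>g\<close>.\<close>
    show "ip s0 (U (\<alpha>0, s0)) (U (\<alpha>0, s0)) = 1"
    proof -
      obtain c where c: "zero_extension s0 (U (\<alpha>0, s0)) = (\<lambda>e x. c * g e x)"
        using span F[OF T(2) k0] by auto
      have "c = 1"
        using gF[OF T(2)] unfolding snd_conv c ip_cmult_right gg by simp
      have "ip s0 (U (\<alpha>0, s0)) (U (\<alpha>0, s0)) = ip s0 (zero_extension s0 (U (\<alpha>0, s0))) (zero_extension s0 (U (\<alpha>0, s0)))"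
        by (rule ip_cong) (simp_all add: zero_extension_def)
      also have "\<dots> = 1"
        unfolding c ip_cmult gg \<open>c = 1\<close> by simp
      finally show ?thesis .
    qed
    show "edge_solutions L (fst p) 0 (\<lambda>e x. 0) (U p) (U' p)" if "p \<in> T" "k p = 0" for p
      using sol[OF that(1)] \<kappa>_real[OF that(1)] that(2) by (auto intro: edge_solutions_homogeneous[of _ _ g])
  qed (fact L T U_cont U'_cont vc iff simple_p range)+
qed

text \<open>The derivative is obtained at every s near s0, where the bordered solution is normalized
  only against the eigenfunction at s0; the factor \<open>\<Phi> (p, p)\<close> makes up for the
  difference.\<close>

lemma simple_eigenvalue_curve:
  assumes s0: "0 < s0" "s0 < S" and simple: "simple_eigenvalue (set_length \<Gamma> e0 s0) (complex_of_real \<alpha>0)"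
  shows "\<exists>\<delta>>0. \<exists>\<epsilon>>0. \<exists>lam :: real \<Rightarrow> real. lam s0 = \<alpha>0 \<and>
    (\<forall>s. \<bar>s - s0\<bar> < \<delta> \<longrightarrow>
       0 < s \<and> s < S \<and>
       simple_eigenvalue (set_length \<Gamma> e0 s) (complex_of_real (lam s)) \<and>
       (\<forall>\<mu> :: real. is_eigenvalue (set_length \<Gamma> e0 s) (complex_of_real \<mu>) \<and> \<bar>\<mu> - \<alpha>0\<bar> < \<epsilon>
            \<longleftrightarrow> \<mu> = lam s) \<and>
       (\<forall>f. f \<in> eigenspace (set_length \<Gamma> e0 s) (complex_of_real (lam s)) \<and>
            normalized (set_length \<Gamma> e0 s) f \<longrightarrow>
            (lam has_real_derivative - (norm (seg_deriv s (f e0) s))\<^sup>2) (at s)))"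
proof -
  obtain L and T :: "(real \<times> real) set" and k :: "real \<times> real \<Rightarrow> real"
    and U U' :: "real \<times> real \<Rightarrow> 'e \<Rightarrow> real \<Rightarrow> complex" where
    L: "L < S" and T: "open T" "(\<alpha>0, s0) \<in> T" "T \<subseteq> UNIV \<times> {0<..<L}" and k_cont: "continuous_on T k"
    and k_s0: "\<And>\<alpha>. (\<alpha>, s0) \<in> T \<Longrightarrow> k (\<alpha>, s0) = \<alpha> - \<alpha>0"
    and k_diff: "\<And>\<alpha> \<beta> s. (\<alpha>, s) \<in> T \<Longrightarrow> (\<beta>, s) \<in> T \<Longrightarrow>
      of_real (k (\<beta>, s) - k (\<alpha>, s)) = of_real (\<beta> - \<alpha>) * ip s (U (\<alpha>, s)) (U (\<beta>, s))"
    and U_cont: "\<And>e. e \<in> E \<Longrightarrow> continuous_on (T \<times> {0..len L e}) (\<lambda>p. U (fst p) e (snd p))"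
    and U'_cont: "\<And>e. e \<in> E \<Longrightarrow> continuous_on (T \<times> {0..len L e}) (\<lambda>p. U' (fst p) e (snd p))"
    and U_norm: "ip s0 (U (\<alpha>0, s0)) (U (\<alpha>0, s0)) = 1"
    and sol: "\<And>p. p \<in> T \<Longrightarrow> k p = 0 \<Longrightarrow> edge_solutions L (fst p) 0 (\<lambda>e x. 0) (U p) (U' p)"
    and vc: "\<And>p. p \<in> T \<Longrightarrow> vertex_conditions (snd p) (U p) (U' p)"
    and eig_iff: "\<And>p. p \<in> T \<Longrightarrow> is_eigenvalue (set_length \<Gamma> e0 (snd p)) (of_real (fst p)) \<longleftrightarrow> k p = 0"
    and eig_simple: "\<And>p. p \<in> T \<Longrightarrow> k p = 0 \<Longrightarrow> simple_eigenvalue (set_length \<Gamma> e0 (snd p)) (of_real (fst p))"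
    and eig_span: "\<And>p f. p \<in> T \<Longrightarrow> k p = 0 \<Longrightarrow> f \<in> eigenspace (set_length \<Gamma> e0 (snd p)) (of_real (fst p)) \<Longrightarrow>
      \<exists>c. f = (\<lambda>e x. c * zero_extension (snd p) (U p) e x)"
  proof (rule simple_eigenvalue_bordered[OF assms], goal_cases)
    case (1 L T k U U')
    show ?case by (rule 1(1)[OF 1(2-16)])
  qed
  define p0 where "p0 = (\<alpha>0, s0)"
  define \<Phi> where "\<Phi> q = ip (snd (snd q)) (U (fst q)) (U (snd q))" for q
  define d where "d p = U' p e0 (snd p)" for p
  have TT: "open (T \<times> T)" by (intro open_Times T)
  have \<Phi>_cont: "continuous_on (T \<times> T) \<Phi>"
    unfolding \<Phi>_def by (rule ip_continuous[OF L T(3) U_cont])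
  have d_cont: "continuous_on T d"
  proof -
    have 1: "continuous_on T (\<lambda>p. (p, snd p))"
      by (intro continuous_intros)
    have 2: "(\<lambda>p. (p, snd p)) ` T \<subseteq> T \<times> {0..len L e0}"
      using T(3) by force
    show ?thesis
      unfolding d_def using continuous_on_compose2[OF U'_cont[OF e0_in_E] 1 2] by simp
  qed
  \<comment> \<open>Strictly above the value at the base point, so that the bound persists
    nearby.\<close>
  define C where "C = norm (d p0) + 1"
  text \<open>
    On \<open>W\<close> the solutions for different parameters are far from orthogonal, which makes \<open>k\<close>
    strictly monotone in the spectral parameter, and \<open>d\<close> is bounded, which makes the root of
    \<open>k\<close> continuous in the length.
  \<close>
  define W where "W = ((T \<times> T) \<inter> (\<lambda>q. Re (\<Phi> q)) -` {1/2<..}) \<inter> ((T \<times> T) \<inter> (\<lambda>q. norm (d (snd q))) -` {..<C})"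
  have "continuous_on (T \<times> T) (\<lambda>q. Re (\<Phi> q))"
    by (intro continuous_on_Re \<Phi>_cont)
  moreover have "continuous_on (T \<times> T) (\<lambda>q. norm (d (snd q)))"
    by (intro continuous_on_norm continuous_on_compose2[OF d_cont continuous_on_snd[OF continuous_on_id]]) auto
  ultimately have "open W"
    unfolding W_def
    by (intro open_Int[OF continuous_open_preimage[OF _ TT] continuous_open_preimage[OF _ TT]]) auto
  moreover have "(p0, p0) \<in> W"
    using T(2) U_norm by (simp add: W_def \<Phi>_def C_def p0_def)
  ultimately obtain A B where AB: "open A" "open B" "(p0, p0) \<in> A \<times> B" "A \<times> B \<subseteq> W"
    by (rule open_prod_elim)
  \<comment> \<open>Intersecting the two neighbourhoods lets both parameter pairs range over the
    same set; a second splitting separates \<alpha> from s.\<close>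
  then have "open (A \<inter> B)" "p0 \<in> A \<inter> B" by auto
  then obtain A1 B1 where AB1: "open A1" "open B1" "p0 \<in> A1 \<times> B1" "A1 \<times> B1 \<subseteq> A \<inter> B"
    by (rule open_prod_elim)
  obtain r1 where r1: "r1 > 0" "\<And>\<alpha>. \<bar>\<alpha> - \<alpha>0\<bar> < r1 \<Longrightarrow> \<alpha> \<in> A1"
    using AB1(1,3) unfolding open_dist p0_def dist_real_def by blast
  obtain r2 where r2: "r2 > 0" "\<And>s. \<bar>s - s0\<bar> < r2 \<Longrightarrow> s \<in> B1"
    using AB1(2,3) unfolding open_dist p0_def dist_real_def by blast
  define \<eta> where "\<eta> = min r1 r2"
  have \<eta>: "\<eta> > 0" using r1 r2 by (simp add: \<eta>_def)
  have box: "((\<alpha>, s), (\<beta>, t)) \<in> W"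
    if "\<bar>\<alpha> - \<alpha>0\<bar> < \<eta>" "\<bar>s - s0\<bar> < \<eta>" "\<bar>\<beta> - \<alpha>0\<bar> < \<eta>" "\<bar>t - s0\<bar> < \<eta>" for \<alpha> \<beta> s t
  proof -
    have "(\<alpha>, s) \<in> A1 \<times> B1" "(\<beta>, t) \<in> A1 \<times> B1"
      using that r1(2) r2(2) by (auto simp: \<eta>_def)
    then have "((\<alpha>, s), (\<beta>, t)) \<in> A \<times> B"
      using AB1(4) by blast
    then show ?thesis
      using AB(4) by blast
  qed
  have boxT: "(\<alpha>, s) \<in> T" if "\<bar>\<alpha> - \<alpha>0\<bar> < \<eta>" "\<bar>s - s0\<bar> < \<eta>" for \<alpha> s
    using box[OF that that] by (simp add: W_def)
  have box_ip: "Re (ip t (U (\<alpha>, s)) (U (\<beta>, t))) > 1/2" and box_d: "norm (d (\<beta>, t)) < C"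
    if "\<bar>\<alpha> - \<alpha>0\<bar> < \<eta>" "\<bar>s - s0\<bar> < \<eta>" "\<bar>\<beta> - \<alpha>0\<bar> < \<eta>" "\<bar>t - s0\<bar> < \<eta>" for \<alpha> \<beta> s t
    using box[OF that] by (simp_all add: W_def \<Phi>_def)
  have k_inj: "\<alpha> = \<beta>"
    if "\<bar>\<alpha> - \<alpha>0\<bar> < \<eta>" "\<bar>\<beta> - \<alpha>0\<bar> < \<eta>" "\<bar>s - s0\<bar> < \<eta>" "k (\<alpha>, s) = 0" "k (\<beta>, s) = 0" for \<alpha> \<beta> s
  proof -
    have "of_real (\<beta> - \<alpha>) * ip s (U (\<alpha>, s)) (U (\<beta>, s)) = 0"
      using k_diff[OF boxT[OF that(1,3)] boxT[OF that(2,3)]] that(4,5) by simp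
    moreover have "ip s (U (\<alpha>, s)) (U (\<beta>, s)) \<noteq> 0"
      using box_ip[OF that(1,3) that(2,3)] by auto
    ultimately show ?thesis by simp
  qed
  \<comment> \<open>Half of the box, so that the closed interval from \<alpha>0 - \<epsilon> to
    \<alpha>0 + \<epsilon> stays inside it.\<close>
  define \<epsilon> where "\<epsilon> = \<eta> / 2"
  have \<epsilon>: "0 < \<epsilon>" "\<epsilon> < \<eta>" using \<eta> by (simp_all add: \<epsilon>_def)
  have k_cont_s: "continuous_on {s0 - \<eta><..<s0 + \<eta>} (\<lambda>s. k (\<alpha>, s))" if "\<bar>\<alpha> - \<alpha>0\<bar> < \<eta>" for \<alpha>
    using boxT[OF that] by (intro continuous_on_compose2[OF k_cont] continuous_intros) (auto simp: abs_less_iff)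
  have k_cont_\<alpha>: "continuous_on {\<alpha>0 - \<epsilon>..\<alpha>0 + \<epsilon>} (\<lambda>\<alpha>. k (\<alpha>, s))" if "\<bar>s - s0\<bar> < \<eta>" for s
    using boxT[OF _ that] \<epsilon> by (intro continuous_on_compose2[OF k_cont] continuous_intros) (auto simp: abs_less_iff)
  have ends: "\<bar>\<alpha>0 + \<epsilon> - \<alpha>0\<bar> < \<eta>" "\<bar>\<alpha>0 - \<epsilon> - \<alpha>0\<bar> < \<eta>" "\<bar>s0 - s0\<bar> < \<eta>" "\<bar>\<alpha>0 - \<alpha>0\<bar> < \<eta>"
    using \<epsilon> \<eta> by auto
  \<comment> \<open>At s0 the value is \<epsilon> by the explicit formula for \<open>k\<close>, and
    continuity keeps the sign for nearby s; \<open>d2\<close> does the same at the lower end, where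
    the value is - \<epsilon>.\<close>
  obtain d1 where d1: "d1 > 0" "\<And>s. \<bar>s - s0\<bar> < d1 \<Longrightarrow> k (\<alpha>0 + \<epsilon>, s) > 0"
    by (rule continuous_real_positive_nbhd[OF k_cont_s[OF ends(1)], of s0])
      (use \<eta> \<epsilon> k_s0[OF boxT[OF ends(1,3)]] in auto)
  obtain d2 where d2: "d2 > 0" "\<And>s. \<bar>s - s0\<bar> < d2 \<Longrightarrow> - k (\<alpha>0 - \<epsilon>, s) > 0"
    by (rule continuous_real_positive_nbhd[OF continuous_on_minus[OF k_cont_s[OF ends(2)]], of s0])
      (use \<eta> \<epsilon> k_s0[OF boxT[OF ends(2,3)]] in auto)
  define \<delta> where "\<delta> = min \<eta> (min d1 d2)"
  have \<delta>: "\<delta> > 0" "\<delta> \<le> \<eta>" using \<eta> d1 d2 by (simp_all add: \<delta>_def)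
  \<comment> \<open>Existence of the root comes from the intermediate value theorem, its uniqueness
    from \<open>k_inj\<close>.\<close>
  define lam where "lam s = (SOME \<alpha>. \<bar>\<alpha> - \<alpha>0\<bar> < \<epsilon> \<and> k (\<alpha>, s) = 0)" for s
  have lam: "\<bar>lam s - \<alpha>0\<bar> < \<epsilon>" "k (lam s, s) = 0" if s: "\<bar>s - s0\<bar> < \<delta>" for s
  proof -
    have pos: "k (\<alpha>0 + \<epsilon>, s) > 0" "k (\<alpha>0 - \<epsilon>, s) < 0" and s\<eta>: "\<bar>s - s0\<bar> < \<eta>"
      using d1(2)[of s] d2(2)[of s] s by (auto simp: \<delta>_def)
    obtain \<alpha> where \<alpha>: "\<alpha>0 - \<epsilon> \<le> \<alpha>" "\<alpha> \<le> \<alpha>0 + \<epsilon>" "k (\<alpha>, s) = 0"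
      using IVT'[of "\<lambda>\<alpha>. k (\<alpha>, s)" "\<alpha>0 - \<epsilon>" 0 "\<alpha>0 + \<epsilon>"] pos \<epsilon>(1) k_cont_\<alpha>[OF s\<eta>] by force
    then have "\<alpha> \<noteq> \<alpha>0 - \<epsilon>" "\<alpha> \<noteq> \<alpha>0 + \<epsilon>"
      using pos by auto
    then have "\<bar>\<alpha> - \<alpha>0\<bar> < \<epsilon> \<and> k (\<alpha>, s) = 0"
      using \<alpha> by auto
    then have "\<bar>lam s - \<alpha>0\<bar> < \<epsilon> \<and> k (lam s, s) = 0"
      unfolding lam_def by (rule someI)
    then show "\<bar>lam s - \<alpha>0\<bar> < \<epsilon>" "k (lam s, s) = 0" by auto
  qed
  have lam_\<eta>: "\<bar>lam s - \<alpha>0\<bar> < \<eta>" "\<bar>s - s0\<bar> < \<eta>" if "\<bar>s - s0\<bar> < \<delta>" for s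
    using lam(1)[OF that] that \<epsilon> \<delta> by auto
  have lamT: "(lam s, s) \<in> T" if "\<bar>s - s0\<bar> < \<delta>" for s
    by (rule boxT[OF lam_\<eta>[OF that]])
  have lam_s0: "lam s0 = \<alpha>0"
  proof (rule k_inj)
    show "k (\<alpha>0, s0) = 0"
      using k_s0[OF T(2)] by simp
  qed (use lam_\<eta>[of s0] lam(2)[of s0] \<delta> \<eta> in auto)
  have TS: "0 < s" "s < L" "s < S" if "(\<alpha>, s) \<in> T" for \<alpha> s
    using T(3) L that by force+
  have deriv: "(lam has_real_derivative - (norm (seg_deriv s (f e0) s))\<^sup>2) (at s)"
    if s: "\<bar>s - s0\<bar> < \<delta>" and f: "f \<in> eigenspace (set_length \<Gamma> e0 s) (complex_of_real (lam s))"
      and fn: "normalized (set_length \<Gamma> e0 s) f" for s f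
  proof -
    define p where "p = (lam s, s)"
    have pT: "p \<in> T" and kp: "k p = 0"
      using lamT[OF s] lam(2)[OF s] by (simp_all add: p_def)
    note sp = TS[OF lamT[OF s]]
    have sol_p: "edge_solutions t (lam s) 0 (\<lambda>e x. 0) (U p) (U' p)" if "t \<le> L" for t
      using edge_solutions_mono[OF sol[OF pT kp] that] by (simp add: p_def)
    have u_deriv: "(U p e0 has_vector_derivative U' p e0 s) (at s)"
      using sturm_solution_has_vector_derivative[OF edge_solutionsD[OF sol_p[OF order_refl] e0_in_E], of s "U p e0"] sp
      by (simp add: at_within_Icc_at)
    have u_s: "U p e0 s = 0"
      using vertex_conditions_dirichlet[OF vc[OF pT]] by (simp add: p_def)
    have u_lim: "(U p e0 \<longlongrightarrow> 0) (at s)"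
      using has_vector_derivative_continuous[OF u_deriv] u_s by (simp add: continuous_within)
    have near: "eventually (\<lambda>t. \<bar>t - s0\<bar> < \<delta>) (at s)"
      using eventually_at_in_open'[of "{s0 - \<delta><..<s0 + \<delta>}" s] s
      by (auto simp: abs_less_iff elim!: eventually_mono)
    \<comment> \<open>On the graph of length t the continued solution for s violates only the
      Dirichlet condition at t, while the eigenfunction for t satisfies all conditions; so one
      boundary term survives.\<close>
    have green_t: "of_real (lam s - lam t) * \<Phi> (p, (lam t, t)) = cnj (U p e0 t) * d (lam t, t)"
      if t: "\<bar>t - s0\<bar> < \<delta>" for t
    proof -
      note tp = TS[OF lamT[OF t]]
      have w: "edge_solutions t (lam t) 0 (\<lambda>e x. 0) (U (lam t, t)) (U' (lam t, t))"
        using edge_solutions_mono[OF sol[OF lamT[OF t] lam(2)[OF t]] less_imp_le[OF tp(2)]] by simp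
      have vw: "vertex_conditions t (U (lam t, t)) (U' (lam t, t))"
        using vc[OF lamT[OF t]] by simp
      have "(of_real (lam s) - of_real (lam t)) * ip t (U p) (U (lam t, t)) + 0 * ip t (U p) (\<lambda>e x. 0)
          - cnj 0 * ip t (\<lambda>e x. 0) (U (lam t, t))
          = cnj (U p e0 t) * U' (lam t, t) e0 t - cnj (U' p e0 t) * U (lam t, t) e0 t"
      proof (rule green[OF tp(1,3) _ sol_p w])
        fix v i assume v: "v \<in> Vs" "v \<noteq> vh" "i < degree_at \<Gamma> v"
        show "defect t (U p) (U' p) v i = 0"
          using vertex_conditionsD[OF vc[OF pT] v(1,3)] defect_indep_len[OF v(1,2)] by metis
        show "defect t (U (lam t, t)) (U' (lam t, t)) v i = 0"
          by (rule vertex_conditionsD[OF vw v(1,3)])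
      qed (use tp in \<open>auto simp: edge_continuous_def\<close>)
      then show ?thesis
        using vertex_conditions_dirichlet[OF vw] by (simp add: \<Phi>_def d_def)
    qed
    have \<Phi>_half: "Re (\<Phi> (p, (lam t, t))) > 1/2" if "\<bar>t - s0\<bar> < \<delta>" for t
      using box_ip[OF lam_\<eta>[OF s] lam_\<eta>[OF that]] by (simp add: \<Phi>_def p_def)
    \<comment> \<open>The bounds 1/2 on \<Phi> and C on \<open>d\<close> turn Green's identity into
      an estimate by the value of \<open>U p\<close> at t, which tends to 0. This gives continuity
      of \<open>lam\<close> at s, on which the limits of \<open>d\<close> and \<Phi> depend.\<close>
    have "norm (lam t - lam s) \<le> 2 * C * norm (U p e0 t)" if t: "\<bar>t - s0\<bar> < \<delta>" for t
    proof -
      have "\<bar>lam t - lam s\<bar> * (1/2) \<le> \<bar>lam t - lam s\<bar> * norm (\<Phi> (p, (lam t, t)))"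
        using \<Phi>_half[OF t] complex_Re_le_cmod[of "\<Phi> (p, (lam t, t))"] by (intro mult_left_mono) auto
      also have "\<dots> = norm (of_real (lam s - lam t) * \<Phi> (p, (lam t, t)))"
        by (simp only: norm_mult norm_of_real abs_minus_commute)
      also have "\<dots> = norm (U p e0 t) * norm (d (lam t, t))"
        unfolding green_t[OF t] by (simp add: norm_mult)
      also have "\<dots> \<le> norm (U p e0 t) * C"
        using box_d[OF lam_\<eta>[OF s] lam_\<eta>[OF t]] by (intro mult_left_mono) auto
      finally show ?thesis by (simp add: mult_ac)
    qed
    then have "eventually (\<lambda>t. norm (lam t - lam s) \<le> 2 * C * norm (U p e0 t)) (at s)"
      using near by (auto elim: eventually_mono)
    moreover have "((\<lambda>t. 2 * C * norm (U p e0 t)) \<longlongrightarrow> 0) (at s)"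
      using tendsto_mult_right_zero[OF tendsto_norm_zero[OF u_lim]] by blast
    ultimately have "((\<lambda>t. lam t - lam s) \<longlongrightarrow> 0) (at s)"
      by (rule Lim_null_comparison)
    then have "(lam \<longlongrightarrow> lam s) (at s)"
      by (simp add: LIM_zero_iff)
    then have P_lim: "((\<lambda>t. (lam t, t)) \<longlongrightarrow> p) (at s)"
      unfolding p_def by (intro tendsto_Pair tendsto_ident_at)
    have d_lim: "((\<lambda>t. d (lam t, t)) \<longlongrightarrow> d p) (at s)"
      using continuous_on_eq_continuous_at[OF T(1)] d_cont pT P_lim isCont_tendsto_compose by blast
    have \<Phi>_lim: "((\<lambda>t. \<Phi> (p, (lam t, t))) \<longlongrightarrow> \<Phi> (p, p)) (at s)"
    proof (rule isCont_tendsto_compose[of _ \<Phi>])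
      show "isCont \<Phi> (p, p)"
        using \<Phi>_cont pT continuous_on_eq_continuous_at[OF TT] by blast
    qed (intro tendsto_Pair tendsto_const P_lim)
    have \<Phi>_nz: "\<Phi> (p, p) \<noteq> 0"
      using \<Phi>_half[OF s] by (auto simp: p_def)
    have q_lim: "((\<lambda>t. U p e0 t / of_real (t - s)) \<longlongrightarrow> U' p e0 s) (at s)"
      using has_vector_derivative_quotient_tendsto[OF u_deriv] by (simp add: u_s)
    \<comment> \<open>Green's identity divided by t - s and by \<Phi>. As \<open>U p\<close>
      vanishes at s on the loose edge, its value at t over t - s is a difference quotient.\<close>
    have lim: "((\<lambda>t. - (cnj (U p e0 t / of_real (t - s)) * d (lam t, t) / \<Phi> (p, (lam t, t))))
        \<longlongrightarrow> - (cnj (U' p e0 s) * d p / \<Phi> (p, p))) (at s)"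
      by (intro tendsto_minus tendsto_divide tendsto_mult tendsto_cnj q_lim d_lim \<Phi>_lim \<Phi>_nz)
    have "eventually (\<lambda>t. - (cnj (U p e0 t / of_real (t - s)) * d (lam t, t) / \<Phi> (p, (lam t, t)))
        = of_real ((lam t - lam s) / (t - s))) (at s)"
      using near eventually_neq_at_within[of s s UNIV]
    proof eventually_elim
      case (elim t)
      have nz: "\<Phi> (p, (lam t, t)) \<noteq> 0"
        using \<Phi>_half[OF elim(1)] by auto
      have eq: "cnj (U p e0 t / of_real (t - s)) * d (lam t, t) = of_real ((lam s - lam t) / (t - s)) * \<Phi> (p, (lam t, t))"
        using green_t[OF elim(1)] by (simp add: field_simps)
      have "cnj (U p e0 t / of_real (t - s)) * d (lam t, t) / \<Phi> (p, (lam t, t)) = of_real ((lam s - lam t) / (t - s))"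
        unfolding eq by (rule nonzero_mult_div_cancel_right[OF nz])
      also have "\<dots> = - of_real ((lam t - lam s) / (t - s))"
        by (simp add: minus_divide_left)
      finally show ?case by simp
    qed
    from Lim_transform_eventually[OF lim this]
    have lim': "((\<lambda>t. complex_of_real ((lam t - lam s) / (t - s))) \<longlongrightarrow> - (cnj (U' p e0 s) * d p / \<Phi> (p, p))) (at s)" .
    \<comment> \<open>The given eigenfunction is c times the bordered one, and its normalization
      makes |c|^2 the reciprocal of \<open>\<Phi> (p, p)\<close>, exactly the factor in the
      limit.\<close>
    obtain c where c: "f = (\<lambda>e x. c * zero_extension s (U p) e x)"
      using eig_span[OF pT kp] f by (auto simp: p_def)
    have "ip s f f = 1"
      using fn normalized_iff[OF eigenspace_continuous[OF f sp(1)]] by simp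
    moreover have "ip s f f = cnj c * c * \<Phi> (p, p)"
    proof -
      have "ip s (zero_extension s (U p)) (zero_extension s (U p)) = \<Phi> (p, p)"
        unfolding \<Phi>_def p_def fst_conv snd_conv by (rule ip_cong) (simp_all add: zero_extension_def)
      then show ?thesis
        unfolding c ip_cmult by simp
    qed
    ultimately have c\<Phi>: "cnj c * c = 1 / \<Phi> (p, p)"
      using \<Phi>_nz by (simp add: field_simps)
    have "seg_deriv s (f e0) s = c * U' p e0 s"
    proof (rule sturm_solution_seg_deriv)
      show "sturm_solution s (shifted_pot (lam s) e0) (\<lambda>x. c * (0 * 0)) (\<lambda>x. c * U p e0 x) (\<lambda>x. c * U' p e0 x)"
        using sturm_solution_cmult[OF edge_solutionsD[OF sol_p[OF less_imp_le[OF sp(2)]] e0_in_E], of c] by simp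
      show "f e0 x = c * U p e0 x" if "x \<in> {0..s}" for x
        using that e0_in_E by (simp add: c zero_extension_def)
    qed (use sp in auto)
    then have "complex_of_real ((norm (seg_deriv s (f e0) s))\<^sup>2) = cnj (c * U' p e0 s) * (c * U' p e0 s)"
      by (simp only: complex_norm_square mult.commute)
    also have "\<dots> = cnj c * c * (cnj (U' p e0 s) * U' p e0 s)"
      by (simp add: mult_ac)
    also have "\<dots> = cnj (U' p e0 s) * d p / \<Phi> (p, p)"
      unfolding c\<Phi> by (simp add: d_def p_def)
    finally have "- (cnj (U' p e0 s) * d p / \<Phi> (p, p)) = complex_of_real (- (norm (seg_deriv s (f e0) s))\<^sup>2)"
      by simp
    then show ?thesis
      using lim' unfolding has_field_derivative_iff by (simp only: tendsto_of_real_iff)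
  qed
  show ?thesis
  proof (intro exI conjI allI impI)
    show "\<delta> > 0" "\<epsilon> > 0" "lam s0 = \<alpha>0"
      by (fact \<delta>(1) \<epsilon>(1) lam_s0)+
    fix s assume s: "\<bar>s - s0\<bar> < \<delta>"
    show "0 < s" "s < S"
      using TS[OF lamT[OF s]] by auto
    show "simple_eigenvalue (set_length \<Gamma> e0 s) (complex_of_real (lam s))"
      using eig_simple[OF lamT[OF s] lam(2)[OF s]] by simp
    show "is_eigenvalue (set_length \<Gamma> e0 s) (complex_of_real \<mu>) \<and> \<bar>\<mu> - \<alpha>0\<bar> < \<epsilon> \<longleftrightarrow> \<mu> = lam s" for \<mu>
    proof
      assume \<mu>: "is_eigenvalue (set_length \<Gamma> e0 s) (complex_of_real \<mu>) \<and> \<bar>\<mu> - \<alpha>0\<bar> < \<epsilon>"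
      then have \<mu>\<eta>: "\<bar>\<mu> - \<alpha>0\<bar> < \<eta>"
        using \<epsilon>(2) by simp
      have "k (\<mu>, s) = 0"
        using eig_iff[OF boxT[OF \<mu>\<eta> lam_\<eta>(2)[OF s]]] \<mu> by simp
      then show "\<mu> = lam s"
        using k_inj[OF \<mu>\<eta> lam_\<eta>(1)[OF s] lam_\<eta>(2)[OF s]] lam(2)[OF s] by simp
    next
      assume "\<mu> = lam s"
      then show "is_eigenvalue (set_length \<Gamma> e0 s) (complex_of_real \<mu>) \<and> \<bar>\<mu> - \<alpha>0\<bar> < \<epsilon>"
        using eig_iff[OF lamT[OF s]] lam[OF s] by simp
    qed
    show "(lam has_real_derivative - (norm (seg_deriv s (f e0) s))\<^sup>2) (at s)"
      if "f \<in> eigenspace (set_length \<Gamma> e0 s) (complex_of_real (lam s)) \<and> normalized (set_length \<Gamma> e0 s) f" for f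
      using deriv[OF s] that by blast
  qed
qed

end

text \<open>The eigenvalue as a function of the length is not given in advance: its existence near
  the given length is part of the claim, and the equivalence identifies \<open>lam s\<close> as the
  only real eigenvalue within \<epsilon> of the given one. The formula is stated for every
  normalized eigenfunction, so no choice of phase enters.\<close>

theorem proposition4p1:
  fixes \<Gamma> :: "('v, 'e) qgraph" and e\<^sub>0 :: 'e and S s\<^sub>0 lam\<^sub>0 :: real
  assumes "loose_edge \<Gamma> e\<^sub>0"
    and "dirichlet_at \<Gamma> (head (graph \<Gamma>) e\<^sub>0)"
    and "\<And>s. 0 < s \<Longrightarrow> s < S \<Longrightarrow> compact_quantum_graph (set_length \<Gamma> e\<^sub>0 s)"
    and "0 < s\<^sub>0" and "s\<^sub>0 < S"
    and "simple_eigenvalue (set_length \<Gamma> e\<^sub>0 s\<^sub>0) (complex_of_real lam\<^sub>0)"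
  shows "\<exists>\<delta>>0. \<exists>\<epsilon>>0. \<exists>lam :: real \<Rightarrow> real. lam s\<^sub>0 = lam\<^sub>0 \<and>
    (\<forall>s. \<bar>s - s\<^sub>0\<bar> < \<delta> \<longrightarrow>
       0 < s \<and> s < S \<and>
       simple_eigenvalue (set_length \<Gamma> e\<^sub>0 s) (complex_of_real (lam s)) \<and>
       (\<forall>\<mu> :: real. is_eigenvalue (set_length \<Gamma> e\<^sub>0 s) (complex_of_real \<mu>) \<and> \<bar>\<mu> - lam\<^sub>0\<bar> < \<epsilon>
            \<longleftrightarrow> \<mu> = lam s) \<and>
       (\<forall>f. f \<in> eigenspace (set_length \<Gamma> e\<^sub>0 s) (complex_of_real (lam s)) \<and>
            normalized (set_length \<Gamma> e\<^sub>0 s) f \<longrightarrow>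
            (lam has_real_derivative - (norm (seg_deriv s (f e\<^sub>0) s))\<^sup>2) (at s)))"
proof -
  interpret dirichlet_loose_edge \<Gamma> e\<^sub>0 S
    using assms(1-3) order.strict_trans[OF assms(4,5)] by (rule dirichlet_loose_edge.intro)
  show ?thesis
    by (rule simple_eigenvalue_curve[OF assms(4-6)])
qed

end
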